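(* Let $F:(M_1^{m_1},\phi_1,\xi_1,\eta_1,g_1)\to(M_2^{m_2},g_2)$ be a pointwise slant Riemannian submersion with horizontal space of dimension $s\ge3$ and slant function $\theta$. Then, at every point: (1) If $M_1(c)$ is a Sasakian space form, then $$\rho_{\mathcal H}^{\mathcal H}\le\begin{cases}\delta_C^{\mathcal H}(s-1)+\dfrac{c+3}{4}+\dfrac{3(c-1)}{4s}\cos^2\theta-\dfrac{c-1}{2s},&\xi_1\in\Gamma((\ker F_* )^\perp),\\[6pt]\delta_C^{\mathcal H}(s-1)+\dfrac{c+3}{4}+\dfrac{3(c-1)}{4(s-1)}\cos^2\theta,&\xi_1\in\Gamma(\ker F_* ).\end{cases}$$ (2) If $M_1(c)$ is a Kenmotsu space form, then $$\rho_{\mathcal H}^{\mathcal H}\le\begin{cases}\delta_C^{\mathcal H}(s-1)+\dfrac{c-3}{4}+\dfrac{3(c+1)}{4s}\cos^2\theta-\dfrac{c+1}{2s},&\xi_1\in\Gamma((\ker F_* )^\perp),\\[6pt]\delta_C^{\mathcal H}(s-1)+\dfrac{c-3}{4}+\dfrac{3(c+1)}{4(s-1)}\cos^2\theta,&\xi_1\in\Gamma(\ker F_* ).\end{cases}$$ (3) If $M_1(c)$ is a cosymplectic space form, then $$\rho_{\mathcal H}^{\mathcal H}\le\begin{cases}\delta_C^{\mathcal H}(s-1)+\dfrac{c}{4}+\dfrac{3c}{4s}\cos^2\theta-\dfrac{c}{2s},&\xi_1\in\Gamma((\ker F_* )^\perp),\\[6pt]\delta_C^{\mathcal H}(s-1)+\dfrac{c}{4}+\dfrac{3c}{4(s-1)}\cos^2\theta,&\xi_1\in\Gamma(\ker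 F_* ).\end{cases}$$ (4) If $M_1(c)$ is an almost $C(\alpha)$ space form, then $$\rho_{\mathcal H}^{\mathcal H}\le\begin{cases}\delta_C^{\mathcal H}(s-1)+\dfrac{c+3\alpha^2}{4}+\dfrac{3(c-\alpha^2)}{4s}\cos^2\theta-\dfrac{c-\alpha^2}{2s},&\xi_1\in\Gamma((\ker F_* )^\perp),\\[6pt]\delta_C^{\mathcal H}(s-1)+\dfrac{c+3\alpha^2}{4}+\dfrac{3(c-\alpha^2)}{4(s-1)}\cos^2\theta,&\xi_1\in\Gamma(\ker F_* ).\end{cases}$$ In each of (1)–(4) the same inequalities hold with $\delta_C^{\mathcal H}(s-1)$ replaced by $\hat\delta_C^{\mathcal H}(s-1)$. In all cases, equality holds (identically on $M_1$) if and only if the tensor $A$ vanishes identically, i.e. $A_XY=0$ for all $X,Y\in\Gamma((\ker F_* )^\perp)$, which is equivalent to the horizontal distribution being completely integrable.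
   Context: All manifolds are smooth, connected, without boundary. A Riemannian submersion $F:(M_1^{m_1},g_1)\to(M_2^{m_2},g_2)$ has vertical distribution $\mathcal V=\ker F_*$ (of dimension $r$) and horizontal distribution $\mathcal H=(\ker F_* )^\perp$; $\mathcal V,\mathcal H$ also denote the orthogonal projections. $\nabla$ is the Levi-Civita connection of $g_1$. O'Neill's tensor $A$ is $A_EG=\mathcal V\nabla_{\mathcal HE}\mathcal HG+\mathcal H\nabla_{\mathcal HE}\mathcal VG$; for horizontal $X,Y$, $A_XY=\frac12\mathcal V[X,Y]$. Almost contact metric manifold $(M,\phi,\xi,\eta,g)$: $\phi^2=-I+\eta\otimes\xi$, $\eta(\xi)=1$, $\phi\xi=0$, with $g$ compatible ($g(\phi X,\phi Y)=g(X,Y)-\eta(X)\eta(Y)$). It is a generalized Sasakian space form $M(c_1,c_2,c_3)$ if for smooth functions $c_1,c_2,c_3$ $$\begin{aligned}R(X,Y)Z={}&c_1\{g(Y,Z)X-g(X,Z)Y\}+c_2\{g(X,\phi Z)\phi Y-g(Y,\phi Z)\phi X+2g(X,\phi Y)\phi Z\}\\&+c_3\{\eta(X)\eta(Z)Y-\eta(Y)\eta(Z)X+g(X,Z)\eta(Y)\xi-g(Y,Z)\eta(X)\xi\}.\end{aligned}$$ Special cases ($c,\alpha$ real constants): Sasakian space form: $c_1=\frac{c+3}4$, $c_2=c_3=\frac{c-1}4$; Kenmotsu space form: $c_1=\frac{c-3}4$, $c_2=c_3=\frac{c+1}4$; cosymplectic space form: $c_1=c_2=c_3=\frac c4$; almost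 $C(\alpha)$ space form: $c_1=\frac{c+3\alpha^2}4$, $c_2=c_3=\frac{c-\alpha^2}4$. Pointwise slant: for vertical $U$ and horizontal $X$ write $\phi_1U=P^{\mathcal V}U+Q^{\mathcal V}U$ and $\phi_1X=P^{\mathcal H}X+Q^{\mathcal H}X$ with $P^{\mathcal V}U$, $Q^{\mathcal H}X$ vertical and $Q^{\mathcal V}U$, $P^{\mathcal H}X$ horizontal. The Reeb field $\xi_1$ is either vertical or horizontal. $F$ is pointwise slant with slant function $\theta:M_1\to[0,\pi/2]$ if at each $p$ the angle between $\phi_1U$ and $\mathcal V_p$ equals $\theta(p)$ for every nonzero $U\in\mathcal V_p$ orthogonal to $\xi_1$, i.e. $(P^{\mathcal V})^2=-\cos^2\theta\,I$ on the orthogonal complement of $\xi_1$ in $\mathcal V$. The convention used for the horizontal results is that the analogous identities hold for $P^{\mathcal H}$ with the same $\theta$: $(P^{\mathcal H})^2=-\cos^2\theta\,I$ on $\mathcal H\cap\ker\eta_1$, hence $\|P^{\mathcal H}\|^2=\sum_{i,j=1}^s g_1(X_i,P^{\mathcal H}X_j)^2$ equals $(s-1)\cos^2\theta$ if $\xi_1$ is horizontal and $s\cos^2\theta$ if $\xi_1$ is vertical. Curvature $R^{\mathcal H}$ of the horizontal distribution: it is related to the curvature $R^{M_1}$ of $M_1$, for horizontal $X,Y,Z,W$, by $$g_1(R^{M_1}(X,Y)Z,W)=g_1(R^{\mathcal H}(X,Y)Z,W)-2g_1(A_XY,A_ZW)+g_1(A_YZ,A_XW)-g_1(A_XZ,A_YW),$$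 and this relation is taken as the definition of $R^{\mathcal H}$. For an orthonormal basis $\{X_1,\dots,X_s\}$ of $\mathcal H_p$, $\rho_{\mathcal H}^{\mathcal H}=\frac{1}{s(s-1)}\sum_{i,j=1}^s g_1(R^{\mathcal H}(X_i,X_j)X_j,X_i)$. Horizontal Casorati curvatures at $p$: with $\{U_1,\dots,U_r\}$ an orthonormal basis of $\mathcal V_p$, put $A_{ij}^k=g_1(A_{X_i}X_j,U_k)$ and $C^{\mathcal H}=\frac1s\sum_{k=1}^r\sum_{i,j=1}^s(A_{ij}^k)^2$. For a $q$-dimensional subspace $L\subset\mathcal H_p$ ($q\ge2$) with orthonormal basis $\{X_1,\dots,X_q\}$, $C(L)=\frac1q\sum_{k=1}^r\sum_{i,j=1}^q(A_{ij}^k)^2$. With $L$ ranging over hyperplanes ($(s-1)$-dimensional subspaces) of $\mathcal H_p$, $$\delta_C^{\mathcal H}(s-1)=\tfrac12C^{\mathcal H}+\tfrac{s+1}{2s}\inf_LC(L),\qquad\hat\delta_C^{\mathcal H}(s-1)=2C^{\mathcal H}-\tfrac{2s-1}{2s}\sup_LC(L).$$ *)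

theory Defs
  imports "HOL-Analysis.Analysis"
begin

section \<open>Smooth manifolds\<close>

text \<open>Iterated directional derivatives: on an open set this is the class of k times continuously
  differentiable functions.\<close>

fun Ck_on :: "nat \<Rightarrow> 'e::real_normed_vector set \<Rightarrow> ('e \<Rightarrow> 'f::real_normed_vector) \<Rightarrow> bool" where
  "Ck_on 0 S f \<longleftrightarrow> continuous_on S f"
| "Ck_on (Suc k) S f \<longleftrightarrow>
     (\<forall>x\<in>S. f differentiable (at x)) \<and> (\<forall>v. Ck_on k S (\<lambda>x. frechet_derivative f (at x) v))"

definition smooth_on :: "'e::real_normed_vector set \<Rightarrow> ('e \<Rightarrow> 'f::real_normed_vector) \<Rightarrow> bool" where
  "smooth_on S f \<longleftrightarrow> (\<forall>k. Ck_on k S f)"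

type_synonym ('a, 'e) chart = "'a set \<times> ('a \<Rightarrow> 'e)"

abbreviation cdom :: "('a, 'e) chart \<Rightarrow> 'a set" where "cdom c \<equiv> fst c"
abbreviation cmap :: "('a, 'e) chart \<Rightarrow> 'a \<Rightarrow> 'e" where "cmap c \<equiv> snd c"

definition cinv :: "('a, 'e) chart \<Rightarrow> 'e \<Rightarrow> 'a" where
  "cinv c = inv_into (cdom c) (cmap c)"

text \<open>A manifold has the whole type \<open>'a\<close> as its set of points and is modelled on the Euclidean space
  \<open>'e\<close>, so its dimension is \<open>DIM('e)\<close>. For every point p one chart of the atlas around p is singled
  out, and the tangent space at p is represented by \<open>'e\<close> through this preferred chart. Thus a vector
  field is a function \<open>'a \<Rightarrow> 'e\<close> whose value at p lists the components in the preferred chart at p;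
  these charts jump from point to point, so smoothness is tested only after the change of
  coordinates \<open>dchart\<close> to a fixed chart. The metric at p is a bilinear form on \<open>'e\<close> that is unrelated
  to the inner product of \<open>'e\<close>.\<close>

record ('a, 'e) riem_mfd =
  atlas :: "('a, 'e) chart set"
  gm :: "'a \<Rightarrow> 'e \<Rightarrow> 'e \<Rightarrow> real"

definition smooth_atlas :: "('a::topological_space, 'e::euclidean_space) chart set \<Rightarrow> bool" where
  "smooth_atlas \<A> \<longleftrightarrow>
     (\<forall>c\<in>\<A>. open (cdom c) \<and> open (cmap c ` cdom c) \<and>
        homeomorphism (cdom c) (cmap c ` cdom c) (cmap c) (cinv c)) \<and>
     (\<Union>c\<in>\<A>. cdom c) = UNIV \<and>
     (\<forall>c\<in>\<A>. \<forall>d\<in>\<A>. smooth_on (cmap c ` (cdom c \<inter> cdom d)) (cmap d \<circ> cinv c))"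

definition chart_at :: "('a, 'e) riem_mfd \<Rightarrow> 'a \<Rightarrow> ('a, 'e) chart" where
  "chart_at M p = (SOME c. c \<in> atlas M \<and> p \<in> cdom c)"

abbreviation coord :: "('a, 'e) riem_mfd \<Rightarrow> 'a \<Rightarrow> 'e" where
  "coord M p \<equiv> cmap (chart_at M p) p"

text \<open>The components in the chart c of a tangent vector at p.\<close>

definition dchart ::
  "('a, 'e::euclidean_space) riem_mfd \<Rightarrow> ('a, 'e) chart \<Rightarrow> 'a \<Rightarrow> 'e \<Rightarrow> 'e" where
  "dchart M c p = frechet_derivative (cmap c \<circ> cinv (chart_at M p)) (at (coord M p))"

text \<open>The component function of a vector field in the chart c, on the image of c.\<close>

definition vrep ::
  "('a, 'e::euclidean_space) riem_mfd \<Rightarrow> ('a, 'e) chart \<Rightarrow> ('a \<Rightarrow> 'e) \<Rightarrow> 'e \<Rightarrow> 'e" where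
  "vrep M c X x = dchart M c (cinv c x) (X (cinv c x))"

definition vfield_on ::
  "('a::topological_space, 'e::euclidean_space) riem_mfd \<Rightarrow> 'a set \<Rightarrow> ('a \<Rightarrow> 'e) \<Rightarrow> bool" where
  "vfield_on M U X \<longleftrightarrow> open U \<and> (\<forall>c\<in>atlas M. smooth_on (cmap c ` (U \<inter> cdom c)) (vrep M c X))"

definition smooth_fun_on ::
  "('a::topological_space, 'e::euclidean_space) riem_mfd \<Rightarrow> 'a set \<Rightarrow> ('a \<Rightarrow> real) \<Rightarrow> bool" where
  "smooth_fun_on M U f \<longleftrightarrow>
     open U \<and> (\<forall>c\<in>atlas M. smooth_on (cmap c ` (U \<inter> cdom c)) (f \<circ> cinv c))"

text \<open>The derivative of the function f at p in the direction of the tangent vector v.\<close>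

definition dfun ::
  "('a, 'e::euclidean_space) riem_mfd \<Rightarrow> ('a \<Rightarrow> real) \<Rightarrow> 'a \<Rightarrow> 'e \<Rightarrow> real" where
  "dfun M f p v = frechet_derivative (f \<circ> cinv (chart_at M p)) (at (coord M p)) v"

definition lie_bracket ::
  "('a, 'e::euclidean_space) riem_mfd \<Rightarrow> ('a \<Rightarrow> 'e) \<Rightarrow> ('a \<Rightarrow> 'e) \<Rightarrow> 'a \<Rightarrow> 'e" where
  "lie_bracket M X Y p =
     frechet_derivative (vrep M (chart_at M p) Y) (at (coord M p)) (X p) -
     frechet_derivative (vrep M (chart_at M p) X) (at (coord M p)) (Y p)"

text \<open>The local extension of a tangent vector v at p that has constant components in the preferred
  chart at p. Tensors given by formulas on vector fields are evaluated at tangent vectors through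
  this extension; by tensoriality every other extension gives the same value.\<close>

definition ext_field ::
  "('a, 'e::euclidean_space) riem_mfd \<Rightarrow> 'a \<Rightarrow> 'e \<Rightarrow> 'a \<Rightarrow> 'e" where
  "ext_field M p v q =
     frechet_derivative (cmap (chart_at M q) \<circ> cinv (chart_at M p)) (at (cmap (chart_at M p) q)) v"


section \<open>Metric, connection, curvature\<close>

definition riemannian_manifold ::
  "('a::{t2_space, second_countable_topology}, 'e::euclidean_space) riem_mfd \<Rightarrow> bool" where
  "riemannian_manifold M \<longleftrightarrow>
     smooth_atlas (atlas M) \<and> connected (UNIV :: 'a set) \<and>
     (\<forall>p. bilinear (gm M p) \<and> (\<forall>v w. gm M p v w = gm M p w v) \<and>
        (\<forall>v. v \<noteq> 0 \<longrightarrow> 0 < gm M p v v)) \<and>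
     (\<forall>U X Y. vfield_on M U X \<and> vfield_on M U Y \<longrightarrow>
        smooth_fun_on M U (\<lambda>p. gm M p (X p) (Y p)))"

text \<open>A covariant derivative \<open>D p v Y\<close> is the derivative at p, in the direction of the tangent vector v,
  of a vector field Y that is smooth on some neighbourhood of p.\<close>

type_synonym ('a, 'e) covd = "'a \<Rightarrow> 'e \<Rightarrow> ('a \<Rightarrow> 'e) \<Rightarrow> 'e"

definition affine_connection ::
  "('a::topological_space, 'e::euclidean_space) riem_mfd \<Rightarrow> ('a, 'e) covd \<Rightarrow> bool" where
  "affine_connection M D \<longleftrightarrow>
     (\<forall>U X Y. vfield_on M U X \<and> vfield_on M U Y \<longrightarrow> vfield_on M U (\<lambda>p. D p (X p) Y)) \<and>
     (\<forall>U Y. vfield_on M U Y \<longrightarrow> (\<forall>p\<in>U. linear (\<lambda>v. D p v Y))) \<and>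
     (\<forall>U Y Z. vfield_on M U Y \<and> vfield_on M U Z \<longrightarrow>
        (\<forall>p\<in>U. \<forall>v. D p v (\<lambda>q. Y q + Z q) = D p v Y + D p v Z)) \<and>
     (\<forall>U f Y. smooth_fun_on M U f \<and> vfield_on M U Y \<longrightarrow>
        (\<forall>p\<in>U. \<forall>v. D p v (\<lambda>q. f q *\<^sub>R Y q) = dfun M f p v *\<^sub>R Y p + f p *\<^sub>R D p v Y))"

definition levi_civita ::
  "('a::topological_space, 'e::euclidean_space) riem_mfd \<Rightarrow> ('a, 'e) covd \<Rightarrow> bool" where
  "levi_civita M D \<longleftrightarrow>
     affine_connection M D \<and>
     (\<forall>U X Y. vfield_on M U X \<and> vfield_on M U Y \<longrightarrow>
        (\<forall>p\<in>U. D p (X p) Y - D p (Y p) X = lie_bracket M X Y p)) \<and>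
     (\<forall>U Y Z. vfield_on M U Y \<and> vfield_on M U Z \<longrightarrow>
        (\<forall>p\<in>U. \<forall>v. dfun M (\<lambda>q. gm M q (Y q) (Z q)) p v =
           gm M p (D p v Y) (Z p) + gm M p (Y p) (D p v Z)))"

definition curv_field :: "('a, 'e::euclidean_space) riem_mfd \<Rightarrow> ('a, 'e) covd \<Rightarrow>
    ('a \<Rightarrow> 'e) \<Rightarrow> ('a \<Rightarrow> 'e) \<Rightarrow> ('a \<Rightarrow> 'e) \<Rightarrow> 'a \<Rightarrow> 'e" where
  "curv_field M D X Y Z p =
     D p (X p) (\<lambda>q. D q (Y q) Z) - D p (Y p) (\<lambda>q. D q (X q) Z) - D p (lie_bracket M X Y p) Z"

definition curv :: "('a, 'e::euclidean_space) riem_mfd \<Rightarrow> ('a, 'e) covd \<Rightarrow>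
    'a \<Rightarrow> 'e \<Rightarrow> 'e \<Rightarrow> 'e \<Rightarrow> 'e" where
  "curv M D p x y z = curv_field M D (ext_field M p x) (ext_field M p y) (ext_field M p z) p"


section \<open>Almost contact metric manifolds and space forms\<close>

definition almost_contact_metric :: "('a::topological_space, 'e::euclidean_space) riem_mfd \<Rightarrow>
    ('a \<Rightarrow> 'e \<Rightarrow> 'e) \<Rightarrow> ('a \<Rightarrow> 'e) \<Rightarrow> ('a \<Rightarrow> 'e \<Rightarrow> real) \<Rightarrow> bool" where
  "almost_contact_metric M \<phi> \<xi> \<eta> \<longleftrightarrow>
     (\<forall>p. linear (\<phi> p)) \<and> (\<forall>U X. vfield_on M U X \<longrightarrow> vfield_on M U (\<lambda>p. \<phi> p (X p))) \<and>
     vfield_on M UNIV \<xi> \<and>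
     (\<forall>p. linear (\<eta> p)) \<and> (\<forall>U X. vfield_on M U X \<longrightarrow> smooth_fun_on M U (\<lambda>p. \<eta> p (X p))) \<and>
     (\<forall>p v. \<phi> p (\<phi> p v) = - v + \<eta> p v *\<^sub>R \<xi> p) \<and>
     (\<forall>p. \<eta> p (\<xi> p) = 1) \<and>
     (\<forall>p. \<phi> p (\<xi> p) = 0) \<and>
     (\<forall>p v w. gm M p (\<phi> p v) (\<phi> p w) = gm M p v w - \<eta> p v * \<eta> p w)"

definition gen_sasakian_space_form ::
  "('a::topological_space, 'e::euclidean_space) riem_mfd \<Rightarrow> ('a, 'e) covd \<Rightarrow>
    ('a \<Rightarrow> 'e \<Rightarrow> 'e) \<Rightarrow> ('a \<Rightarrow> 'e) \<Rightarrow> ('a \<Rightarrow> 'e \<Rightarrow> real) \<Rightarrow>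
    ('a \<Rightarrow> real) \<Rightarrow> ('a \<Rightarrow> real) \<Rightarrow> ('a \<Rightarrow> real) \<Rightarrow> bool" where
  "gen_sasakian_space_form M D \<phi> \<xi> \<eta> c1 c2 c3 \<longleftrightarrow>
     almost_contact_metric M \<phi> \<xi> \<eta> \<and>
     smooth_fun_on M UNIV c1 \<and> smooth_fun_on M UNIV c2 \<and> smooth_fun_on M UNIV c3 \<and>
     (\<forall>p x y z. curv M D p x y z =
        c1 p *\<^sub>R (gm M p y z *\<^sub>R x - gm M p x z *\<^sub>R y) +
        c2 p *\<^sub>R (gm M p x (\<phi> p z) *\<^sub>R \<phi> p y - gm M p y (\<phi> p z) *\<^sub>R \<phi> p x
                + (2 * gm M p x (\<phi> p y)) *\<^sub>R \<phi> p z) +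
        c3 p *\<^sub>R ((\<eta> p x * \<eta> p z) *\<^sub>R y - (\<eta> p y * \<eta> p z) *\<^sub>R x
                + (gm M p x z * \<eta> p y) *\<^sub>R \<xi> p - (gm M p y z * \<eta> p x) *\<^sub>R \<xi> p))"

definition sasakian_space_form where
  "sasakian_space_form M D \<phi> \<xi> \<eta> c \<longleftrightarrow> gen_sasakian_space_form M D \<phi> \<xi> \<eta>
     (\<lambda>_. (c + 3) / 4) (\<lambda>_. (c - 1) / 4) (\<lambda>_. (c - 1) / 4)"

definition kenmotsu_space_form where
  "kenmotsu_space_form M D \<phi> \<xi> \<eta> c \<longleftrightarrow> gen_sasakian_space_form M D \<phi> \<xi> \<eta>
     (\<lambda>_. (c - 3) / 4) (\<lambda>_. (c + 1) / 4) (\<lambda>_. (c + 1) / 4)"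

definition cosymplectic_space_form where
  "cosymplectic_space_form M D \<phi> \<xi> \<eta> c \<longleftrightarrow> gen_sasakian_space_form M D \<phi> \<xi> \<eta>
     (\<lambda>_. c / 4) (\<lambda>_. c / 4) (\<lambda>_. c / 4)"

definition almost_C_space_form where
  "almost_C_space_form \<alpha> M D \<phi> \<xi> \<eta> c \<longleftrightarrow> gen_sasakian_space_form M D \<phi> \<xi> \<eta>
     (\<lambda>_. (c + 3 * \<alpha>\<^sup>2) / 4) (\<lambda>_. (c - \<alpha>\<^sup>2) / 4) (\<lambda>_. (c - \<alpha>\<^sup>2) / 4)"


section \<open>Riemannian submersions\<close>

definition smooth_map :: "('a::topological_space, 'e::euclidean_space) riem_mfd \<Rightarrow>
    ('b::topological_space, 'f::euclidean_space) riem_mfd \<Rightarrow> ('a \<Rightarrow> 'b) \<Rightarrow> bool" where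
  "smooth_map M N F \<longleftrightarrow> continuous_on UNIV F \<and>
     (\<forall>c\<in>atlas M. \<forall>d\<in>atlas N.
        smooth_on (cmap c ` (cdom c \<inter> F -` cdom d)) (cmap d \<circ> F \<circ> cinv c))"

text \<open>The differential of F at p, between the tangent spaces at p and at \<open>F p\<close>.\<close>

definition mdiff :: "('a, 'e::euclidean_space) riem_mfd \<Rightarrow> ('b, 'f::euclidean_space) riem_mfd \<Rightarrow>
    ('a \<Rightarrow> 'b) \<Rightarrow> 'a \<Rightarrow> 'e \<Rightarrow> 'f" where
  "mdiff M N F p =
     frechet_derivative (cmap (chart_at N (F p)) \<circ> F \<circ> cinv (chart_at M p)) (at (coord M p))"

definition vertical :: "('a, 'e::euclidean_space) riem_mfd \<Rightarrow> ('b, 'f::euclidean_space) riem_mfd \<Rightarrow>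
    ('a \<Rightarrow> 'b) \<Rightarrow> 'a \<Rightarrow> 'e set" where
  "vertical M N F p = {v. mdiff M N F p v = 0}"

definition orth_compl :: "('a, 'e) riem_mfd \<Rightarrow> ('a \<Rightarrow> 'e set) \<Rightarrow> 'a \<Rightarrow> 'e set" where
  "orth_compl M V p = {w. \<forall>v\<in>V p. gm M p v w = 0}"

definition riemannian_submersion :: "('a::topological_space, 'e::euclidean_space) riem_mfd \<Rightarrow>
    ('b::topological_space, 'f::euclidean_space) riem_mfd \<Rightarrow> ('a \<Rightarrow> 'b) \<Rightarrow> bool" where
  "riemannian_submersion M N F \<longleftrightarrow> smooth_map M N F \<and>
     (\<forall>p. surj (mdiff M N F p)) \<and>
     (\<forall>p. \<forall>x\<in>orth_compl M (vertical M N F) p. \<forall>y\<in>orth_compl M (vertical M N F) p.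
        gm N (F p) (mdiff M N F p x) (mdiff M N F p y) = gm M p x y)"

text \<open>From here on V stands for the vertical distribution; the horizontal one is
  \<open>orth_compl M V\<close>.\<close>

text \<open>Orthogonal projection onto the value at p of the distribution S.\<close>

definition oproj :: "('a, 'e::euclidean_space) riem_mfd \<Rightarrow> ('a \<Rightarrow> 'e set) \<Rightarrow> 'a \<Rightarrow> 'e \<Rightarrow> 'e" where
  "oproj M S p x = (THE y. y \<in> S p \<and> (\<forall>z\<in>S p. gm M p (x - y) z = 0))"

abbreviation hproj :: "('a, 'e::euclidean_space) riem_mfd \<Rightarrow> ('a \<Rightarrow> 'e set) \<Rightarrow> 'a \<Rightarrow> 'e \<Rightarrow> 'e" where
  "hproj M V \<equiv> oproj M (orth_compl M V)"

definition oneill_field :: "('a, 'e::euclidean_space) riem_mfd \<Rightarrow> ('a, 'e) covd \<Rightarrow>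
    ('a \<Rightarrow> 'e set) \<Rightarrow> ('a \<Rightarrow> 'e) \<Rightarrow> ('a \<Rightarrow> 'e) \<Rightarrow> 'a \<Rightarrow> 'e" where
  "oneill_field M D V E G p =
     oproj M V p (D p (hproj M V p (E p)) (\<lambda>q. hproj M V q (G q))) +
     hproj M V p (D p (hproj M V p (E p)) (\<lambda>q. oproj M V q (G q)))"

definition oneill :: "('a, 'e::euclidean_space) riem_mfd \<Rightarrow> ('a, 'e) covd \<Rightarrow>
    ('a \<Rightarrow> 'e set) \<Rightarrow> 'a \<Rightarrow> 'e \<Rightarrow> 'e \<Rightarrow> 'e" where
  "oneill M D V p x y = oneill_field M D V (ext_field M p x) (ext_field M p y) p"

text \<open>Sections of a distribution over open subsets.\<close>

definition section_on :: "('a::topological_space, 'e::euclidean_space) riem_mfd \<Rightarrow>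
    ('a \<Rightarrow> 'e set) \<Rightarrow> 'a set \<Rightarrow> ('a \<Rightarrow> 'e) \<Rightarrow> bool" where
  "section_on M S U X \<longleftrightarrow> vfield_on M U X \<and> (\<forall>p\<in>U. X p \<in> S p)"

definition oneill_vanishes :: "('a::topological_space, 'e::euclidean_space) riem_mfd \<Rightarrow>
    ('a, 'e) covd \<Rightarrow> ('a \<Rightarrow> 'e set) \<Rightarrow> bool" where
  "oneill_vanishes M D V \<longleftrightarrow>
     (\<forall>U X Y. section_on M (orth_compl M V) U X \<and> section_on M (orth_compl M V) U Y \<longrightarrow>
        (\<forall>p\<in>U. oneill_field M D V X Y p = 0))"

text \<open>Completely integrable in the sense of Warner (Foundations of Differentiable Manifolds and
  Lie Groups, Definition 1.56), that is, involutive.\<close>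

definition completely_integrable :: "('a::topological_space, 'e::euclidean_space) riem_mfd \<Rightarrow>
    ('a \<Rightarrow> 'e set) \<Rightarrow> bool" where
  "completely_integrable M S \<longleftrightarrow>
     (\<forall>U X Y. section_on M S U X \<and> section_on M S U Y \<longrightarrow> (\<forall>p\<in>U. lie_bracket M X Y p \<in> S p))"


section \<open>Pointwise slant submersions\<close>

text \<open>The angle at p between a nonzero tangent vector w and \<open>S p\<close>: the cosine is the length of the
  orthogonal projection of w divided by the length of w.\<close>

definition angle_to :: "('a, 'e::euclidean_space) riem_mfd \<Rightarrow> ('a \<Rightarrow> 'e set) \<Rightarrow> 'a \<Rightarrow> 'e \<Rightarrow> real" where
  "angle_to M S p w =
     arccos (sqrt (gm M p (oproj M S p w) (oproj M S p w)) / sqrt (gm M p w w))"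

definition pointwise_slant :: "('a, 'e::euclidean_space) riem_mfd \<Rightarrow> ('a \<Rightarrow> 'e set) \<Rightarrow>
    ('a \<Rightarrow> 'e \<Rightarrow> 'e) \<Rightarrow> ('a \<Rightarrow> 'e) \<Rightarrow> ('a \<Rightarrow> real) \<Rightarrow> bool" where
  "pointwise_slant M V \<phi> \<xi> \<theta> \<longleftrightarrow>
     (\<forall>p. 0 \<le> \<theta> p \<and> \<theta> p \<le> pi / 2) \<and>
     (\<forall>p. \<forall>u\<in>V p. u \<noteq> 0 \<and> gm M p u (\<xi> p) = 0 \<longrightarrow> angle_to M V p (\<phi> p u) = \<theta> p)"

text \<open>The accompanying convention on the horizontal part \<open>\<lambda>x. hproj M V p (\<phi> p x)\<close> of \<open>\<phi>\<close>, with
  the same slant function.\<close>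

definition horizontal_slant :: "('a, 'e::euclidean_space) riem_mfd \<Rightarrow> ('a \<Rightarrow> 'e set) \<Rightarrow>
    ('a \<Rightarrow> 'e \<Rightarrow> 'e) \<Rightarrow> ('a \<Rightarrow> 'e \<Rightarrow> real) \<Rightarrow> ('a \<Rightarrow> real) \<Rightarrow> bool" where
  "horizontal_slant M V \<phi> \<eta> \<theta> \<longleftrightarrow>
     (\<forall>p. \<forall>x\<in>orth_compl M V p. \<eta> p x = 0 \<longrightarrow>
        hproj M V p (\<phi> p (hproj M V p (\<phi> p x))) = - ((cos (\<theta> p))\<^sup>2 *\<^sub>R x))"


section \<open>Scalar curvature and Casorati curvatures of the horizontal distribution\<close>

text \<open>\<open>hcurv M D V p x y z w\<close> is the value of the metric on \<open>R\<^sup>H(x,y)z\<close> and w.\<close>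

definition hcurv :: "('a, 'e::euclidean_space) riem_mfd \<Rightarrow> ('a, 'e) covd \<Rightarrow>
    ('a \<Rightarrow> 'e set) \<Rightarrow> 'a \<Rightarrow> 'e \<Rightarrow> 'e \<Rightarrow> 'e \<Rightarrow> 'e \<Rightarrow> real" where
  "hcurv M D V p x y z w =
     gm M p (curv M D p x y z) w
     + 2 * gm M p (oneill M D V p x y) (oneill M D V p z w)
     - gm M p (oneill M D V p y z) (oneill M D V p x w)
     + gm M p (oneill M D V p x z) (oneill M D V p y w)"

text \<open>An orthonormal basis of the subspace L of the tangent space at p, indexed by
  \<open>0, \<dots>, dim L - 1\<close>. The quantities below do not depend on the choice.\<close>

definition is_onb :: "('a, 'e::euclidean_space) riem_mfd \<Rightarrow> 'a \<Rightarrow> 'e set \<Rightarrow> (nat \<Rightarrow> 'e) \<Rightarrow> bool" where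
  "is_onb M p L X \<longleftrightarrow>
     (\<forall>i<dim L. \<forall>j<dim L. gm M p (X i) (X j) = (if i = j then 1 else 0)) \<and>
     span (X ` {..<dim L}) = L"

definition onb :: "('a, 'e::euclidean_space) riem_mfd \<Rightarrow> 'a \<Rightarrow> 'e set \<Rightarrow> nat \<Rightarrow> 'e" where
  "onb M p L = (SOME X. is_onb M p L X)"

definition hscal :: "('a, 'e::euclidean_space) riem_mfd \<Rightarrow> ('a, 'e) covd \<Rightarrow>
    ('a \<Rightarrow> 'e set) \<Rightarrow> 'a \<Rightarrow> real" where
  "hscal M D V p =
     (let s = dim (orth_compl M V p); X = onb M p (orth_compl M V p)
      in 1 / (real s * (real s - 1)) * (\<Sum>i<s. \<Sum>j<s. hcurv M D V p (X i) (X j) (X j) (X i)))"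

text \<open>The horizontal Casorati curvature of a subspace L of the horizontal space at p; the case
  where L is the whole horizontal space is the horizontal Casorati curvature at p.\<close>

definition casorati :: "('a, 'e::euclidean_space) riem_mfd \<Rightarrow> ('a, 'e) covd \<Rightarrow>
    ('a \<Rightarrow> 'e set) \<Rightarrow> 'a \<Rightarrow> 'e set \<Rightarrow> real" where
  "casorati M D V p L =
     (let q = dim L; X = onb M p L; r = dim (V p); U = onb M p (V p)
      in 1 / real q *
           (\<Sum>k<r. \<Sum>i<q. \<Sum>j<q. (gm M p (oneill M D V p (X i) (X j)) (U k))\<^sup>2))"

definition hyperplanes :: "'e::euclidean_space set \<Rightarrow> 'e set set" where
  "hyperplanes S = {L. subspace L \<and> L \<subseteq> S \<and> dim L = dim S - 1}"

definition delta_C :: "('a, 'e::euclidean_space) riem_mfd \<Rightarrow> ('a, 'e) covd \<Rightarrow>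
    ('a \<Rightarrow> 'e set) \<Rightarrow> 'a \<Rightarrow> real" where
  "delta_C M D V p =
     (let S = orth_compl M V p; s = real (dim S)
      in 1 / 2 * casorati M D V p S
         + (s + 1) / (2 * s) * (INF L\<in>hyperplanes S. casorati M D V p L))"

definition delta_C_hat :: "('a, 'e::euclidean_space) riem_mfd \<Rightarrow> ('a, 'e) covd \<Rightarrow>
    ('a \<Rightarrow> 'e set) \<Rightarrow> 'a \<Rightarrow> real" where
  "delta_C_hat M D V p =
     (let S = orth_compl M V p; s = real (dim S)
      in 2 * casorati M D V p S
         - (2 * s - 1) / (2 * s) * (SUP L\<in>hyperplanes S. casorati M D V p L))"

end

theory Submission
  imports Defs
begin

text \<open>
  Why the theorem holds. Fix a point and an orthonormal basis \<open>X\<^sub>1, \<dots>, X\<^sub>s\<close> of the horizontal space.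
  On horizontal vectors A is alternating with vertical values, so the relation that defines the
  horizontal curvature reduces on planes to O'Neill's formula

    \<open>g(R\<^sup>H(X\<^sub>i, X\<^sub>j) X\<^sub>j, X\<^sub>i) = g(R(X\<^sub>i, X\<^sub>j) X\<^sub>j, X\<^sub>i) - 3 |A X\<^sub>i X\<^sub>j|\<^sup>2\<close>.

  Summing over i and j, the first term gives the curvature terms of the bound: the space form
  equation leaves only the squares of \<open>g(X\<^sub>i, \<phi> X\<^sub>j)\<close> and of \<open>\<eta>(X\<^sub>i)\<close>, the former add up to minus the
  trace of \<open>(P\<^sup>H)\<^sup>2\<close>, which the slant condition determines, and the latter to 1 or 0 according to
  the position of the Reeb field (\<open>sum_horizontal_curvature\<close>). The second term gives
  \<open>- 3 T / (s (s - 1))\<close>, where T is the sum of all \<open>|A X\<^sub>i X\<^sub>j|\<^sup>2\<close>, that is s times the Casorati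
  curvature. On the other side both Casorati invariants are at least a positive multiple of T:
  for the first one this is clear, since the infimum is nonnegative; for the second one, T restricted
  to a hyperplane is at most T, so the supremum is at most \<open>T / (s - 1)\<close>, and the coefficients leave
  a positive remainder. Hence the inequality holds, and equality holds at a point exactly if T
  vanishes there, which means that A vanishes on horizontal vectors (\<open>casorati_bound\<close>).

  The geometric content is that A is alternating (\<open>oneill_alternating\<close>). For a vertical field U and
  horizontal x and y, differentiating \<open>g(Y, U) = 0\<close> gives \<open>g(A x y, U) = - g(y, D x U)\<close>, an expression
  that depends on x and y through their values alone. It remains to see that \<open>g(x, D x U) = 0\<close>
  (\<open>D_vertical_skew\<close>). Extend x to a basic field X, one that is related to a constant coordinate
  field of the base. Then \<open>[X, U]\<close> is vertical and \<open>g(X, X)\<close> is constant along the fibres, so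
  \<open>g(X, D X U) = g(X, D U X) = U (g(X, X)) / 2 = 0\<close>. The same formula shows that the vertical part of
  \<open>[X, Y]\<close> is \<open>2 A X Y\<close> for horizontal X and Y, which gives the equivalence with integrability.

  All this needs smooth projections and smooth basic fields. They come from one lemma,
  \<open>vfield_with_prescribed_products\<close>: along a smooth frame there is a smooth field in its span with
  prescribed smooth inner products with the frame fields. Applied to a coordinate frame it yields
  gradients; the gradients of the pulled back coordinates of the base are a frame of the horizontal
  distribution, and applied to them it yields horizontal projections and basic fields.
\<close>


section \<open>Calculus of smooth maps between Euclidean spaces\<close>

lemma frechet_eqI: "(f has_derivative f') (at x) \<Longrightarrow> frechet_derivative f (at x) = f'"
  using frechet_derivative_at by metis

lemma frechet_derivative_cong:
  assumes "open S" "x \<in> S" "\<And>y. y \<in> S \<Longrightarrow> f y = g y"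
  shows "frechet_derivative f (at x) = frechet_derivative g (at x)"
proof -
  have "(f has_derivative f') (at x) \<longleftrightarrow> (g has_derivative f') (at x)" for f'
    using assms has_derivative_transform_within_open[of f f' x UNIV S g]
      has_derivative_transform_within_open[of g f' x UNIV S f] by metis
  then show ?thesis unfolding frechet_derivative_def by simp
qed

lemma differentiable_cong:
  assumes "open S" "x \<in> S" "\<And>y. y \<in> S \<Longrightarrow> f y = g y" "f differentiable (at x)"
  shows "g differentiable (at x)"
  using assms has_derivative_transform_within_open unfolding differentiable_def by metis

lemma Ck_on_subset: "Ck_on k S f \<Longrightarrow> T \<subseteq> S \<Longrightarrow> Ck_on k T f"
  by (induction k arbitrary: f) (auto intro: continuous_on_subset)

lemma Ck_on_cong:
  assumes "open S" "\<And>x. x \<in> S \<Longrightarrow> f x = g x" "Ck_on k S f"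
  shows "Ck_on k S g"
  using assms(2,3)
proof (induction k arbitrary: f g)
  case 0
  then show ?case using continuous_on_cong by fastforce
next
  case (Suc k)
  have "g differentiable (at x)" if "x \<in> S" for x
    using Suc.prems that assms(1) differentiable_cong[of S x f g] by auto
  moreover have "Ck_on k S (\<lambda>x. frechet_derivative g (at x) v)" for v
  proof (rule Suc.IH)
    show "Ck_on k S (\<lambda>x. frechet_derivative f (at x) v)" using Suc.prems by simp
    show "frechet_derivative f (at x) v = frechet_derivative g (at x) v" if "x \<in> S" for x
      using frechet_derivative_cong[OF assms(1) that] Suc.prems by metis
  qed
  ultimately show ?case by simp
qed

lemma Ck_on_Suc_imp: "Ck_on (Suc k) S f \<Longrightarrow> Ck_on k S f"
proof (induction k arbitrary: f)
  case 0
  then have "f differentiable_on S" by (intro differentiable_at_imp_differentiable_on) auto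
  then show ?case by (simp add: differentiable_imp_continuous_on)
next
  case (Suc k)
  then show ?case by (metis Ck_on.simps(2))
qed

lemma Ck_on_Suc_has_derivative:
  "Ck_on (Suc k) S f \<Longrightarrow> x \<in> S \<Longrightarrow> (f has_derivative frechet_derivative f (at x)) (at x)"
  using frechet_derivative_works by auto

lemma Ck_on_SucI:
  assumes "open S" "\<And>x. x \<in> S \<Longrightarrow> (f has_derivative f' x) (at x)" "\<And>v. Ck_on k S (\<lambda>x. f' x v)"
  shows "Ck_on (Suc k) S f"
proof -
  have "Ck_on k S (\<lambda>x. frechet_derivative f (at x) v)" for v
    by (rule Ck_on_cong[OF assms(1) _ assms(3)[of v]]) (simp add: frechet_eqI[OF assms(2)])
  then show ?thesis using assms(2) by (auto simp: differentiable_def)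
qed

lemma Ck_on_const: "Ck_on k S (\<lambda>x. a)"
  by (induction k arbitrary: a) auto

lemma Ck_on_bounded_linear_compose:
  assumes "open S" "bounded_linear L"
  shows "Ck_on k S f \<Longrightarrow> Ck_on k S (\<lambda>x. L (f x))"
proof (induction k arbitrary: f)
  case 0
  then show ?case using assms by (auto intro: bounded_linear.continuous_on)
next
  case (Suc k)
  show ?case
  proof (rule Ck_on_SucI[OF assms(1)])
    show "((\<lambda>x. L (f x)) has_derivative (\<lambda>v. L (frechet_derivative f (at x) v))) (at x)"
      if "x \<in> S" for x
      using bounded_linear.has_derivative[OF assms(2) Ck_on_Suc_has_derivative[OF Suc.prems that]]
      by (simp add: o_def)
    show "Ck_on k S (\<lambda>x. L (frechet_derivative f (at x) v))" for v
      using Suc by simp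
  qed
qed

lemma Ck_on_add:
  assumes "open S"
  shows "Ck_on k S f \<Longrightarrow> Ck_on k S g \<Longrightarrow> Ck_on k S (\<lambda>x. f x + g x)"
proof (induction k arbitrary: f g)
  case 0
  then show ?case by (auto intro: continuous_intros)
next
  case (Suc k)
  show ?case
    by (rule Ck_on_SucI[OF assms has_derivative_add[OF Suc.prems(1)[THEN Ck_on_Suc_has_derivative]
          Suc.prems(2)[THEN Ck_on_Suc_has_derivative]]]) (use Suc in auto)
qed

lemma Ck_on_scaleR:
  assumes "open S"
  shows "Ck_on k S f \<Longrightarrow> Ck_on k S g \<Longrightarrow> Ck_on k S (\<lambda>x. f x *\<^sub>R g x)"
proof (induction k arbitrary: f g)
  case 0
  then show ?case by (auto intro: continuous_intros)
next
  case (Suc k)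
  have prod: "Ck_on k S (\<lambda>x. f x *\<^sub>R frechet_derivative g (at x) v + frechet_derivative f (at x) v *\<^sub>R g x)"
    for v
    using Suc.prems Suc.prems[THEN Ck_on_Suc_imp] by (intro Ck_on_add[OF assms] Suc.IH) simp_all
  show ?case
    by (rule Ck_on_SucI[OF assms has_derivative_scaleR[OF Suc.prems(1)[THEN Ck_on_Suc_has_derivative]
          Suc.prems(2)[THEN Ck_on_Suc_has_derivative]] prod])
qed

lemma Ck_on_sum:
  assumes "open S" "\<And>i. i \<in> I \<Longrightarrow> Ck_on k S (f i)"
  shows "Ck_on k S (\<lambda>x. \<Sum>i\<in>I. f i x)"
  using assms(2) by (induction I rule: infinite_finite_induct)
    (auto intro: Ck_on_const Ck_on_add[OF assms(1)])

lemma Ck_on_inverse: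
  fixes f :: "'e::real_normed_vector \<Rightarrow> real"
  assumes "open S" "\<And>x. x \<in> S \<Longrightarrow> f x \<noteq> 0"
  shows "Ck_on k S f \<Longrightarrow> Ck_on k S (\<lambda>x. inverse (f x))"
proof (induction k)
  case 0
  then show ?case using assms by (auto intro!: continuous_intros)
next
  case (Suc k)
  have inv: "Ck_on k S (\<lambda>x. inverse (f x))" using Suc Ck_on_Suc_imp by blast
  show ?case
  proof (rule Ck_on_SucI[OF assms(1)])
    show "((\<lambda>x. inverse (f x)) has_derivative
        (\<lambda>v. inverse (f x) *\<^sub>R inverse (f x) *\<^sub>R (- 1) *\<^sub>R frechet_derivative f (at x) v)) (at x)"
      if "x \<in> S" for x
      using Deriv.has_derivative_inverse[OF assms(2)[OF that] Ck_on_Suc_has_derivative[OF Suc.prems that]]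
      by (simp add: algebra_simps)
    show "Ck_on k S (\<lambda>x. inverse (f x) *\<^sub>R inverse (f x) *\<^sub>R (- 1) *\<^sub>R frechet_derivative f (at x) v)" for v
      using Suc.prems inv by (intro Ck_on_scaleR assms(1) Ck_on_const) auto
  qed
qed

text \<open>The derivative of \<open>g \<circ> f\<close> in the direction v is the sum of the derivatives of g along the
  basis vectors, weighted by the components of the derivative of f. Every direction occurring in
  it is constant, so the induction hypothesis applies to the derivatives of g.\<close>

lemma Ck_on_compose:
  fixes f :: "'e::real_normed_vector \<Rightarrow> 'f::euclidean_space"
  assumes "open S" "open T" "f ` S \<subseteq> T"
  shows "Ck_on k S f \<Longrightarrow> Ck_on k T g \<Longrightarrow> Ck_on k S (\<lambda>x. g (f x))"
proof (induction k arbitrary: g)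
  case 0
  then show ?case
    using assms continuous_on_compose2[of T g S f] by auto
next
  case (Suc k)
  define g' where "g' y = frechet_derivative g (at y)" for y
  define f' where "f' y = frechet_derivative f (at y)" for y
  have g': "(g has_derivative g' y) (at y)" if "y \<in> T" for y
    using Ck_on_Suc_has_derivative[OF Suc.prems(2) that] by (simp add: g'_def)
  have f': "(f has_derivative f' x) (at x)" if "x \<in> S" for x
    using Ck_on_Suc_has_derivative[OF Suc.prems(1) that] by (simp add: f'_def)
  show ?case
  proof (rule Ck_on_SucI[OF assms(1)])
    fix x assume x: "x \<in> S"
    then have fx: "f x \<in> T" using assms by auto
    have lin: "linear (g' (f x))" using g'[OF fx] has_derivative_linear by blast
    have "g' (f x) (f' x v) = (\<Sum>b\<in>Basis. (f' x v \<bullet> b) *\<^sub>R g' (f x) b)" for v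
      by (subst euclidean_representation[of "f' x v", symmetric])
        (simp add: linear_sum[OF lin] linear_cmul[OF lin] del: euclidean_representation)
    then show "((\<lambda>x. g (f x)) has_derivative (\<lambda>v. \<Sum>b\<in>Basis. (f' x v \<bullet> b) *\<^sub>R g' (f x) b)) (at x)"
      using has_derivative_compose[OF f'[OF x] g'[OF fx]] by simp
  next
    have c: "Ck_on k S f" using Suc.prems Ck_on_Suc_imp by blast
    show "Ck_on k S (\<lambda>x. \<Sum>b\<in>Basis. (f' x v \<bullet> b) *\<^sub>R g' (f x) b)" for v
      using Suc.prems
      by (intro Ck_on_sum assms Ck_on_scaleR
            Ck_on_bounded_linear_compose[OF assms(1) bounded_linear_inner_left] Suc.IH[OF c])
        (auto simp: f'_def g'_def)
  qed
qed

lemma smooth_on_subset: "smooth_on S f \<Longrightarrow> T \<subseteq> S \<Longrightarrow> smooth_on T f"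
  unfolding smooth_on_def using Ck_on_subset by blast

lemma smooth_on_cong: "open S \<Longrightarrow> (\<And>x. x \<in> S \<Longrightarrow> f x = g x) \<Longrightarrow> smooth_on S f \<Longrightarrow> smooth_on S g"
  unfolding smooth_on_def using Ck_on_cong by blast

lemma smooth_on_const: "smooth_on S (\<lambda>x. a)"
  unfolding smooth_on_def using Ck_on_const by blast

lemma smooth_on_add:
  "open S \<Longrightarrow> smooth_on S f \<Longrightarrow> smooth_on S g \<Longrightarrow> smooth_on S (\<lambda>x. f x + g x)"
  unfolding smooth_on_def using Ck_on_add by blast

lemma smooth_on_scaleR:
  "open S \<Longrightarrow> smooth_on S f \<Longrightarrow> smooth_on S g \<Longrightarrow> smooth_on S (\<lambda>x. f x *\<^sub>R g x)"
  unfolding smooth_on_def using Ck_on_scaleR by blast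

lemma smooth_on_sum:
  "open S \<Longrightarrow> (\<And>i. i \<in> I \<Longrightarrow> smooth_on S (f i)) \<Longrightarrow> smooth_on S (\<lambda>x. \<Sum>i\<in>I. f i x)"
  unfolding smooth_on_def by (auto intro!: Ck_on_sum)

lemma smooth_on_inverse:
  fixes f :: "'e::real_normed_vector \<Rightarrow> real"
  shows "open S \<Longrightarrow> (\<And>x. x \<in> S \<Longrightarrow> f x \<noteq> 0) \<Longrightarrow> smooth_on S f \<Longrightarrow> smooth_on S (\<lambda>x. inverse (f x))"
  unfolding smooth_on_def using Ck_on_inverse by blast

lemma smooth_on_inner:
  "open S \<Longrightarrow> smooth_on S f \<Longrightarrow> smooth_on S (\<lambda>x. f x \<bullet> b)"
  unfolding smooth_on_def using Ck_on_bounded_linear_compose[OF _ bounded_linear_inner_left] by blast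

lemma smooth_on_compose:
  fixes f :: "'e::real_normed_vector \<Rightarrow> 'f::euclidean_space"
  shows "open S \<Longrightarrow> open T \<Longrightarrow> f ` S \<subseteq> T \<Longrightarrow> smooth_on S f \<Longrightarrow> smooth_on T g \<Longrightarrow>
    smooth_on S (\<lambda>x. g (f x))"
  unfolding smooth_on_def using Ck_on_compose[of S T f] by blast

lemma smooth_on_has_derivative:
  "smooth_on S f \<Longrightarrow> x \<in> S \<Longrightarrow> (f has_derivative frechet_derivative f (at x)) (at x)"
  unfolding smooth_on_def using Ck_on_Suc_has_derivative by blast

lemma smooth_on_derivative:
  "smooth_on S f \<Longrightarrow> smooth_on S (\<lambda>x. frechet_derivative f (at x) v)"
  unfolding smooth_on_def by (metis Ck_on.simps(2))

lemma smooth_on_continuous_on: "smooth_on S f \<Longrightarrow> continuous_on S f"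
  unfolding smooth_on_def by (metis Ck_on.simps(1))

lemma linear_euclidean_expansion:
  fixes L :: "'e::euclidean_space \<Rightarrow> 'f::real_vector"
  assumes "linear L"
  shows "L v = (\<Sum>b\<in>Basis. (v \<bullet> b) *\<^sub>R L b)"
  by (subst euclidean_representation[of v, symmetric])
    (simp add: linear_sum[OF assms] linear_cmul[OF assms] del: euclidean_representation)

lemma smooth_on_derivative_apply:
  fixes f :: "'e::euclidean_space \<Rightarrow> 'f::real_normed_vector"
  assumes "open S" "smooth_on S f" "smooth_on S w"
  shows "smooth_on S (\<lambda>x. frechet_derivative f (at x) (w x))"
proof (rule smooth_on_cong[OF assms(1)])
  show "smooth_on S (\<lambda>x. \<Sum>b\<in>Basis. (w x \<bullet> b) *\<^sub>R frechet_derivative f (at x) b)"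
    by (intro smooth_on_sum smooth_on_scaleR smooth_on_inner smooth_on_derivative assms)
  show "(\<Sum>b\<in>Basis. (w x \<bullet> b) *\<^sub>R frechet_derivative f (at x) b) = frechet_derivative f (at x) (w x)"
    if "x \<in> S" for x
    using linear_euclidean_expansion[OF
        has_derivative_linear[OF smooth_on_has_derivative[OF assms(2) that]]] by metis
qed

text \<open>A second difference over a parallelogram with sides \<open>t v\<close> and \<open>t w\<close> is \<open>t\<^sup>2\<close> times a second
  derivative at a nearby point, by the mean value theorem applied once in each direction.\<close>

lemma second_difference:
  fixes f :: "'e::euclidean_space \<Rightarrow> real"
  assumes f: "smooth_on S f" and ball: "ball x r \<subseteq> S" and t: "0 < t" "t * (norm v + norm w) < r"
  shows "\<exists>y. norm (y - x) \<le> t * (norm v + norm w) \<and>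
    f (x + t *\<^sub>R v + t *\<^sub>R w) - f (x + t *\<^sub>R v) - f (x + t *\<^sub>R w) + f x =
      t * (t * frechet_derivative (\<lambda>z. frechet_derivative f (at z) v) (at y) w)"
proof -
  define fv where "fv z = frechet_derivative f (at z) v" for z
  have fv: "smooth_on S fv" unfolding fv_def by (rule smooth_on_derivative[OF f])
  have near: "norm (a *\<^sub>R v + b *\<^sub>R w) \<le> t * (norm v + norm w)"
    if "0 \<le> a" "a \<le> t" "0 \<le> b" "b \<le> t" for a b
  proof -
    have "norm (a *\<^sub>R v + b *\<^sub>R w) \<le> a * norm v + b * norm w"
      using norm_triangle_ineq[of "a *\<^sub>R v" "b *\<^sub>R w"] that by simp
    also have "\<dots> \<le> t * norm v + t * norm w"
      using that by (intro add_mono mult_right_mono) auto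
    finally show ?thesis by (simp add: algebra_simps)
  qed
  have inS: "x + a *\<^sub>R v + b *\<^sub>R w \<in> S" if "0 \<le> a" "a \<le> t" "0 \<le> b" "b \<le> t" for a b
  proof -
    have "dist x (x + a *\<^sub>R v + b *\<^sub>R w) = norm (a *\<^sub>R v + b *\<^sub>R w)"
      by (simp add: dist_norm norm_minus_commute algebra_simps)
    then show ?thesis using near[OF that] t ball by (metis mem_ball order_le_less_trans subsetD)
  qed
  have derf: "((\<lambda>a. f (x + a *\<^sub>R v + b *\<^sub>R w)) has_real_derivative fv (x + a *\<^sub>R v + b *\<^sub>R w)) (at a)"
    if "0 \<le> a" "a \<le> t" "0 \<le> b" "b \<le> t" for a b
  proof -
    have "((\<lambda>a. x + a *\<^sub>R v + b *\<^sub>R w) has_derivative (\<lambda>h. h *\<^sub>R v)) (at a)"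
      by (auto intro!: derivative_eq_intros)
    from has_derivative_compose[OF this smooth_on_has_derivative[OF f inS[OF that]]]
    show ?thesis
      unfolding has_field_derivative_def fv_def
      by (rule has_derivative_eq_rhs) (simp add: fun_eq_iff linear_cmul[OF has_derivative_linear[OF smooth_on_has_derivative[OF f inS[OF that]]]]
          mult.commute)
  qed
  have derfv: "((\<lambda>b. fv (x + a *\<^sub>R v + b *\<^sub>R w)) has_real_derivative
        frechet_derivative fv (at (x + a *\<^sub>R v + b *\<^sub>R w)) w) (at b)"
    if "0 \<le> a" "a \<le> t" "0 \<le> b" "b \<le> t" for a b
  proof -
    have "((\<lambda>b. x + a *\<^sub>R v + b *\<^sub>R w) has_derivative (\<lambda>h. h *\<^sub>R w)) (at b)"
      by (auto intro!: derivative_eq_intros)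
    from has_derivative_compose[OF this smooth_on_has_derivative[OF fv inS[OF that]]]
    show ?thesis
      unfolding has_field_derivative_def
      by (rule has_derivative_eq_rhs) (simp add: fun_eq_iff linear_cmul[OF has_derivative_linear[OF smooth_on_has_derivative[OF fv inS[OF that]]]]
          mult.commute)
  qed
  have "((\<lambda>a. f (x + a *\<^sub>R v + t *\<^sub>R w) - f (x + a *\<^sub>R v + 0 *\<^sub>R w)) has_real_derivative
      fv (x + a *\<^sub>R v + t *\<^sub>R w) - fv (x + a *\<^sub>R v + 0 *\<^sub>R w)) (at a)" if "0 \<le> a" "a \<le> t" for a
    using that t(1) by (intro DERIV_diff derf) auto
  from MVT2[OF t(1) this] obtain a where a: "0 < a" "a < t" and
    eq1: "(f (x + t *\<^sub>R v + t *\<^sub>R w) - f (x + t *\<^sub>R v)) - (f (x + t *\<^sub>R w) - f x) =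
      t * (fv (x + a *\<^sub>R v + t *\<^sub>R w) - fv (x + a *\<^sub>R v))"
    by auto
  from MVT2[OF t(1) derfv[of a]] a obtain b where b: "0 < b" "b < t" and
    eq2: "fv (x + a *\<^sub>R v + t *\<^sub>R w) - fv (x + a *\<^sub>R v) =
      t * frechet_derivative fv (at (x + a *\<^sub>R v + b *\<^sub>R w)) w"
    by auto
  have "norm ((x + a *\<^sub>R v + b *\<^sub>R w) - x) \<le> t * (norm v + norm w)"
    using near[of a b] a b by (simp add: add.assoc)
  then show ?thesis using eq1 eq2 unfolding fv_def by (intro exI[of _ "x + a *\<^sub>R v + b *\<^sub>R w"]) auto
qed

text \<open>The second difference is symmetric in v and w, so both mixed derivatives are limits of the same
  quotients.\<close>

lemma symmetric_second_derivative:
  fixes f :: "'e::euclidean_space \<Rightarrow> real"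
  assumes "open S" and f: "smooth_on S f" and "x \<in> S"
  shows "frechet_derivative (\<lambda>z. frechet_derivative f (at z) v) (at x) w =
    frechet_derivative (\<lambda>z. frechet_derivative f (at z) w) (at x) v"
proof -
  define p where "p y = frechet_derivative (\<lambda>z. frechet_derivative f (at z) v) (at y) w" for y
  define q where "q y = frechet_derivative (\<lambda>z. frechet_derivative f (at z) w) (at y) v" for y
  obtain r where r: "0 < r" "ball x r \<subseteq> S" using assms openE by blast
  (* The steps t n shrink to 0 and keep the parallelograms inside the ball. *)
  define d where "d = norm v + norm w + 1"
  have d: "0 < d" unfolding d_def by (smt (verit) norm_ge_zero)
  define t where "t n = r / (d * real (Suc n + 1))" for n
  have t0: "0 < t n" for n using r d by (auto simp: t_def)
  have tr: "t n * (norm v + norm w) < r" for n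
  proof -
    have "t n * (norm v + norm w) < t n * d" using t0 by (simp add: d_def)
    also have "\<dots> = r / real (Suc n + 1)" using d by (simp add: t_def)
    also have "\<dots> \<le> r" using r by (simp add: field_simps)
    finally show ?thesis .
  qed
  have ex: "\<exists>y z. norm (y - x) \<le> t n * (norm v + norm w) \<and> norm (z - x) \<le> t n * (norm v + norm w)
      \<and> p y = q z" for n
  proof -
    obtain y where y: "norm (y - x) \<le> t n * (norm v + norm w)"
      "f (x + t n *\<^sub>R v + t n *\<^sub>R w) - f (x + t n *\<^sub>R v) - f (x + t n *\<^sub>R w) + f x = t n * (t n * p y)"
      using second_difference[OF f r(2) t0 tr] unfolding p_def by blast
    obtain z where z: "norm (z - x) \<le> t n * (norm w + norm v)"
      "f (x + t n *\<^sub>R w + t n *\<^sub>R v) - f (x + t n *\<^sub>R w) - f (x + t n *\<^sub>R v) + f x = t n * (t n * q z)"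
      using second_difference[OF f r(2) t0, of n w v] tr[of n] unfolding q_def
      by (auto simp: add.commute)
    have "t n * (t n * p y) = t n * (t n * q z)"
      using y(2) z(2) by (simp add: algebra_simps)
    then have "p y = q z" using t0[of n] by simp
    then show ?thesis using y(1) z(1) by (auto simp: add.commute)
  qed
  obtain y z where yz: "norm (y n - x) \<le> t n * (norm v + norm w)"
      "norm (z n - x) \<le> t n * (norm v + norm w)" "p (y n) = q (z n)" for n
    using ex by metis
  have "(\<lambda>n. 1 / real (Suc (n + 1))) \<longlonglongrightarrow> 0"
    using LIMSEQ_Suc[OF lim_1_over_n] LIMSEQ_ignore_initial_segment by fastforce
  then have "(\<lambda>n. r / d * (norm v + norm w) * (1 / real (Suc (n + 1)))) \<longlonglongrightarrow> r / d * (norm v + norm w) * 0"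
    by (rule tendsto_mult_left)
  then have lim: "(\<lambda>n. t n * (norm v + norm w)) \<longlonglongrightarrow> 0"
    by (simp add: t_def field_simps)
  have toI: "u \<longlonglongrightarrow> x" if "\<And>n. norm (u n - x) \<le> t n * (norm v + norm w)" for u
    by (rule LIM_zero_cancel, rule Lim_null_comparison[OF _ lim]) (use that in auto)
  have "(\<lambda>n. k (u n)) \<longlonglongrightarrow> k x" if "continuous_on S k" "u \<longlonglongrightarrow> x" for k :: "'e \<Rightarrow> real" and u
    using that assms by (simp add: continuous_on_eq_continuous_at isCont_tendsto_compose)
  moreover have "continuous_on S p" "continuous_on S q"
    unfolding p_def q_def by (intro smooth_on_continuous_on smooth_on_derivative f)+
  ultimately have "(\<lambda>n. p (y n)) \<longlonglongrightarrow> p x" "(\<lambda>n. q (z n)) \<longlonglongrightarrow> q x"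
    using toI yz(1,2) by blast+
  then have "p x = q x" using yz(3) LIMSEQ_unique by auto
  then show ?thesis by (simp add: p_def q_def)
qed

section \<open>Charts, vector fields and smooth functions\<close>

locale riemannian_mfd =
  fixes M :: "('a::{t2_space, second_countable_topology}, 'e::euclidean_space) riem_mfd"
  assumes riem: "riemannian_manifold M"
begin

lemma smooth_atlas: "smooth_atlas (atlas M)"
  using riem by (simp add: riemannian_manifold_def)

lemma open_cdom: "c \<in> atlas M \<Longrightarrow> open (cdom c)"
  using smooth_atlas by (simp add: smooth_atlas_def)

lemma chart_homeomorphism:
  "c \<in> atlas M \<Longrightarrow> homeomorphism (cdom c) (cmap c ` cdom c) (cmap c) (cinv c)"
  using smooth_atlas by (simp add: smooth_atlas_def)

lemma cinv_cmap [simp]: "c \<in> atlas M \<Longrightarrow> q \<in> cdom c \<Longrightarrow> cinv c (cmap c q) = q"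
  using chart_homeomorphism by (metis homeomorphism_apply1)

lemma open_chart_image:
  assumes "c \<in> atlas M" "open U"
  shows "open (cmap c ` (U \<inter> cdom c))"
proof -
  have "openin (top_of_set (cdom c)) (U \<inter> cdom c)" using assms by (metis Int_commute openin_open_Int)
  from homeomorphism_imp_open_map[OF chart_homeomorphism[OF assms(1)] this]
  show ?thesis using smooth_atlas assms(1) openin_open_trans by (metis smooth_atlas_def)
qed

lemma chart_at: "chart_at M p \<in> atlas M" "p \<in> cdom (chart_at M p)"
proof -
  have "\<exists>c. c \<in> atlas M \<and> p \<in> cdom c" using smooth_atlas unfolding smooth_atlas_def by blast
  then have "chart_at M p \<in> atlas M \<and> p \<in> cdom (chart_at M p)"
    unfolding chart_at_def by (rule someI_ex)
  then show "chart_at M p \<in> atlas M" "p \<in> cdom (chart_at M p)" by auto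
qed

lemma smooth_transition:
  "c \<in> atlas M \<Longrightarrow> c' \<in> atlas M \<Longrightarrow>
    smooth_on (cmap c ` (cdom c' \<inter> cdom c)) (cmap c' \<circ> cinv c)"
  using smooth_atlas by (auto simp: smooth_atlas_def Int_commute)

lemma transition_has_derivative:
  assumes "c \<in> atlas M" "c' \<in> atlas M" "q \<in> cdom c" "q \<in> cdom c'"
  shows "(cmap c' \<circ> cinv c has_derivative
    frechet_derivative (cmap c' \<circ> cinv c) (at (cmap c q))) (at (cmap c q))"
  using smooth_on_has_derivative[OF smooth_transition] assms by blast

text \<open>The chain rule for a change of charts. Every later passage between a chart fixed on a
  neighbourhood and the preferred chart at a point, in which tangent vectors are represented, is an
  instance of it.\<close>

lemma chart_change_has_derivative:
  assumes c: "c \<in> atlas M" "c' \<in> atlas M" "q \<in> cdom c" "q \<in> cdom c'"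
    and f: "(f \<circ> cinv c) differentiable (at (cmap c q))"
  shows "(f \<circ> cinv c' has_derivative
    (\<lambda>v. frechet_derivative (f \<circ> cinv c) (at (cmap c q))
      (frechet_derivative (cmap c \<circ> cinv c') (at (cmap c' q)) v))) (at (cmap c' q))"
proof -
  have "(f \<circ> cinv c has_derivative frechet_derivative (f \<circ> cinv c) (at (cmap c q)))
      (at ((cmap c \<circ> cinv c') (cmap c' q)))"
    using f c frechet_derivative_works by auto
  from has_derivative_compose[OF transition_has_derivative[OF c(2,1,4,3)] this]
  have "((\<lambda>x. (f \<circ> cinv c) ((cmap c \<circ> cinv c') x)) has_derivative
    (\<lambda>v. frechet_derivative (f \<circ> cinv c) (at (cmap c q))
      (frechet_derivative (cmap c \<circ> cinv c') (at (cmap c' q)) v))) (at (cmap c' q))" .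
  then show ?thesis
    by (rule has_derivative_transform_within_open[OF _ open_chart_image[OF c(2) open_cdom[OF c(1)]]])
      (use c in auto)
qed

lemma chart_change:
  assumes "c \<in> atlas M" "c' \<in> atlas M" "q \<in> cdom c" "q \<in> cdom c'"
    and "(f \<circ> cinv c) differentiable (at (cmap c q))"
  shows "frechet_derivative (f \<circ> cinv c') (at (cmap c' q)) v =
    frechet_derivative (f \<circ> cinv c) (at (cmap c q))
      (frechet_derivative (cmap c \<circ> cinv c') (at (cmap c' q)) v)"
  using frechet_eqI[OF chart_change_has_derivative[OF assms]] by simp

lemma transition_self:
  assumes "c \<in> atlas M" "q \<in> cdom c"
  shows "frechet_derivative (cmap c \<circ> cinv c) (at (cmap c q)) v = v"
proof -
  have "frechet_derivative (cmap c \<circ> cinv c) (at (cmap c q)) =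
      frechet_derivative (\<lambda>x. x) (at (cmap c q))"
    by (rule frechet_derivative_cong[OF open_chart_image[OF assms(1) open_cdom[OF assms(1)]]])
      (use assms in auto)
  then show ?thesis by simp
qed

lemma transition_cocycle:
  assumes "c \<in> atlas M" "c' \<in> atlas M" "c'' \<in> atlas M" "q \<in> cdom c" "q \<in> cdom c'" "q \<in> cdom c''"
  shows "frechet_derivative (cmap c'' \<circ> cinv c') (at (cmap c' q))
      (frechet_derivative (cmap c' \<circ> cinv c) (at (cmap c q)) v) =
    frechet_derivative (cmap c'' \<circ> cinv c) (at (cmap c q)) v"
  using chart_change[of c' c q "cmap c''" v] transition_has_derivative[of c' c'' q] assms
  by (metis differentiable_def)

lemma dchart_transition:
  assumes "c \<in> atlas M" "c' \<in> atlas M" "q \<in> cdom c" "q \<in> cdom c'"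
  shows "frechet_derivative (cmap c' \<circ> cinv c) (at (cmap c q)) (dchart M c q v) = dchart M c' q v"
  unfolding dchart_def by (rule transition_cocycle) (use assms chart_at in auto)

lemma dchart_self [simp]: "dchart M (chart_at M p) p v = v"
  unfolding dchart_def by (rule transition_self) (use chart_at in auto)

lemma linear_dchart: "c \<in> atlas M \<Longrightarrow> q \<in> cdom c \<Longrightarrow> linear (dchart M c q)"
  unfolding dchart_def using transition_has_derivative[of "chart_at M q" c q] chart_at
    has_derivative_linear by blast

lemma dchart_ext_field:
  assumes "q \<in> cdom (chart_at M p)"
  shows "dchart M (chart_at M p) q (ext_field M p v q) = v"
  unfolding dchart_def ext_field_def
  by (subst transition_cocycle) (use assms chart_at transition_self in auto)

lemma ext_field_dchart:
  assumes "q \<in> cdom (chart_at M p)"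
  shows "ext_field M p (dchart M (chart_at M p) q v) q = v"
  unfolding dchart_def ext_field_def
  by (subst transition_cocycle) (use assms chart_at transition_self in auto)

lemma ext_field_self [simp]: "ext_field M p v p = v"
  unfolding ext_field_def by (rule transition_self) (use chart_at in auto)

lemma linear_ext_field: "q \<in> cdom (chart_at M p) \<Longrightarrow> linear (\<lambda>v. ext_field M p v q)"
  unfolding ext_field_def
  using transition_has_derivative[of "chart_at M p" "chart_at M q" q] chart_at
    has_derivative_linear by blast

lemma dchart_inject:
  assumes "c \<in> atlas M" "q \<in> cdom c" "dchart M c q v = 0"
  shows "v = 0"
proof -
  have "v = frechet_derivative (cmap (chart_at M q) \<circ> cinv c) (at (cmap c q)) (dchart M c q v)"
    using dchart_transition[of c "chart_at M q" q v] assms chart_at by simp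
  also have "\<dots> = 0"
    using transition_has_derivative[of c "chart_at M q" q] assms chart_at
      has_derivative_linear linear_0 by metis
  finally show ?thesis .
qed

lemma vfield_on_open: "vfield_on M U X \<Longrightarrow> open U"
  by (simp add: vfield_on_def)

lemma smooth_fun_on_open: "smooth_fun_on M U f \<Longrightarrow> open U"
  by (simp add: smooth_fun_on_def)

lemma smooth_fun_on_iff:
  "smooth_fun_on M U f \<longleftrightarrow>
    open U \<and> (\<forall>c\<in>atlas M. smooth_on (cmap c ` (U \<inter> cdom c)) (\<lambda>x. f (cinv c x)))"
  unfolding smooth_fun_on_def comp_def by (rule refl)

lemma vfield_on_subset: "vfield_on M U X \<Longrightarrow> open W \<Longrightarrow> W \<subseteq> U \<Longrightarrow> vfield_on M W X"
  unfolding vfield_on_def by (meson Int_mono image_mono order_refl smooth_on_subset)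

lemma smooth_fun_on_subset: "smooth_fun_on M U f \<Longrightarrow> open W \<Longrightarrow> W \<subseteq> U \<Longrightarrow> smooth_fun_on M W f"
  unfolding smooth_fun_on_def by (meson Int_mono image_mono order_refl smooth_on_subset)

lemma vfield_on_cong:
  assumes "vfield_on M U X" "\<And>q. q \<in> U \<Longrightarrow> X q = Y q"
  shows "vfield_on M U Y"
  unfolding vfield_on_def
proof (intro conjI ballI)
  show U: "open U" using assms vfield_on_open by blast
  fix c assume c: "c \<in> atlas M"
  show "smooth_on (cmap c ` (U \<inter> cdom c)) (vrep M c Y)"
    by (rule smooth_on_cong[OF open_chart_image[OF c U], of "vrep M c X"])
      (use assms c in \<open>auto simp: vfield_on_def vrep_def\<close>)
qed

lemma smooth_fun_on_cong:
  assumes "smooth_fun_on M U f" "\<And>q. q \<in> U \<Longrightarrow> f q = g q"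
  shows "smooth_fun_on M U g"
  unfolding smooth_fun_on_def
proof (intro conjI ballI)
  show U: "open U" using assms smooth_fun_on_open by blast
  fix c assume c: "c \<in> atlas M"
  show "smooth_on (cmap c ` (U \<inter> cdom c)) (g \<circ> cinv c)"
    by (rule smooth_on_cong[OF open_chart_image[OF c U], of "f \<circ> cinv c"])
      (use assms c in \<open>auto simp: smooth_fun_on_def\<close>)
qed

lemma vfield_on_add:
  assumes "vfield_on M U X" "vfield_on M U Y"
  shows "vfield_on M U (\<lambda>q. X q + Y q)"
  unfolding vfield_on_def
proof (intro conjI ballI)
  show U: "open U" using assms vfield_on_open by blast
  fix c assume c: "c \<in> atlas M"
  have "smooth_on (cmap c ` (U \<inter> cdom c)) (\<lambda>x. vrep M c X x + vrep M c Y x)"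
    using assms c U by (intro smooth_on_add open_chart_image) (auto simp: vfield_on_def)
  then show "smooth_on (cmap c ` (U \<inter> cdom c)) (vrep M c (\<lambda>q. X q + Y q))"
    by (rule smooth_on_cong[OF open_chart_image[OF c U], rotated])
      (use c in \<open>auto simp: vrep_def linear_add[OF linear_dchart[OF c]]\<close>)
qed

lemma vfield_on_scaleR:
  assumes "smooth_fun_on M U f" "vfield_on M U X"
  shows "vfield_on M U (\<lambda>q. f q *\<^sub>R X q)"
  unfolding vfield_on_def
proof (intro conjI ballI)
  show U: "open U" using assms vfield_on_open by blast
  fix c assume c: "c \<in> atlas M"
  have "smooth_on (cmap c ` (U \<inter> cdom c)) (\<lambda>x. f (cinv c x) *\<^sub>R vrep M c X x)"
    using assms c U by (intro smooth_on_scaleR open_chart_image) (auto simp: vfield_on_def smooth_fun_on_iff)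
  then show "smooth_on (cmap c ` (U \<inter> cdom c)) (vrep M c (\<lambda>q. f q *\<^sub>R X q))"
    by (rule smooth_on_cong[OF open_chart_image[OF c U], rotated])
      (use c in \<open>auto simp: vrep_def linear_cmul[OF linear_dchart[OF c]]\<close>)
qed

lemma smooth_fun_on_const: "open U \<Longrightarrow> smooth_fun_on M U (\<lambda>q. a)"
  by (auto simp: smooth_fun_on_def o_def intro: smooth_on_const)

lemma smooth_fun_on_add:
  assumes "smooth_fun_on M U f" "smooth_fun_on M U g"
  shows "smooth_fun_on M U (\<lambda>q. f q + g q)"
  using assms unfolding smooth_fun_on_def o_def
  by (auto intro!: smooth_on_add open_chart_image)

lemma smooth_fun_on_mult:
  assumes "smooth_fun_on M U f" "smooth_fun_on M U g"
  shows "smooth_fun_on M U (\<lambda>q. f q * g q)"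
  using assms unfolding smooth_fun_on_def o_def real_scaleR_def[symmetric]
  by (auto intro!: smooth_on_scaleR open_chart_image simp del: real_scaleR_def)

lemma smooth_fun_on_divide:
  assumes "smooth_fun_on M U f" "smooth_fun_on M U g" "\<And>q. q \<in> U \<Longrightarrow> g q \<noteq> 0"
  shows "smooth_fun_on M U (\<lambda>q. f q / g q)"
proof -
  have "smooth_fun_on M U (\<lambda>q. inverse (g q))"
    unfolding smooth_fun_on_iff
  proof (intro conjI ballI)
    show U: "open U" using assms smooth_fun_on_open by blast
    fix c assume c: "c \<in> atlas M"
    have "g (cinv c x) \<noteq> 0" if "x \<in> cmap c ` (U \<inter> cdom c)" for x
      using that assms(3) c by auto
    then show "smooth_on (cmap c ` (U \<inter> cdom c)) (\<lambda>x. inverse (g (cinv c x)))"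
      using assms(2) c U by (intro smooth_on_inverse open_chart_image) (auto simp: smooth_fun_on_iff)
  qed
  from smooth_fun_on_mult[OF assms(1) this] show ?thesis by (simp add: divide_inverse)
qed

lemma smooth_fun_on_diff:
  assumes "smooth_fun_on M U f" "smooth_fun_on M U g"
  shows "smooth_fun_on M U (\<lambda>q. f q - g q)"
  using smooth_fun_on_add[OF assms(1) smooth_fun_on_mult[OF
        smooth_fun_on_const[OF smooth_fun_on_open[OF assms(1)], of "-1"] assms(2)]] by simp

lemma vfield_on_diff:
  assumes "vfield_on M U X" "vfield_on M U Y"
  shows "vfield_on M U (\<lambda>q. X q - Y q)"
  using vfield_on_add[OF assms(1) vfield_on_scaleR[OF
        smooth_fun_on_const[OF vfield_on_open[OF assms(1)], of "-1"] assms(2)]] by simp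

lemma vfield_on_zero:
  assumes "open U"
  shows "vfield_on M U (\<lambda>q. 0)"
  unfolding vfield_on_def
proof (intro conjI ballI assms)
  fix c assume c: "c \<in> atlas M"
  show "smooth_on (cmap c ` (U \<inter> cdom c)) (vrep M c (\<lambda>q. 0))"
    by (rule smooth_on_cong[OF open_chart_image[OF c assms] _ smooth_on_const[of _ 0]])
      (use c in \<open>auto simp: vrep_def linear_0[OF linear_dchart[OF c]]\<close>)
qed

text \<open>In the chart c the field with constant components in the preferred chart at p is the derivative
  of a transition map, taken at a point that depends smoothly on the coordinates.\<close>

lemma vfield_on_ext_field: "vfield_on M (cdom (chart_at M p)) (ext_field M p v)"
  unfolding vfield_on_def
proof (intro conjI ballI)
  show "open (cdom (chart_at M p))" using chart_at open_cdom by blast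
next
  define d where "d = chart_at M p"
  have d: "d \<in> atlas M" using chart_at by (simp add: d_def)
  fix c assume c: "c \<in> atlas M"
  have sm: "smooth_on (cmap c ` (cdom d \<inter> cdom c))
      (\<lambda>x. frechet_derivative (cmap c \<circ> cinv d) (at ((cmap d \<circ> cinv c) x)) v)"
  proof (rule smooth_on_compose[where T = "cmap d ` (cdom c \<inter> cdom d)" and f = "cmap d \<circ> cinv c"
        and g = "\<lambda>y. frechet_derivative (cmap c \<circ> cinv d) (at y) v"])
    show "smooth_on (cmap d ` (cdom c \<inter> cdom d)) (\<lambda>y. frechet_derivative (cmap c \<circ> cinv d) (at y) v)"
      by (rule smooth_on_derivative[OF smooth_transition[OF d c]])
    show "smooth_on (cmap c ` (cdom d \<inter> cdom c)) (cmap d \<circ> cinv c)"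
      by (rule smooth_transition[OF c d])
    show "open (cmap c ` (cdom d \<inter> cdom c))" "open (cmap d ` (cdom c \<inter> cdom d))"
      using c d open_chart_image open_cdom by metis+
    show "(cmap d \<circ> cinv c) ` cmap c ` (cdom d \<inter> cdom c) \<subseteq> cmap d ` (cdom c \<inter> cdom d)"
      using c by auto
  qed
  have eq: "frechet_derivative (cmap c \<circ> cinv d) (at ((cmap d \<circ> cinv c) x)) v =
      vrep M c (ext_field M p v) x" if "x \<in> cmap c ` (cdom d \<inter> cdom c)" for x
  proof -
    obtain q where q: "q \<in> cdom d" "q \<in> cdom c" "x = cmap c q" using \<open>x \<in> _\<close> by blast
    show ?thesis
      using dchart_transition[OF d c q(1,2), of "ext_field M p v q"] q c d dchart_ext_field[of q p v]
      by (simp add: vrep_def d_def)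
  qed
  show "smooth_on (cmap c ` (cdom (chart_at M p) \<inter> cdom c)) (vrep M c (ext_field M p v))"
    unfolding d_def[symmetric]
    by (rule smooth_on_cong[OF open_chart_image[OF c open_cdom[OF d]] eq sm])
qed

lemma smooth_fun_on_has_derivative:
  assumes "smooth_fun_on M U f" "c \<in> atlas M" "q \<in> U" "q \<in> cdom c"
  shows "(f \<circ> cinv c has_derivative frechet_derivative (f \<circ> cinv c) (at (cmap c q))) (at (cmap c q))"
proof (rule smooth_on_has_derivative)
  show "smooth_on (cmap c ` (U \<inter> cdom c)) (f \<circ> cinv c)"
    using assms(1,2) by (simp add: smooth_fun_on_def)
qed (use assms(3,4) in \<open>intro imageI IntI\<close>)

lemma dfun_chart:
  assumes "(f \<circ> cinv c) differentiable (at (cmap c q))" "c \<in> atlas M" "q \<in> cdom c"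
  shows "dfun M f q v = frechet_derivative (f \<circ> cinv c) (at (cmap c q)) (dchart M c q v)"
  unfolding dfun_def dchart_def
  by (rule chart_change) (use assms chart_at in auto)

lemma linear_dfun:
  assumes "smooth_fun_on M U f" "q \<in> U"
  shows "linear (dfun M f q)"
  unfolding dfun_def using smooth_fun_on_has_derivative[OF assms(1) chart_at(1) assms(2) chart_at(2)]
    has_derivative_linear by metis

lemma dfun_cong:
  assumes "open U" "p \<in> U" "\<And>q. q \<in> U \<Longrightarrow> f q = g q"
  shows "dfun M f p v = dfun M g p v"
proof -
  have "frechet_derivative (f \<circ> cinv (chart_at M p)) (at (coord M p)) =
     frechet_derivative (g \<circ> cinv (chart_at M p)) (at (coord M p))"
    by (rule frechet_derivative_cong[OF open_chart_image[OF chart_at(1) assms(1)]])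
      (use assms chart_at in auto)
  then show ?thesis by (simp add: dfun_def)
qed

lemma dfun_const [simp]: "dfun M (\<lambda>q. a) p v = 0"
  by (simp add: dfun_def o_def)

text \<open>In a fixed chart \<open>dfun M f q (X q)\<close> is the sum of the partial derivatives of f, weighted by the
  component functions of X.\<close>

lemma smooth_fun_on_dfun:
  assumes "smooth_fun_on M U f" "vfield_on M U X"
  shows "smooth_fun_on M U (\<lambda>q. dfun M f q (X q))"
  unfolding smooth_fun_on_def
proof (intro conjI ballI)
  show U: "open U" using assms vfield_on_open by blast
  fix c assume c: "c \<in> atlas M"
  show "smooth_on (cmap c ` (U \<inter> cdom c)) ((\<lambda>q. dfun M f q (X q)) \<circ> cinv c)"
  proof (rule smooth_on_cong[OF open_chart_image[OF c U]])
    show "smooth_on (cmap c ` (U \<inter> cdom c)) (\<lambda>x. frechet_derivative (f \<circ> cinv c) (at x) (vrep M c X x))"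
      using assms c U by (intro smooth_on_derivative_apply open_chart_image)
        (auto simp: vfield_on_def smooth_fun_on_def)
    fix x assume "x \<in> cmap c ` (U \<inter> cdom c)"
    then obtain q where q: "q \<in> U" "q \<in> cdom c" "x = cmap c q" by blast
    have "(f \<circ> cinv c) differentiable (at (cmap c q))"
      by (rule differentiableI[OF smooth_fun_on_has_derivative[OF assms(1) c q(1,2)]])
    from dfun_chart[OF this c q(2)]
    show "frechet_derivative (f \<circ> cinv c) (at x) (vrep M c X x) = ((\<lambda>q. dfun M f q (X q)) \<circ> cinv c) x"
      using q c by (simp add: vrep_def)
  qed
qed

lemma vrep_chart_at [simp]: "vrep M (chart_at M p) X (coord M p) = X p"
  using chart_at[of p] by (simp add: vrep_def)


end

context riemannian_mfd begin

text \<open>Differentiate \<open>Y f = dfun M f _ Y\<close> along X in the preferred chart at p by the product rule: the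
  second derivatives of f are symmetric and cancel in the commutator.\<close>

lemma dfun_lie_bracket:
  assumes f: "smooth_fun_on M U f" and X: "vfield_on M U X" and Y: "vfield_on M U Y" and p: "p \<in> U"
  shows "dfun M f p (lie_bracket M X Y p) =
    dfun M (\<lambda>q. dfun M f q (Y q)) p (X p) - dfun M (\<lambda>q. dfun M f q (X q)) p (Y p)"
proof -
  define c where "c = chart_at M p"
  define h where "h = f \<circ> cinv c"
  define x where "x = coord M p"
  define S where "S = cmap c ` (U \<inter> cdom c)"
  have c: "c \<in> atlas M" "p \<in> cdom c" using chart_at by (auto simp: c_def)
  have S: "open S" using open_chart_image[OF c(1) vfield_on_open[OF X]] by (simp add: S_def)
  have x: "x \<in> S" using p c by (auto simp: S_def x_def c_def)
  have h: "smooth_on S h" using f c by (auto simp: smooth_fun_on_def h_def S_def)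
  have dd: "dfun M (\<lambda>q. dfun M f q (Z q)) p w =
      (\<Sum>b\<in>Basis. (frechet_derivative (vrep M c Z) (at x) w \<bullet> b) * frechet_derivative h (at x) b) +
      (\<Sum>b\<in>Basis. (Z p \<bullet> b) * frechet_derivative (\<lambda>y. frechet_derivative h (at y) b) (at x) w)"
    if Z: "vfield_on M U Z" for Z w
  proof -
    have Zs: "smooth_on S (vrep M c Z)" using Z c by (auto simp: vfield_on_def S_def)
    have D: "((\<lambda>y. \<Sum>b\<in>Basis. (vrep M c Z y \<bullet> b) * frechet_derivative h (at y) b) has_derivative
      (\<lambda>w. \<Sum>b\<in>Basis. (vrep M c Z x \<bullet> b) * frechet_derivative (\<lambda>y. frechet_derivative h (at y) b) (at x) w
        + (frechet_derivative (vrep M c Z) (at x) w \<bullet> b) * frechet_derivative h (at x) b)) (at x)"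
      by (intro has_derivative_sum has_derivative_mult has_derivative_inner_left
          smooth_on_has_derivative[OF Zs x] smooth_on_has_derivative[OF smooth_on_derivative[OF h] x])
    have "(\<Sum>b\<in>Basis. (vrep M c Z y \<bullet> b) * frechet_derivative h (at y) b) =
        ((\<lambda>q. dfun M f q (Z q)) \<circ> cinv c) y" if "y \<in> S" for y
    proof -
      obtain q where q: "q \<in> U" "q \<in> cdom c" "y = cmap c q" using \<open>y \<in> S\<close> by (auto simp: S_def)
      have "(f \<circ> cinv c) differentiable (at (cmap c q))"
        by (rule differentiableI[OF smooth_fun_on_has_derivative[OF f c(1) q(1,2)]])
      from dfun_chart[OF this c(1) q(2)]
      have "dfun M f q (Z q) = frechet_derivative h (at y) (vrep M c Z y)"
        using q c by (simp add: vrep_def h_def)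
      also have "\<dots> = (\<Sum>b\<in>Basis. (vrep M c Z y \<bullet> b) *\<^sub>R frechet_derivative h (at y) b)"
        by (rule linear_euclidean_expansion[OF has_derivative_linear[OF
              smooth_on_has_derivative[OF h \<open>y \<in> S\<close>]]])
      finally show ?thesis using q c by simp
    qed
    from D this have "((\<lambda>q. dfun M f q (Z q)) \<circ> cinv c has_derivative
      (\<lambda>w. \<Sum>b\<in>Basis. (vrep M c Z x \<bullet> b) * frechet_derivative (\<lambda>y. frechet_derivative h (at y) b) (at x) w
        + (frechet_derivative (vrep M c Z) (at x) w \<bullet> b) * frechet_derivative h (at x) b)) (at x)"
      by (rule has_derivative_transform_within_open[OF _ S x])
    from frechet_eqI[OF this] show ?thesis
      unfolding dfun_def c_def[symmetric] x_def[symmetric]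
      by (simp add: sum.distrib x_def c_def)
  qed
  define H where "H b b' = frechet_derivative (\<lambda>y. frechet_derivative h (at y) b) (at x) b'" for b b'
  have Hsym: "H b b' = H b' b" for b b'
    unfolding H_def by (rule symmetric_second_derivative[OF S h x])
  have Hexp: "H b w = (\<Sum>b'\<in>Basis. (w \<bullet> b') * H b b')" for b w
    unfolding H_def
    using linear_euclidean_expansion[OF has_derivative_linear[OF
          smooth_on_has_derivative[OF smooth_on_derivative[OF h] x]], of b w] by simp
  have swap: "(Y p \<bullet> b) * ((X p \<bullet> b') * H b b') = (X p \<bullet> b') * ((Y p \<bullet> b) * H b' b)" for b b'
    by (subst Hsym) (rule mult.left_commute)
  have "(\<Sum>b\<in>Basis. (Y p \<bullet> b) * H b (X p)) =
      (\<Sum>b\<in>Basis. \<Sum>b'\<in>Basis. (Y p \<bullet> b) * ((X p \<bullet> b') * H b b'))"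
    by (simp only: Hexp[of _ "X p"] sum_distrib_left)
  also have "\<dots> = (\<Sum>b'\<in>Basis. \<Sum>b\<in>Basis. (Y p \<bullet> b) * ((X p \<bullet> b') * H b b'))"
    by (rule sum.swap)
  also have "\<dots> = (\<Sum>b'\<in>Basis. \<Sum>b\<in>Basis. (X p \<bullet> b') * ((Y p \<bullet> b) * H b' b))"
    by (simp only: swap)
  also have "\<dots> = (\<Sum>b\<in>Basis. (X p \<bullet> b) * H b (Y p))"
    by (simp only: Hexp[of _ "Y p"] sum_distrib_left)
  finally have symm: "(\<Sum>b\<in>Basis. (Y p \<bullet> b) * H b (X p)) = (\<Sum>b\<in>Basis. (X p \<bullet> b) * H b (Y p))" .
  have lh: "linear (frechet_derivative h (at x))"
    using has_derivative_linear[OF smooth_on_has_derivative[OF h x]] .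
  have "dfun M f p (lie_bracket M X Y p) = frechet_derivative h (at x) (lie_bracket M X Y p)"
    by (simp add: dfun_def h_def c_def x_def)
  also have "\<dots> = frechet_derivative h (at x) (frechet_derivative (vrep M c Y) (at x) (X p)) -
      frechet_derivative h (at x) (frechet_derivative (vrep M c X) (at x) (Y p))"
    unfolding lie_bracket_def c_def x_def by (rule linear_diff[OF lh[unfolded x_def]])
  finally show ?thesis
    using dd[OF X, of "Y p"] dd[OF Y, of "X p"] symm[unfolded H_def]
      linear_euclidean_expansion[OF lh, of "frechet_derivative (vrep M c Y) (at x) (X p)"]
      linear_euclidean_expansion[OF lh, of "frechet_derivative (vrep M c X) (at x) (Y p)"]
    by simp
qed


section \<open>Orthogonal frames and gradients\<close>

lemma bilinear_gm: "bilinear (gm M p)"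
  and gm_sym: "gm M p v w = gm M p w v"
  and gm_pos: "v \<noteq> 0 \<Longrightarrow> 0 < gm M p v v"
  using riem by (auto simp: riemannian_manifold_def)

lemmas gm_simps = bilinear_ladd[OF bilinear_gm] bilinear_radd[OF bilinear_gm]
  bilinear_lsub[OF bilinear_gm] bilinear_rsub[OF bilinear_gm]
  bilinear_lmul[OF bilinear_gm] bilinear_rmul[OF bilinear_gm]
  bilinear_lneg[OF bilinear_gm] bilinear_rneg[OF bilinear_gm]
  bilinear_lzero[OF bilinear_gm] bilinear_rzero[OF bilinear_gm]

lemma linear_gm: "linear (gm M p v)" "linear (\<lambda>w. gm M p w v)"
  using bilinear_gm by (auto simp: bilinear_def)

lemma gm_eq_zero_iff: "gm M p v v = 0 \<longleftrightarrow> v = 0"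
  using gm_pos[of v p] by (cases "v = 0") (auto simp: gm_simps)

lemma gm_nonneg: "0 \<le> gm M p v v"
  using gm_pos[of v p] by (cases "v = 0") (auto simp: gm_simps)

lemma gm_span_zero:
  assumes "\<And>w. w \<in> B \<Longrightarrow> gm M p v w = 0" "w \<in> span B"
  shows "gm M p v w = 0"
  using linear_eq_0_on_span[OF linear_gm(1)] assms by blast

lemma smooth_fun_on_gm:
  "vfield_on M U X \<Longrightarrow> vfield_on M U Y \<Longrightarrow> smooth_fun_on M U (\<lambda>q. gm M q (X q) (Y q))"
  using riem unfolding riemannian_manifold_def by blast

text \<open>The Gram--Schmidt process with smooth dependence on the point, in the form in which it is used
  below: a frame, its dual frame and the orthogonal projection onto its span are all fields with
  prescribed inner products. The induction adds the component Z of the new frame field that is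
  orthogonal to the earlier ones; independence makes \<open>gm M q (Z q) (Z q)\<close> a legitimate
  denominator.\<close>

lemma vfield_with_prescribed_products:
  assumes "finite I" "open U"
    and "\<And>i. i \<in> I \<Longrightarrow> vfield_on M U (Y i)"
    and "\<And>q i. q \<in> U \<Longrightarrow> i \<in> I \<Longrightarrow> Y i q \<notin> span ((\<lambda>j. Y j q) ` (I - {i}))"
    and "\<And>i. i \<in> I \<Longrightarrow> smooth_fun_on M U (h i)"
  shows "\<exists>W. vfield_on M U W \<and>
    (\<forall>q\<in>U. W q \<in> span ((\<lambda>i. Y i q) ` I) \<and> (\<forall>i\<in>I. gm M q (W q) (Y i q) = h i q))"
  using assms(1,3-)
proof (induction I arbitrary: h rule: finite_induct)
  case empty
  then show ?case using vfield_on_zero[OF assms(2)] by (intro exI[of _ "\<lambda>q. 0"]) auto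
next
  case (insert j I)
  have ind: "Y i q \<notin> span ((\<lambda>j. Y j q) ` (I - {i}))" if "q \<in> U" "i \<in> I" for q i
  proof -
    have "span ((\<lambda>j. Y j q) ` (I - {i})) \<subseteq> span ((\<lambda>j. Y j q) ` (insert j I - {i}))"
      by (intro span_mono image_mono) auto
    then show ?thesis using insert.prems(2)[OF that(1), of i] that(2) by auto
  qed
  have Yj: "vfield_on M U (Y j)" and YI: "\<And>i. i \<in> I \<Longrightarrow> vfield_on M U (Y i)"
    using insert.prems by auto
  have IH: "\<exists>W. vfield_on M U W \<and>
      (\<forall>q\<in>U. W q \<in> span ((\<lambda>i. Y i q) ` I) \<and> (\<forall>i\<in>I. gm M q (W q) (Y i q) = k i q))"
    if "\<And>i. i \<in> I \<Longrightarrow> smooth_fun_on M U (k i)" for k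
    by (rule insert.IH) (erule YI, erule (1) ind, erule that)
  have "\<exists>P. vfield_on M U P \<and> (\<forall>q\<in>U. P q \<in> span ((\<lambda>i. Y i q) ` I) \<and>
      (\<forall>i\<in>I. gm M q (P q) (Y i q) = gm M q (Y j q) (Y i q)))"
    by (rule IH) (rule smooth_fun_on_gm[OF Yj YI])
  then obtain P where P: "vfield_on M U P" "\<forall>q\<in>U. P q \<in> span ((\<lambda>i. Y i q) ` I) \<and>
      (\<forall>i\<in>I. gm M q (P q) (Y i q) = gm M q (Y j q) (Y i q))"
    by (elim exE conjE)
  have "\<exists>W. vfield_on M U W \<and> (\<forall>q\<in>U. W q \<in> span ((\<lambda>i. Y i q) ` I) \<and>
      (\<forall>i\<in>I. gm M q (W q) (Y i q) = h i q))"
    by (rule IH) (simp add: insert.prems(3))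
  then obtain W where W: "vfield_on M U W" "\<forall>q\<in>U. W q \<in> span ((\<lambda>i. Y i q) ` I) \<and>
      (\<forall>i\<in>I. gm M q (W q) (Y i q) = h i q)"
    by (elim exE conjE)
  (* P is the projection of Y j to the span of the earlier frame fields; the factor t corrects the
     product with Y j and leaves the earlier products unchanged. *)
  define Z where "Z q = Y j q - P q" for q
  define t where "t q = (h j q - gm M q (W q) (Y j q)) / gm M q (Z q) (Z q)" for q
  have Z: "vfield_on M U Z" unfolding Z_def by (rule vfield_on_diff[OF Yj P(1)])
  have Znz: "Z q \<noteq> 0" if "q \<in> U" for q
    using insert.prems(2)[OF that, of j] bspec[OF P(2) that] insert.hyps by (auto simp: Z_def)
  have ZI: "gm M q (Z q) (Y i q) = 0" if "q \<in> U" "i \<in> I" for q i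
    using bspec[OF P(2) that(1)] that(2) by (simp add: Z_def gm_simps)
  have ZP: "gm M q (Z q) (P q) = 0" if "q \<in> U" for q
    by (rule gm_span_zero[OF _ conjunct1[OF bspec[OF P(2) that]]]) (use ZI[OF that] in auto)
  have Zj: "gm M q (Z q) (Y j q) = gm M q (Z q) (Z q)" if "q \<in> U" for q
    using ZP[OF that] by (simp add: Z_def gm_simps)
  have t: "smooth_fun_on M U t"
    unfolding t_def
    by (intro smooth_fun_on_divide smooth_fun_on_diff smooth_fun_on_gm W(1) Z Yj)
      (simp_all add: insert.prems(3) Znz gm_eq_zero_iff)
  have sp: "W q + t q *\<^sub>R Z q \<in> span ((\<lambda>i. Y i q) ` insert j I)" if "q \<in> U" for q
  proof -
    have sub: "span ((\<lambda>i. Y i q) ` I) \<subseteq> span ((\<lambda>i. Y i q) ` insert j I)"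
      by (intro span_mono) auto
    have "Y j q \<in> span ((\<lambda>i. Y i q) ` insert j I)" by (intro span_base) simp
    then show ?thesis
      unfolding Z_def
      using subsetD[OF sub conjunct1[OF bspec[OF W(2) that]]]
        subsetD[OF sub conjunct1[OF bspec[OF P(2) that]]]
      by (intro span_add span_scale span_diff)
  qed
  have pr: "gm M q (W q + t q *\<^sub>R Z q) (Y i q) = h i q" if "q \<in> U" "i \<in> insert j I" for q i
  proof (cases "i = j")
    case True
    then show ?thesis
      using Zj[OF that(1)] Znz[OF that(1)] by (simp add: gm_simps t_def gm_eq_zero_iff)
  next
    case False
    then have "i \<in> I" using that(2) by simp
    then show ?thesis
      using bspec[OF W(2) that(1)] ZI[OF that(1)] by (simp add: gm_simps)
  qed
  show ?case
    by (rule exI[of _ "\<lambda>q. W q + t q *\<^sub>R Z q"], intro conjI ballI)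
      (rule vfield_on_add[OF W(1) vfield_on_scaleR[OF t Z]], erule sp, erule (1) pr)
qed

text \<open>The products of the gradient with the fields of a coordinate frame are the partial derivatives of
  f, which are smooth, and they determine it.\<close>

lemma gradient_exists:
  assumes f: "smooth_fun_on M U f" and U: "U \<subseteq> cdom (chart_at M p)"
  shows "\<exists>W. vfield_on M U W \<and> (\<forall>q\<in>U. \<forall>v. gm M q (W q) v = dfun M f q v)"
proof -
  have oU: "open U" using f smooth_fun_on_open by blast
  have E: "vfield_on M U (ext_field M p b)" for b
    by (rule vfield_on_subset[OF vfield_on_ext_field oU U])
  have indep: "ext_field M p i q \<notin> span ((\<lambda>j. ext_field M p j q) ` (Basis - {i}))"
    if "q \<in> U" "i \<in> Basis" for q i
  proof
    assume a: "ext_field M p i q \<in> span ((\<lambda>j. ext_field M p j q) ` (Basis - {i}))"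
    have q: "q \<in> cdom (chart_at M p)" using that U by auto
    have "dchart M (chart_at M p) q ` span ((\<lambda>j. ext_field M p j q) ` (Basis - {i})) =
        span (dchart M (chart_at M p) q ` (\<lambda>j. ext_field M p j q) ` (Basis - {i}))"
      by (rule linear_span_image[OF linear_dchart[OF chart_at(1) q], symmetric])
    also have "dchart M (chart_at M p) q ` (\<lambda>j. ext_field M p j q) ` (Basis - {i}) = Basis - {i}"
      by (simp add: image_image dchart_ext_field[OF q])
    finally have "i \<in> span (Basis - {i})"
      using imageI[OF a, of "dchart M (chart_at M p) q"] dchart_ext_field[OF q, of i] by simp
    then show False
      using independent_Basis that(2) unfolding dependent_def by blast
  qed
  have "\<exists>W. vfield_on M U W \<and> (\<forall>q\<in>U. W q \<in> span ((\<lambda>b. ext_field M p b q) ` Basis) \<and>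
      (\<forall>b\<in>Basis. gm M q (W q) (ext_field M p b q) = dfun M f q (ext_field M p b q)))"
    by (rule vfield_with_prescribed_products)
      (rule finite_Basis, rule oU, rule E, erule (1) indep, rule smooth_fun_on_dfun[OF f E])
  then obtain W where W: "vfield_on M U W" "\<forall>q\<in>U. W q \<in> span ((\<lambda>b. ext_field M p b q) ` Basis) \<and>
      (\<forall>b\<in>Basis. gm M q (W q) (ext_field M p b q) = dfun M f q (ext_field M p b q))"
    by (elim exE conjE)
  have "gm M q (W q) v = dfun M f q v" if q: "q \<in> U" for q v
  proof -
    have q': "q \<in> cdom (chart_at M p)" using that U by auto
    define z where "z = dchart M (chart_at M p) q v"
    have v: "v = (\<Sum>b\<in>Basis. (z \<bullet> b) *\<^sub>R ext_field M p b q)"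
      using linear_euclidean_expansion[OF linear_ext_field[OF q'], of z]
      by (simp add: z_def ext_field_dchart[OF q'])
    show ?thesis
      unfolding v
      by (simp add: linear_sum[OF linear_gm(1)] linear_sum[OF linear_dfun[OF f q]]
          linear_cmul[OF linear_gm(1)] linear_cmul[OF linear_dfun[OF f q]] bspec[OF W(2) q])
  qed
  then show ?thesis using W(1) by (intro exI[of _ W] conjI ballI allI)
qed

end


section \<open>The Levi-Civita connection\<close>

locale levi_civita_mfd = riemannian_mfd M
  for M :: "('a::{t2_space, second_countable_topology}, 'e::euclidean_space) riem_mfd" +
  fixes D :: "('a, 'e) covd"
  assumes levi_civita: "levi_civita M D"
begin

lemma affine_connection: "affine_connection M D"
  using levi_civita by (simp add: levi_civita_def)

lemma linear_D: "vfield_on M U Y \<Longrightarrow> p \<in> U \<Longrightarrow> linear (\<lambda>v. D p v Y)"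
  using affine_connection[unfolded affine_connection_def, THEN conjunct2, THEN conjunct1] by blast

lemma D_add: "vfield_on M U Y \<Longrightarrow> vfield_on M U Z \<Longrightarrow> p \<in> U \<Longrightarrow>
    D p v (\<lambda>q. Y q + Z q) = D p v Y + D p v Z"
  using affine_connection[unfolded affine_connection_def, THEN conjunct2, THEN conjunct2, THEN conjunct1] by blast

lemma D_scaleR: "smooth_fun_on M U f \<Longrightarrow> vfield_on M U Y \<Longrightarrow> p \<in> U \<Longrightarrow>
    D p v (\<lambda>q. f q *\<^sub>R Y q) = dfun M f p v *\<^sub>R Y p + f p *\<^sub>R D p v Y"
  using affine_connection[unfolded affine_connection_def, THEN conjunct2, THEN conjunct2, THEN conjunct2] by blast

lemma torsion_free: "vfield_on M U X \<Longrightarrow> vfield_on M U Y \<Longrightarrow> p \<in> U \<Longrightarrow>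
    D p (X p) Y - D p (Y p) X = lie_bracket M X Y p"
  using levi_civita[unfolded levi_civita_def, THEN conjunct2, THEN conjunct1] by blast

lemma metric_compatible: "vfield_on M U Y \<Longrightarrow> vfield_on M U Z \<Longrightarrow> p \<in> U \<Longrightarrow>
    dfun M (\<lambda>q. gm M q (Y q) (Z q)) p v = gm M p (D p v Y) (Z p) + gm M p (Y p) (D p v Z)"
  using levi_civita[unfolded levi_civita_def, THEN conjunct2, THEN conjunct2] by blast

text \<open>A field Z that vanishes on a neighbourhood U equals \<open>f Z\<close> for the function f that is 0 on U
  and 1 elsewhere. The product rule asks for the smoothness of f on U only, and there f and its
  derivative vanish.\<close>

lemma D_eq_zero:
  assumes "open U" "p \<in> U" "\<And>q. q \<in> U \<Longrightarrow> Z q = 0"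
  shows "D p v Z = 0"
proof -
  define f :: "'a \<Rightarrow> real" where "f q = (if q \<in> U then 0 else 1)" for q
  have f: "smooth_fun_on M U f"
    by (rule smooth_fun_on_cong[OF smooth_fun_on_const[OF assms(1), of 0]]) (simp add: f_def)
  have Z: "vfield_on M U Z"
    by (rule vfield_on_cong[OF vfield_on_zero[OF assms(1)]]) (simp add: assms(3))
  have "(\<lambda>q. f q *\<^sub>R Z q) = Z" using assms(3) by (auto simp: f_def)
  moreover have "D p v (\<lambda>q. f q *\<^sub>R Z q) = 0"
    using D_scaleR[OF f Z assms(2), of v] assms(2,3) by (simp add: f_def)
  ultimately show ?thesis by simp
qed

lemma D_cong:
  assumes "vfield_on M U Y" "p \<in> U" "\<And>q. q \<in> U \<Longrightarrow> Y q = Y' q"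
  shows "D p v Y = D p v Y'"
proof -
  define Z where "Z q = Y' q - Y q" for q
  have U: "open U" using assms(1) vfield_on_open by blast
  have Z: "vfield_on M U Z"
    by (rule vfield_on_cong[OF vfield_on_zero[OF U]]) (simp add: assms(3) Z_def)
  have "D p v Y' = D p v (\<lambda>q. Y q + Z q)" by (simp add: Z_def)
  also have "\<dots> = D p v Y + D p v Z" by (rule D_add[OF assms(1) Z assms(2)])
  also have "D p v Z = 0" by (rule D_eq_zero[OF U assms(2)]) (simp add: Z_def assms(3))
  finally show ?thesis by simp
qed

end

section \<open>Horizontal and vertical fields of a Riemannian submersion\<close>

locale riemannian_submersion_mfd = levi_civita_mfd M D + N: riemannian_mfd N
  for M :: "('a::{t2_space, second_countable_topology}, 'e::euclidean_space) riem_mfd"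
    and D :: "('a, 'e) covd"
    and N :: "('b::{t2_space, second_countable_topology}, 'f::euclidean_space) riem_mfd" +
  fixes F :: "'a \<Rightarrow> 'b"
  assumes submersion: "riemannian_submersion M N F"
begin

abbreviation V where "V \<equiv> vertical M N F"
abbreviation H where "H \<equiv> orth_compl M V"

lemma smooth_map: "smooth_map M N F"
  using submersion by (simp add: riemannian_submersion_def)

lemma surj_mdiff: "surj (mdiff M N F p)"
  using submersion by (simp add: riemannian_submersion_def)

lemma isometry:
  "x \<in> H p \<Longrightarrow> y \<in> H p \<Longrightarrow> gm N (F p) (mdiff M N F p x) (mdiff M N F p y) = gm M p x y"
  using submersion by (simp add: riemannian_submersion_def)

lemma open_preimage: "open W \<Longrightarrow> open (F -` W)"
  using smooth_map by (simp add: smooth_map_def open_vimage)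

lemma local_rep_smooth:
  assumes "c \<in> atlas M" "d \<in> atlas N"
  shows "smooth_on (cmap c ` (F -` cdom d \<inter> cdom c)) (cmap d \<circ> F \<circ> cinv c)"
  using smooth_map assms by (simp add: smooth_map_def Int_commute)

lemma local_rep_has_derivative:
  assumes "c \<in> atlas M" "d \<in> atlas N" "q \<in> cdom c" "F q \<in> cdom d"
  shows "(cmap d \<circ> F \<circ> cinv c has_derivative
    frechet_derivative (cmap d \<circ> F \<circ> cinv c) (at (cmap c q))) (at (cmap c q))"
  by (rule smooth_on_has_derivative[OF local_rep_smooth[OF assms(1,2)]]) (use assms(3,4) in simp)

lemma mdiff_has_derivative:
  "(cmap (chart_at N (F p)) \<circ> F \<circ> cinv (chart_at M p) has_derivative mdiff M N F p) (at (coord M p))"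
  unfolding mdiff_def
  by (rule local_rep_has_derivative[OF chart_at(1) N.chart_at(1) chart_at(2) N.chart_at(2)])

lemma linear_mdiff: "linear (mdiff M N F p)"
  by (rule has_derivative_linear[OF mdiff_has_derivative])

lemma has_derivative_after_submersion:
 assumes k: "(k \<circ> cinv (chart_at N (F p)) has_derivative k') (at (coord N (F p)))"
  shows "((\<lambda>q. k (F q)) \<circ> cinv (chart_at M p) has_derivative (\<lambda>v. k' (mdiff M N F p v)))
    (at (coord M p))"
proof -
  define c where "c = chart_at M p"
  define d where "d = chart_at N (F p)"
  have c: "c \<in> atlas M" "p \<in> cdom c" and d: "d \<in> atlas N" "F p \<in> cdom d"
    using chart_at[of p] N.chart_at[of "F p"] by (simp_all add: c_def d_def)
  have "(k \<circ> cinv d has_derivative k') (at ((cmap d \<circ> F \<circ> cinv c) (cmap c p)))"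
    using k c by (simp add: d_def)
  from has_derivative_compose[OF mdiff_has_derivative[of p, folded c_def d_def] this]
  have comp: "((\<lambda>x. (k \<circ> cinv d) ((cmap d \<circ> F \<circ> cinv c) x)) has_derivative (\<lambda>v. k' (mdiff M N F p v)))
      (at (cmap c p))" .
  have "((\<lambda>q. k (F q)) \<circ> cinv c has_derivative (\<lambda>v. k' (mdiff M N F p v))) (at (cmap c p))"
  proof (rule has_derivative_transform_within_open[OF comp])
    show "open (cmap c ` (F -` cdom d \<inter> cdom c))"
      by (rule open_chart_image[OF c(1) open_preimage[OF N.open_cdom[OF d(1)]]])
    show "cmap c p \<in> cmap c ` (F -` cdom d \<inter> cdom c)" using c d by simp
    fix x assume "x \<in> cmap c ` (F -` cdom d \<inter> cdom c)"
    then show "(k \<circ> cinv d) ((cmap d \<circ> F \<circ> cinv c) x) = ((\<lambda>q. k (F q)) \<circ> cinv c) x"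
      using c d by auto
  qed
  then show ?thesis by (simp add: c_def)
qed

lemma dfun_pullback:
  assumes "smooth_fun_on N W k" "F p \<in> W"
  shows "dfun M (\<lambda>q. k (F q)) p v = dfun N k (F p) (mdiff M N F p v)"
  unfolding dfun_def
  using frechet_eqI[OF has_derivative_after_submersion[OF
        N.smooth_fun_on_has_derivative[OF assms(1) N.chart_at(1) assms(2) N.chart_at(2)]]]
  by (rule fun_cong)

lemma smooth_fun_on_component:
  assumes "d \<in> atlas N"
  shows "smooth_fun_on M (F -` cdom d) (\<lambda>q. cmap d (F q) \<bullet> b)"
  unfolding smooth_fun_on_iff
proof (intro conjI ballI)
  show o: "open (F -` cdom d)" by (rule open_preimage[OF N.open_cdom[OF assms]])
  fix c assume c: "c \<in> atlas M"
  from smooth_on_inner[OF open_chart_image[OF c o] local_rep_smooth[OF c assms], of b]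
  show "smooth_on (cmap c ` (F -` cdom d \<inter> cdom c)) (\<lambda>x. cmap d (F (cinv c x)) \<bullet> b)"
    by simp
qed

lemma dfun_component:
  assumes "d \<in> atlas N" "F p \<in> cdom d"
  shows "dfun M (\<lambda>q. cmap d (F q) \<bullet> b) p v = dchart N d (F p) (mdiff M N F p v) \<bullet> b"
proof -
  have "((\<lambda>y. cmap d y \<bullet> b) \<circ> cinv (chart_at N (F p)) has_derivative (\<lambda>v. dchart N d (F p) v \<bullet> b))
      (at (coord N (F p)))"
    using has_derivative_inner_left[OF N.transition_has_derivative[OF N.chart_at(1) assms(1)
          N.chart_at(2) assms(2)], of b]
    by (simp add: o_def dchart_def)
  from frechet_eqI[OF has_derivative_after_submersion[OF this]]
  show ?thesis unfolding dfun_def by (rule fun_cong)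
qed

lemma subspace_V: "subspace (V q)"
  unfolding vertical_def using linear_mdiff
  by (auto simp: subspace_def linear_0 linear_add linear_cmul)

lemma subspace_H: "subspace (H q)"
  unfolding orth_compl_def by (auto simp: subspace_def gm_simps)

lemma V_H_orthogonal: "v \<in> V q \<Longrightarrow> w \<in> H q \<Longrightarrow> gm M q v w = 0" "v \<in> V q \<Longrightarrow> w \<in> H q \<Longrightarrow> gm M q w v = 0"
  unfolding orth_compl_def by (auto simp: gm_sym)

lemma H_inter_V: "v \<in> H q \<Longrightarrow> v \<in> V q \<Longrightarrow> v = 0"
  using V_H_orthogonal(1) gm_eq_zero_iff by metis

text \<open>A neighbourhood of p on which the coordinates of the base around \<open>F p\<close> can be pulled back to
  functions. Their gradients are a smooth frame of the horizontal distribution.\<close>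

definition nbhd where "nbhd p = F -` cdom (chart_at N (F p)) \<inter> cdom (chart_at M p)"

definition pulled_coord where "pulled_coord p b q = cmap (chart_at N (F p)) (F q) \<bullet> b"

definition grad where
  "grad p b = (SOME W. vfield_on M (nbhd p) W \<and>
    (\<forall>q\<in>nbhd p. \<forall>v. gm M q (W q) v = dfun M (pulled_coord p b) q v))"

lemma open_nbhd: "open (nbhd p)"
  unfolding nbhd_def
  by (intro open_Int open_preimage N.open_cdom open_cdom chart_at(1) N.chart_at(1))

lemma in_nbhd [simp]: "p \<in> nbhd p"
  using chart_at(2)[of p] N.chart_at(2)[of "F p"] by (simp add: nbhd_def)

lemma smooth_pulled_coord: "smooth_fun_on M (nbhd p) (pulled_coord p b)"
  unfolding pulled_coord_def
  by (rule smooth_fun_on_subset[OF smooth_fun_on_component[OF N.chart_at(1)] open_nbhd])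
    (simp add: nbhd_def)

lemma dfun_pulled_coord:
  assumes "q \<in> nbhd p"
  shows "dfun M (pulled_coord p b) q v = dchart N (chart_at N (F p)) (F q) (mdiff M N F q v) \<bullet> b"
  unfolding pulled_coord_def
  by (rule dfun_component[OF N.chart_at(1)]) (use assms in \<open>simp add: nbhd_def\<close>)

lemma grad:
  "vfield_on M (nbhd p) (grad p b) \<and>
    (\<forall>q\<in>nbhd p. \<forall>v. gm M q (grad p b q) v = dfun M (pulled_coord p b) q v)"
  unfolding grad_def
  by (rule someI_ex[OF gradient_exists[OF smooth_pulled_coord, of p p b]]) (simp add: nbhd_def)

lemma gm_grad: "q \<in> nbhd p \<Longrightarrow> gm M q (grad p b q) v = dfun M (pulled_coord p b) q v"
  using grad[of p b] by simp

lemma vertical_iff: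
  assumes "q \<in> nbhd p"
  shows "v \<in> V q \<longleftrightarrow> (\<forall>b\<in>Basis. dfun M (pulled_coord p b) q v = 0)"
proof -
  have d: "chart_at N (F p) \<in> atlas N" "F q \<in> cdom (chart_at N (F p))"
    using assms N.chart_at(1) by (simp_all add: nbhd_def)
  have "(\<forall>b\<in>Basis. dfun M (pulled_coord p b) q v = 0) \<longleftrightarrow>
      dchart N (chart_at N (F p)) (F q) (mdiff M N F q v) = 0"
    by (simp add: dfun_pulled_coord[OF assms] euclidean_all_zero_iff)
  also have "\<dots> \<longleftrightarrow> mdiff M N F q v = 0"
    using N.dchart_inject[OF d] linear_0[OF N.linear_dchart[OF d]] by auto
  finally show ?thesis by (simp add: vertical_def)
qed

lemma grad_horizontal:
  assumes "q \<in> nbhd p" "b \<in> Basis"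
  shows "grad p b q \<in> H q"
  unfolding orth_compl_def
proof (intro CollectI ballI)
  fix v assume "v \<in> V q"
  then have "gm M q (grad p b q) v = 0"
    using vertical_iff[OF assms(1)] assms(2) by (simp add: gm_grad[OF assms(1)])
  then show "gm M q v (grad p b q) = 0" by (simp add: gm_sym)
qed

text \<open>Since the differential of F is onto, there is a vector v on which the differential of one
  coordinate is 1 and those of all others vanish; it is orthogonal to all gradients but one.\<close>

lemma grad_independent:
  assumes q: "q \<in> nbhd p" and b: "b \<in> Basis"
  shows "grad p b q \<notin> span ((\<lambda>b. grad p b q) ` (Basis - {b}))"
proof
  assume a: "grad p b q \<in> span ((\<lambda>b. grad p b q) ` (Basis - {b}))"
  define d where "d = chart_at N (F p)"
  have d: "F q \<in> cdom d" using q by (simp add: nbhd_def d_def)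
  obtain v where "mdiff M N F q v = ext_field N (F p) b (F q)"
    using surj_mdiff by (metis surjD)
  then have v: "dchart N d (F q) (mdiff M N F q v) = b"
    using N.dchart_ext_field[of "F q" "F p" b] d by (simp add: d_def)
  have gv: "gm M q (grad p i q) v = b \<bullet> i" for i
    by (simp add: gm_grad[OF q] dfun_pulled_coord[OF q] v[unfolded d_def])
  have "gm M q v (grad p b q) = 0"
  proof (rule gm_span_zero[OF _ a])
    fix w assume "w \<in> (\<lambda>b. grad p b q) ` (Basis - {b})"
    then obtain i where i: "i \<in> Basis" "i \<noteq> b" "w = grad p i q" by auto
    then show "gm M q v w = 0"
      using gv[of i] inner_not_same_Basis[OF b i(1)] by (auto simp: gm_sym[of _ v])
  qed
  then show False using gv[of b] b by (simp add: gm_sym[of _ v] inner_same_Basis)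
qed

text \<open>The derivatives of the pulled back coordinates are the products with the gradient frame. With
  constant values of h this lemma gives basic fields, with the derivatives along a given field it
  gives the horizontal part of that field.\<close>

lemma horizontal_field_with_prescribed_products:
  assumes "open U" "U \<subseteq> nbhd p" "\<And>b. b \<in> Basis \<Longrightarrow> smooth_fun_on M U (h b)"
  shows "\<exists>W. vfield_on M U W \<and>
    (\<forall>q\<in>U. W q \<in> H q \<and> (\<forall>b\<in>Basis. dfun M (pulled_coord p b) q (W q) = h b q))"
proof -
  have "\<exists>W. vfield_on M U W \<and> (\<forall>q\<in>U. W q \<in> span ((\<lambda>b. grad p b q) ` Basis) \<and>
      (\<forall>b\<in>Basis. gm M q (W q) (grad p b q) = h b q))"
  proof (rule vfield_with_prescribed_products[OF finite_Basis assms(1)])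
    show "vfield_on M U (grad p b)" for b
      by (rule vfield_on_subset[OF conjunct1[OF grad] assms(1,2)])
    show "grad p b q \<notin> span ((\<lambda>b. grad p b q) ` (Basis - {b}))" if "q \<in> U" "b \<in> Basis" for q b
      using grad_independent that assms(2) by auto
    show "smooth_fun_on M U (h b)" if "b \<in> Basis" for b by (rule assms(3)[OF that])
  qed
  then obtain W where W: "vfield_on M U W" "\<forall>q\<in>U. W q \<in> span ((\<lambda>b. grad p b q) ` Basis) \<and>
      (\<forall>b\<in>Basis. gm M q (W q) (grad p b q) = h b q)"
    by (elim exE conjE)
  show ?thesis
  proof (rule exI[of _ W], intro conjI ballI)
    show "vfield_on M U W" by (rule W(1))
  next
    fix q assume q: "q \<in> U"
    have "span ((\<lambda>b. grad p b q) ` Basis) \<subseteq> H q"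
      by (rule span_minimal[OF _ subspace_H]) (use q assms(2) grad_horizontal in auto)
    then show "W q \<in> H q" using bspec[OF W(2) q] by auto
  next
    fix q b assume q: "q \<in> U" and b: "b \<in> (Basis :: 'f set)"
    have "q \<in> nbhd p" using q assms(2) by auto
    then show "dfun M (pulled_coord p b) q (W q) = h b q"
      using bspec[OF W(2) q] b gm_grad[of q p b "W q"] by (simp add: gm_sym[of _ "W q"])
  qed
qed

lemma linear_dfun_pulled_coord: "q \<in> nbhd p \<Longrightarrow> linear (dfun M (pulled_coord p b) q)"
  by (rule linear_dfun[OF smooth_pulled_coord])

text \<open>A horizontal field on which the pulled back coordinates have the same derivatives as on X differs
  from X by a vertical field.\<close>

lemma horizontal_part_exists:
  assumes X: "vfield_on M U X" and U: "U \<subseteq> nbhd p"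
  shows "\<exists>W. vfield_on M U W \<and> (\<forall>q\<in>U. W q \<in> H q \<and> X q - W q \<in> V q)"
proof -
  have oU: "open U" using X vfield_on_open by blast
  have "\<exists>W. vfield_on M U W \<and> (\<forall>q\<in>U. W q \<in> H q \<and>
      (\<forall>b\<in>Basis. dfun M (pulled_coord p b) q (W q) = dfun M (pulled_coord p b) q (X q)))"
    by (rule horizontal_field_with_prescribed_products[OF oU U])
      (rule smooth_fun_on_dfun[OF smooth_fun_on_subset[OF smooth_pulled_coord oU U] X])
  then obtain W where W: "vfield_on M U W" "\<forall>q\<in>U. W q \<in> H q \<and>
      (\<forall>b\<in>Basis. dfun M (pulled_coord p b) q (W q) = dfun M (pulled_coord p b) q (X q))"
    by (elim exE conjE)
  have "X q - W q \<in> V q" if "q \<in> U" for q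
    using vertical_iff[of q p] that U bspec[OF W(2) that]
      linear_diff[OF linear_dfun_pulled_coord] by (auto simp: subset_eq)
  then show ?thesis using W by (intro exI[of _ W] conjI ballI) auto
qed

lemma oproj_eqI:
  assumes "w \<in> H q" "x - w \<in> V q"
  shows "oproj M H q x = w" "oproj M V q x = x - w"
proof -
  show "oproj M H q x = w"
    unfolding oproj_def
  proof (rule the_equality)
    show "w \<in> H q \<and> (\<forall>z\<in>H q. gm M q (x - w) z = 0)"
      using assms V_H_orthogonal by simp
    fix y assume y: "y \<in> H q \<and> (\<forall>z\<in>H q. gm M q (x - y) z = 0)"
    have yw: "y - w \<in> H q" using y assms subspace_H subspace_diff by blast
    have "gm M q (x - y) (y - w) = 0" "gm M q (x - w) (y - w) = 0"
      using y yw V_H_orthogonal(1)[OF assms(2) yw] by simp_all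
    then have "gm M q (y - w) (y - w) = 0" by (simp add: gm_simps)
    then show "y = w" using gm_eq_zero_iff by auto
  qed
  show "oproj M V q x = x - w"
    unfolding oproj_def
  proof (rule the_equality)
    show "x - w \<in> V q \<and> (\<forall>z\<in>V q. gm M q (x - (x - w)) z = 0)"
      using assms V_H_orthogonal by simp
    fix y assume y: "y \<in> V q \<and> (\<forall>z\<in>V q. gm M q (x - y) z = 0)"
    have yw: "y - (x - w) \<in> V q" using y assms subspace_V subspace_diff by blast
    have "gm M q (x - y) (y - (x - w)) = 0" "gm M q w (y - (x - w)) = 0"
      using y yw V_H_orthogonal(2)[OF yw assms(1)] by simp_all
    then have "gm M q (y - (x - w)) (y - (x - w)) = 0" by (simp add: gm_simps)
    then show "y = x - w" using gm_eq_zero_iff by auto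
  qed
qed

lemma hproj_in_H: "oproj M H q x \<in> H q"
  and minus_hproj_in_V: "x - oproj M H q x \<in> V q"
proof -
  have "vfield_on M (nbhd q) (ext_field M q x)"
    by (rule vfield_on_subset[OF vfield_on_ext_field open_nbhd]) (simp add: nbhd_def)
  from horizontal_part_exists[OF this order_refl]
  obtain W where "\<forall>r\<in>nbhd q. W r \<in> H r \<and> ext_field M q x r - W r \<in> V r"
    by (elim exE conjE)
  from bspec[OF this in_nbhd] have "W q \<in> H q" "x - W q \<in> V q" by auto
  then show "oproj M H q x \<in> H q" "x - oproj M H q x \<in> V q"
    using oproj_eqI(1)[of "W q" q x] by auto
qed

lemma vproj_eq: "oproj M V q x = x - oproj M H q x"
  by (rule oproj_eqI(2)[OF hproj_in_H minus_hproj_in_V])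

lemma vproj_in_V: "oproj M V q x \<in> V q"
  by (simp add: vproj_eq minus_hproj_in_V)

lemma hproj_H [simp]: "x \<in> H q \<Longrightarrow> oproj M H q x = x"
  by (rule oproj_eqI(1)) (auto simp: subspace_0[OF subspace_V])

lemma hproj_V [simp]: "x \<in> V q \<Longrightarrow> oproj M H q x = 0"
  by (rule oproj_eqI(1)) (auto simp: subspace_0[OF subspace_H])

lemma gm_hproj: "w \<in> H q \<Longrightarrow> gm M q (oproj M H q x) w = gm M q x w"
  using V_H_orthogonal(1)[OF minus_hproj_in_V[of x q], of w] by (simp add: gm_simps)

lemma gm_vproj: "w \<in> V q \<Longrightarrow> gm M q (oproj M V q x) w = gm M q x w"
  using V_H_orthogonal(2)[of w q "oproj M H q x"] hproj_in_H[of q x]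
  by (simp add: vproj_eq gm_simps)

lemma vfield_on_hproj:
  assumes "vfield_on M U X" "U \<subseteq> nbhd p"
  shows "vfield_on M U (\<lambda>q. oproj M H q (X q))"
proof -
  obtain W where W: "vfield_on M U W" "\<forall>q\<in>U. W q \<in> H q \<and> X q - W q \<in> V q"
    using horizontal_part_exists[OF assms] by (elim exE conjE)
  have "W q = oproj M H q (X q)" if "q \<in> U" for q
    using oproj_eqI(1)[of "W q" q "X q"] bspec[OF W(2) that] by simp
  from vfield_on_cong[OF W(1) this] show ?thesis .
qed

lemma vfield_on_vproj:
  assumes "vfield_on M U X" "U \<subseteq> nbhd p"
  shows "vfield_on M U (\<lambda>q. oproj M V q (X q))"
  unfolding vproj_eq by (rule vfield_on_diff[OF assms(1) vfield_on_hproj[OF assms]])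

lemma vfield_on_nbhd_ext_field: "vfield_on M (nbhd p) (ext_field M p x)"
  by (rule vfield_on_subset[OF vfield_on_ext_field open_nbhd]) (simp add: nbhd_def)

end

context riemannian_submersion_mfd
begin

section \<open>The tensor A on horizontal vectors\<close>

text \<open>Basic fields: prescribing constant derivatives of the pulled back coordinates relates the field to
  a constant coordinate field of the base. Its value at p is x because a horizontal vector is
  determined by its image under the differential.\<close>

lemma basic_field_exists:
  assumes x: "x \<in> H p"
  shows "\<exists>X. vfield_on M (nbhd p) X \<and> X p = x \<and> (\<forall>q\<in>nbhd p. X q \<in> H q \<and>
    mdiff M N F q (X q) = ext_field N (F p) (mdiff M N F p x) (F q))"
proof -
  define w where "w = mdiff M N F p x"
  have "\<exists>X. vfield_on M (nbhd p) X \<and> (\<forall>q\<in>nbhd p. X q \<in> H q \<and>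
      (\<forall>b\<in>Basis. dfun M (pulled_coord p b) q (X q) = w \<bullet> b))"
    by (rule horizontal_field_with_prescribed_products[OF open_nbhd order_refl])
      (rule smooth_fun_on_const[OF open_nbhd])
  then obtain X where X: "vfield_on M (nbhd p) X" "\<forall>q\<in>nbhd p. X q \<in> H q \<and>
      (\<forall>b\<in>Basis. dfun M (pulled_coord p b) q (X q) = w \<bullet> b)"
    by (elim exE conjE)
  have coord: "dchart N (chart_at N (F p)) (F q) (mdiff M N F q (X q)) = w" if "q \<in> nbhd p" for q
    by (rule euclidean_eqI) (use bspec[OF X(2) that] in \<open>simp add: dfun_pulled_coord[OF that]\<close>)
  have related: "mdiff M N F q (X q) = ext_field N (F p) w (F q)" if "q \<in> nbhd p" for q
    using N.ext_field_dchart[of "F q" "F p" "mdiff M N F q (X q)"] coord[OF that] that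
    by (simp add: nbhd_def)
  have "mdiff M N F p (X p) = mdiff M N F p x" using related[of p] by (simp add: w_def)
  then have "X p - x \<in> V p" by (simp add: vertical_def linear_diff[OF linear_mdiff])
  moreover have "X p - x \<in> H p" using bspec[OF X(2) in_nbhd] x subspace_diff[OF subspace_H] by simp
  ultimately have "X p = x" using H_inter_V[of "X p - x" p] by simp
  then show ?thesis using X related unfolding w_def by (intro exI[of _ X] conjI ballI) auto
qed

text \<open>The bracket annihilates the pulled back coordinates: each of its two terms differentiates a
  function that is constant near p.\<close>

lemma bracket_basic_vertical:
  assumes X: "vfield_on M (nbhd p) X"
    and basic: "\<And>q. q \<in> nbhd p \<Longrightarrow> mdiff M N F q (X q) = ext_field N (F p) w (F q)"
    and U: "vfield_on M (nbhd p) U" "\<And>q. q \<in> nbhd p \<Longrightarrow> U q \<in> V q"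
  shows "lie_bracket M X U p \<in> V p"
  unfolding vertical_iff[OF in_nbhd]
proof
  fix b :: 'f assume b: "b \<in> Basis"
  have cX: "dfun M (pulled_coord p b) q (X q) = w \<bullet> b" if "q \<in> nbhd p" for q
    using that by (simp add: dfun_pulled_coord[OF that] basic[OF that] N.dchart_ext_field nbhd_def)
  have cU: "dfun M (pulled_coord p b) q (U q) = 0" if "q \<in> nbhd p" for q
    using U(2)[OF that] b by (simp add: vertical_iff[OF that])
  have "dfun M (pulled_coord p b) p (lie_bracket M X U p) =
      dfun M (\<lambda>q. dfun M (pulled_coord p b) q (U q)) p (X p) -
      dfun M (\<lambda>q. dfun M (pulled_coord p b) q (X q)) p (U p)"
    by (rule dfun_lie_bracket[OF smooth_pulled_coord X U(1) in_nbhd])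
  also have "dfun M (\<lambda>q. dfun M (pulled_coord p b) q (U q)) p (X p) = dfun M (\<lambda>q. 0) p (X p)"
    by (rule dfun_cong[OF open_nbhd in_nbhd cU])
  also have "dfun M (\<lambda>q. dfun M (pulled_coord p b) q (X q)) p (U p) = dfun M (\<lambda>q. w \<bullet> b) p (U p)"
    by (rule dfun_cong[OF open_nbhd in_nbhd cX])
  finally show "dfun M (pulled_coord p b) p (lie_bracket M X U p) = 0" by simp
qed

text \<open>The squared length of a basic field is a function on the base, so it does not change along the
  fibres.\<close>

lemma length_basic_constant_on_fibres:
  assumes basic: "\<And>q. q \<in> nbhd p \<Longrightarrow> X q \<in> H q \<and> mdiff M N F q (X q) = ext_field N (F p) w (F q)"
    and u: "u \<in> V p"
  shows "dfun M (\<lambda>q. gm M q (X q) (X q)) p u = 0"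
proof -
  define k where "k y = gm N y (ext_field N (F p) w y) (ext_field N (F p) w y)" for y
  have k: "smooth_fun_on N (cdom (chart_at N (F p))) k"
    unfolding k_def by (rule N.smooth_fun_on_gm[OF N.vfield_on_ext_field N.vfield_on_ext_field])
  have "gm M q (X q) (X q) = k (F q)" if "q \<in> nbhd p" for q
    using isometry[of "X q" q "X q"] basic[OF that] by (simp add: k_def)
  then have "dfun M (\<lambda>q. gm M q (X q) (X q)) p u = dfun M (\<lambda>q. k (F q)) p u"
    by (rule dfun_cong[OF open_nbhd in_nbhd])
  also have "\<dots> = dfun N k (F p) 0"
    using dfun_pullback[OF k N.chart_at(2)] u by (simp add: vertical_def)
  also have "\<dots> = 0"
    by (rule linear_0[OF N.linear_dfun[OF k N.chart_at(2)]])
  finally show ?thesis .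
qed

text \<open>Extend x to a basic field X. The bracket of X and U is vertical, so \<open>g(x, D x U)\<close> equals
  \<open>g(x, D u X) = u (g(X, X)) / 2\<close> for \<open>u = U p\<close>, and this vanishes because F is isometric on
  horizontal vectors.\<close>

lemma D_vertical_skew:
  assumes U: "vfield_on M (nbhd p) U" "\<And>q. q \<in> nbhd p \<Longrightarrow> U q \<in> V q" and x: "x \<in> H p"
  shows "gm M p x (D p x U) = 0"
proof -
  obtain X where X: "vfield_on M (nbhd p) X" "X p = x" "\<forall>q\<in>nbhd p. X q \<in> H q \<and>
      mdiff M N F q (X q) = ext_field N (F p) (mdiff M N F p x) (F q)"
    using basic_field_exists[OF x] by (elim exE conjE)
  have "lie_bracket M X U p \<in> V p"
    by (rule bracket_basic_vertical[OF X(1) _ U]) (use X(3) in auto)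
  then have br: "gm M p x (lie_bracket M X U p) = 0" using V_H_orthogonal(2) x by blast
  have "dfun M (\<lambda>q. gm M q (X q) (X q)) p (U p) = 0"
    by (rule length_basic_constant_on_fibres[OF _ U(2)[OF in_nbhd]]) (use X(3) in auto)
  then have "gm M p x (D p (U p) X) = 0"
    using metric_compatible[OF X(1) X(1) in_nbhd, of "U p"] X(2) gm_sym[of p "D p (U p) X" x]
    by simp
  moreover have "D p x U = D p (U p) X + lie_bracket M X U p"
    using torsion_free[OF X(1) U(1) in_nbhd] X(2) by (simp add: algebra_simps)
  ultimately show ?thesis using br by (simp add: gm_simps)
qed

text \<open>The derivative of the vertical extension U of u in the direction x. For horizontal x and y it
  satisfies \<open>g(A x y, u) = - g(y, adjA p u x)\<close>; the right hand side is bilinear on the whole tangent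
  space, so the algebra of A is carried out with this map.\<close>

definition adjA where "adjA p u x = D p x (\<lambda>q. oproj M V q (ext_field M p u q))"

lemma vertical_extension:
  assumes "u \<in> V p"
  shows "vfield_on M (nbhd p) (\<lambda>q. oproj M V q (ext_field M p u q))"
    and "oproj M V q (ext_field M p u q) \<in> V q"
    and "oproj M V p (ext_field M p u p) = u"
  using vfield_on_vproj[OF vfield_on_nbhd_ext_field order_refl] vproj_in_V assms
  by (simp_all add: vproj_eq)

lemma linear_adjA: "u \<in> V p \<Longrightarrow> linear (adjA p u)"
  using linear_D[OF vertical_extension(1) in_nbhd] by (simp add: adjA_def[abs_def])

lemma adjA_skew:
  assumes u: "u \<in> V p" and x: "x \<in> H p" and y: "y \<in> H p"
  shows "gm M p x (adjA p u x) = 0" "gm M p y (adjA p u x) = - gm M p x (adjA p u y)"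
proof -
  have skew: "gm M p z (adjA p u z) = 0" if "z \<in> H p" for z
    unfolding adjA_def
    by (rule D_vertical_skew[OF vertical_extension(1)[OF u] vertical_extension(2)[OF u] that])
  then show "gm M p x (adjA p u x) = 0" using x .
  have "gm M p (x + y) (adjA p u (x + y)) = 0" by (rule skew[OF subspace_add[OF subspace_H x y]])
  then show "gm M p y (adjA p u x) = - gm M p x (adjA p u y)"
    using skew[OF x] skew[OF y] by (simp add: linear_add[OF linear_adjA[OF u]] gm_simps)
qed

text \<open>Differentiate \<open>g(Y, U) = 0\<close>.\<close>

lemma D_horizontal_vertical_part:
  assumes Y: "vfield_on M W Y" "\<And>q. q \<in> W \<Longrightarrow> Y q \<in> H q" and p: "p \<in> W" and u: "u \<in> V p"
  shows "gm M p (D p x Y) u = - gm M p (Y p) (adjA p u x)"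
proof -
  define U where "U q = oproj M V q (ext_field M p u q)" for q
  define W' where "W' = W \<inter> nbhd p"
  have W': "open W'" "W' \<subseteq> W" "W' \<subseteq> nbhd p" "p \<in> W'"
    using vfield_on_open[OF Y(1)] open_nbhd p by (auto simp: W'_def)
  have U: "vfield_on M W' U"
    unfolding U_def by (rule vfield_on_subset[OF vertical_extension(1)[OF u] W'(1,3)])
  have Y': "vfield_on M W' Y" by (rule vfield_on_subset[OF Y(1) W'(1,2)])
  have zero: "gm M q (Y q) (U q) = 0" if "q \<in> W'" for q
    using V_H_orthogonal(2)[OF vertical_extension(2)[OF u] Y(2)] W'(2) that unfolding U_def by auto
  have "dfun M (\<lambda>q. gm M q (Y q) (U q)) p x = dfun M (\<lambda>q. 0) p x"
    by (rule dfun_cong[OF W'(1,4) zero])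
  then have "gm M p (D p x Y) (U p) + gm M p (Y p) (D p x U) = 0"
    using metric_compatible[OF Y' U W'(4), of x] by simp
  moreover have "U p = u" unfolding U_def by (rule vertical_extension(3)[OF u])
  ultimately show ?thesis by (simp add: adjA_def U_def[abs_def])
qed

text \<open>The vertical part of an extension of a horizontal vector y vanishes at p, but not around p. It
  enters the second term of A, and differentiating \<open>g(W, Z) = 0\<close> for horizontal Z shows that it
  contributes nothing.\<close>

lemma D_vertical_horizontal_part_zero:
  assumes W: "vfield_on M U W" "\<And>q. q \<in> U \<Longrightarrow> W q \<in> V q" and p: "p \<in> U" "W p = 0" and z: "z \<in> H p"
  shows "gm M p (D p x W) z = 0"
proof -
  define Z where "Z q = oproj M H q (ext_field M p z q)" for q
  define U' where "U' = U \<inter> nbhd p"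
  have U': "open U'" "U' \<subseteq> U" "U' \<subseteq> nbhd p" "p \<in> U'"
    using vfield_on_open[OF W(1)] open_nbhd p by (auto simp: U'_def)
  have Z: "vfield_on M U' Z"
    unfolding Z_def
    by (rule vfield_on_subset[OF vfield_on_hproj[OF vfield_on_nbhd_ext_field order_refl] U'(1,3)])
  have W': "vfield_on M U' W" by (rule vfield_on_subset[OF W(1) U'(1,2)])
  have zero: "gm M q (W q) (Z q) = 0" if "q \<in> U'" for q
    using V_H_orthogonal(1)[OF W(2) hproj_in_H] U'(2) that unfolding Z_def by auto
  have "dfun M (\<lambda>q. gm M q (W q) (Z q)) p x = dfun M (\<lambda>q. 0) p x"
    by (rule dfun_cong[OF U'(1,4) zero])
  then have "gm M p (D p x W) (Z p) + gm M p (W p) (D p x Z) = 0"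
    using metric_compatible[OF W' Z U'(4), of x] by simp
  moreover have "Z p = z" using z by (simp add: Z_def)
  ultimately show ?thesis by (simp add: p(2) gm_simps)
qed

text \<open>For sections of H the vertical part of Y is zero around p, so only the first of the two terms
  of A is left.\<close>

lemma oneill_field_horizontal:
  assumes X: "section_on M H U X" and Y: "section_on M H U Y" and p: "p \<in> U"
  shows "oneill_field M D V X Y p \<in> V p"
    and "u \<in> V p \<Longrightarrow> gm M p (oneill_field M D V X Y p) u = - gm M p (Y p) (adjA p u (X p))"
proof -
  have YU: "vfield_on M U Y" "\<And>q. q \<in> U \<Longrightarrow> Y q \<in> H q" and Xp: "X p \<in> H p"
    using X Y p by (auto simp: section_on_def)
  have "D p (X p) (\<lambda>q. oproj M V q (Y q)) = 0"
    by (rule D_eq_zero[OF vfield_on_open[OF YU(1)] p]) (simp add: vproj_eq YU(2))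
  moreover have "D p (X p) Y = D p (X p) (\<lambda>q. oproj M H q (Y q))"
    by (rule D_cong[OF YU(1) p]) (simp add: YU(2))
  ultimately have eq: "oneill_field M D V X Y p = oproj M V p (D p (X p) Y)"
    using Xp subspace_0[OF subspace_V] by (simp add: oneill_field_def)
  show "oneill_field M D V X Y p \<in> V p" unfolding eq by (rule vproj_in_V)
  show "gm M p (oneill_field M D V X Y p) u = - gm M p (Y p) (adjA p u (X p))" if "u \<in> V p"
    unfolding eq gm_vproj[OF that] by (rule D_horizontal_vertical_part[OF YU p that])
qed

lemma oneill_horizontal:
  assumes x: "x \<in> H p" and y: "y \<in> H p"
  shows "oneill M D V p x y \<in> V p"
    and "u \<in> V p \<Longrightarrow> gm M p (oneill M D V p x y) u = - gm M p y (adjA p u x)"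
proof -
  define Y where "Y q = oproj M H q (ext_field M p y q)" for q
  define W where "W q = oproj M V q (ext_field M p y q)" for q
  have Y: "vfield_on M (nbhd p) Y" "\<And>q. q \<in> nbhd p \<Longrightarrow> Y q \<in> H q" "Y p = y"
    using vfield_on_hproj[OF vfield_on_nbhd_ext_field order_refl] hproj_in_H y
    by (auto simp: Y_def[abs_def])
  have W: "vfield_on M (nbhd p) W" "\<And>q. q \<in> nbhd p \<Longrightarrow> W q \<in> V q" "W p = 0"
    using vfield_on_vproj[OF vfield_on_nbhd_ext_field order_refl] vproj_in_V y
    by (auto simp: W_def[abs_def] vproj_eq)
  have "gm M p (oproj M H p (D p x W)) (oproj M H p (D p x W)) = 0"
    using D_vertical_horizontal_part_zero[OF W(1,2) in_nbhd W(3) hproj_in_H] by (simp add: gm_hproj hproj_in_H)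
  then have "oproj M H p (D p x W) = 0" using gm_eq_zero_iff by blast
  then have eq: "oneill M D V p x y = oproj M V p (D p x Y)"
    using x by (simp add: oneill_def oneill_field_def Y_def[abs_def] W_def[abs_def])
  show "oneill M D V p x y \<in> V p" unfolding eq by (rule vproj_in_V)
  show "gm M p (oneill M D V p x y) u = - gm M p y (adjA p u x)" if "u \<in> V p"
    unfolding eq gm_vproj[OF that]
    using D_horizontal_vertical_part[OF Y(1,2) in_nbhd that, of x] by (simp add: Y(3))
qed

lemma V_eqI:
  assumes "a \<in> V p" "b \<in> V p" "\<And>u. u \<in> V p \<Longrightarrow> gm M p a u = gm M p b u"
  shows "a = b"
proof -
  have "gm M p (a - b) (a - b) = 0"
    using assms(3)[OF subspace_diff[OF subspace_V assms(1,2)]] by (simp add: gm_simps)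
  then show ?thesis using gm_eq_zero_iff by auto
qed

lemma oneill_alternating:
  assumes "x \<in> H p" "y \<in> H p"
  shows "oneill M D V p x x = 0" "oneill M D V p y x = - oneill M D V p x y"
proof -
  show "oneill M D V p x x = 0"
    by (rule V_eqI[of _ p]) (use assms in \<open>simp_all add: oneill_horizontal subspace_0[OF subspace_V] adjA_skew gm_simps\<close>)
  show "oneill M D V p y x = - oneill M D V p x y"
    by (rule V_eqI[of _ p])
      (use assms adjA_skew(2)[of _ p x y] in \<open>simp_all add: oneill_horizontal subspace_neg[OF subspace_V] gm_simps\<close>)
qed

lemma horizontal_sections_through:
  assumes "x \<in> H p"
  shows "\<exists>X. section_on M H (nbhd p) X \<and> X p = x"
proof (intro exI conjI)
  show "section_on M H (nbhd p) (\<lambda>q. oproj M H q (ext_field M p x q))"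
    using vfield_on_hproj[OF vfield_on_nbhd_ext_field order_refl] hproj_in_H
    by (simp add: section_on_def)
qed (use assms in simp)

lemma oneill_field_eq_oneill:
  assumes "section_on M H U X" "section_on M H U Y" "p \<in> U"
  shows "oneill_field M D V X Y p = oneill M D V p (X p) (Y p)"
proof -
  have h: "X p \<in> H p" "Y p \<in> H p" using assms by (auto simp: section_on_def)
  show ?thesis
    by (rule V_eqI[of _ p]) (simp_all add: oneill_field_horizontal[OF assms] oneill_horizontal[OF h])
qed

lemma oneill_vanishes_iff:
  "oneill_vanishes M D V \<longleftrightarrow> (\<forall>p. \<forall>x\<in>H p. \<forall>y\<in>H p. oneill M D V p x y = 0)"
proof
  assume van: "oneill_vanishes M D V"
  show "\<forall>p. \<forall>x\<in>H p. \<forall>y\<in>H p. oneill M D V p x y = 0"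
  proof (intro allI ballI)
    fix p x y assume "x \<in> H p" "y \<in> H p"
    then obtain X Y where XY: "section_on M H (nbhd p) X" "X p = x" "section_on M H (nbhd p) Y" "Y p = y"
      using horizontal_sections_through by metis
    have "oneill_field M D V X Y p = 0"
      using van XY(1,3) in_nbhd unfolding oneill_vanishes_def by blast
    then show "oneill M D V p x y = 0"
      using oneill_field_eq_oneill[OF XY(1,3) in_nbhd] XY(2,4) by simp
  qed
next
  assume zero: "\<forall>p. \<forall>x\<in>H p. \<forall>y\<in>H p. oneill M D V p x y = 0"
  show "oneill_vanishes M D V"
    unfolding oneill_vanishes_def
  proof (intro allI impI ballI)
    fix U X Y p assume XY: "section_on M H U X \<and> section_on M H U Y" and p: "p \<in> U"
    then have "X p \<in> H p" "Y p \<in> H p" by (auto simp: section_on_def)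
    then show "oneill_field M D V X Y p = 0"
      using zero oneill_field_eq_oneill[OF conjunct1[OF XY] conjunct2[OF XY] p] by simp
  qed
qed

text \<open>Since the connection is torsion-free, the bracket is \<open>D X Y - D Y X\<close>, and the vertical parts of
  the two terms are \<open>A X Y\<close> and \<open>A Y X = - A X Y\<close>.\<close>

lemma vertical_part_bracket:
  assumes X: "section_on M H U X" and Y: "section_on M H U Y" and p: "p \<in> U" and u: "u \<in> V p"
  shows "gm M p (lie_bracket M X Y p) u = 2 * gm M p (oneill M D V p (X p) (Y p)) u"
proof -
  have XU: "vfield_on M U X" "\<And>q. q \<in> U \<Longrightarrow> X q \<in> H q" and YU: "vfield_on M U Y" "\<And>q. q \<in> U \<Longrightarrow> Y q \<in> H q"
    using X Y by (auto simp: section_on_def)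
  have h: "X p \<in> H p" "Y p \<in> H p" using XU(2) YU(2) p by auto
  have "gm M p (lie_bracket M X Y p) u = gm M p (D p (X p) Y) u - gm M p (D p (Y p) X) u"
    by (simp add: gm_simps flip: torsion_free[OF XU(1) YU(1) p])
  then show ?thesis
    using D_horizontal_vertical_part[OF YU p u, of "X p"] D_horizontal_vertical_part[OF XU p u, of "Y p"]
      adjA_skew(2)[OF u h] oneill_horizontal(2)[OF h u]
    by simp
qed

lemma oneill_vanishes_iff_integrable: "oneill_vanishes M D V \<longleftrightarrow> completely_integrable M H"
proof
  assume "oneill_vanishes M D V"
  then have zero: "\<forall>p. \<forall>x\<in>H p. \<forall>y\<in>H p. oneill M D V p x y = 0" by (simp add: oneill_vanishes_iff)
  show "completely_integrable M H"
    unfolding completely_integrable_def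
  proof (intro allI impI ballI)
    fix U X Y p assume XY: "section_on M H U X \<and> section_on M H U Y" and p: "p \<in> U"
    then have h: "X p \<in> H p" "Y p \<in> H p" by (auto simp: section_on_def)
    have "gm M p u (lie_bracket M X Y p) = 0" if "u \<in> V p" for u
      using vertical_part_bracket[OF conjunct1[OF XY] conjunct2[OF XY] p that] zero h
      by (simp add: gm_sym[of p u] gm_simps)
    then show "lie_bracket M X Y p \<in> H p" unfolding orth_compl_def by blast
  qed
next
  assume int: "completely_integrable M H"
  show "oneill_vanishes M D V"
    unfolding oneill_vanishes_iff
  proof (intro allI ballI)
    fix p x y assume xy: "x \<in> H p" "y \<in> H p"
    then obtain X Y where XY: "section_on M H (nbhd p) X" "X p = x" "section_on M H (nbhd p) Y" "Y p = y"
      using horizontal_sections_through by metis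
    have "lie_bracket M X Y p \<in> H p"
      using int XY(1,3) in_nbhd unfolding completely_integrable_def by blast
    then have "gm M p (oneill M D V p x y) u = gm M p 0 u" if "u \<in> V p" for u
      using vertical_part_bracket[OF XY(1,3) in_nbhd that] V_H_orthogonal(2)[OF that]
      by (simp add: XY gm_simps)
    then show "oneill M D V p x y = 0"
      by (rule V_eqI[OF oneill_horizontal(1)[OF xy] subspace_0[OF subspace_V]])
  qed
qed

end

context riemannian_mfd
begin

section \<open>Orthonormal bases of subspaces of a tangent space\<close>

lemma orthonormal_extension:
  assumes L: "subspace L"
  shows "n \<le> dim L \<Longrightarrow> \<exists>X. (\<forall>i<n. X i \<in> L) \<and>
    (\<forall>i<n. \<forall>j<n. gm M p (X i) (X j) = (if i = j then 1 else 0))"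
proof (induction n)
  case 0
  then show ?case by simp
next
  case (Suc n)
  from Suc.IH[OF Suc_leD[OF Suc.prems]] obtain X where X': "(\<forall>i<n. X i \<in> L) \<and>
      (\<forall>i<n. \<forall>j<n. gm M p (X i) (X j) = (if i = j then 1 else 0))"
    by (elim exE)
  have X: "X i \<in> L" if "i < n" for i
    using X' that by simp
  have XX: "gm M p (X i) (X j) = (if i = j then 1 else 0)" if "i < n" "j < n" for i j
    using X' that by simp
  have "\<not> L \<subseteq> span (X ` {..<n})"
  proof
    assume "L \<subseteq> span (X ` {..<n})"
    from dim_subset[OF this] have "dim L \<le> dim (X ` {..<n})" by simp
    also have "\<dots> \<le> card (X ` {..<n})" by (rule dim_le_card') simp
    also have "\<dots> \<le> n" using card_image_le[of "{..<n}" X] by simp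
    finally show False using Suc.prems by simp
  qed
  then obtain v where v: "v \<in> L" "v \<notin> span (X ` {..<n})" by blast
  define w where "w = (\<Sum>i<n. gm M p v (X i) *\<^sub>R X i)"
  define z where "z = v - w"
  define e where "e = (1 / sqrt (gm M p z z)) *\<^sub>R z"
  have w: "w \<in> span (X ` {..<n})" "w \<in> L"
    unfolding w_def
    by (intro span_sum span_scale span_base, simp) (intro subspace_sum subspace_scale L X, simp)
  have "z \<noteq> 0" using v w by (auto simp: z_def)
  then have zz: "0 < gm M p z z" by (rule gm_pos)
  have e: "e \<in> L" unfolding e_def z_def by (intro subspace_scale subspace_diff L v(1) w(2))
  have zX: "gm M p z (X j) = 0" if "j < n" for j
  proof -
    have "gm M p w (X j) = (\<Sum>i<n. gm M p v (X i) * (if i = j then 1 else 0))"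
      unfolding w_def using XX[OF _ that]
      by (simp add: linear_sum[OF linear_gm(2)] gm_simps)
    also have "\<dots> = gm M p v (X j)" using that by (simp add: sum.delta if_distrib cong: if_cong)
    finally show ?thesis by (simp add: z_def gm_simps)
  qed
  have eX: "gm M p e (X j) = 0" "gm M p (X j) e = 0" if "j < n" for j
    using zX[OF that] gm_sym[of p "X j" z] by (simp_all add: e_def gm_simps)
  have ee: "gm M p e e = 1"
    using zz by (simp add: e_def gm_simps)
  show ?case
  proof (rule exI[of _ "X(n := e)"], intro conjI allI impI)
    fix i assume "i < Suc n"
    then show "(X(n := e)) i \<in> L" using X e by (auto simp: less_Suc_eq)
  next
    fix i j assume "i < Suc n" "j < Suc n"
    then show "gm M p ((X(n := e)) i) ((X(n := e)) j) = (if i = j then 1 else 0)"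
      using XX eX ee by (auto simp: less_Suc_eq)
  qed
qed

lemma onb_exists:
  assumes L: "subspace L"
  shows "\<exists>X. is_onb M p L X"
proof -
  define n where "n = dim L"
  have "\<exists>X. (\<forall>i<n. X i \<in> L) \<and> (\<forall>i<n. \<forall>j<n. gm M p (X i) (X j) = (if i = j then 1 else 0))"
    by (rule orthonormal_extension[OF L]) (simp add: n_def)
  then obtain X where X: "\<forall>i<n. X i \<in> L"
    "\<forall>i<n. \<forall>j<n. gm M p (X i) (X j) = (if i = j then 1 else 0)"
    by (elim exE conjE)
  have inj: "inj_on X {..<n}"
  proof (rule inj_onI)
    fix i j assume ij: "i \<in> {..<n}" "j \<in> {..<n}" "X i = X j"
    have "gm M p (X i) (X j) = 1" using X(2) ij(2) unfolding ij(3) by simp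
    moreover have "gm M p (X i) (X j) = (if i = j then 1 else 0)" using X(2) ij(1,2) by simp
    ultimately show "i = j" by (simp split: if_splits)
  qed
  have ind: "independent (X ` {..<n})"
  proof
    assume "dependent (X ` {..<n})"
    then obtain i where i: "i < n" "X i \<in> span (X ` {..<n} - {X i})"
      unfolding dependent_def by blast
    have "gm M p (X i) (X i) = 0"
      by (rule gm_span_zero[OF _ i(2)]) (use X(2) i(1) in auto)
    then show False using X(2) i(1) by simp
  qed
  have "X ` {..<n} \<subseteq> L" using X(1) by auto
  moreover have "L \<subseteq> span (X ` {..<n})"
    by (rule card_ge_dim_independent[OF \<open>X ` {..<n} \<subseteq> L\<close> ind]) (simp add: card_image[OF inj] flip: n_def)
  ultimately have "span (X ` {..<n}) = L" using span_minimal[OF _ L] by blast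
  then show ?thesis using X(2) by (intro exI[of _ X]) (simp add: is_onb_def n_def)
qed

lemma is_onb_onb: "subspace L \<Longrightarrow> is_onb M p L (onb M p L)"
  unfolding onb_def by (rule someI_ex[OF onb_exists])

lemma onb_product:
  "is_onb M p L X \<Longrightarrow> i < dim L \<Longrightarrow> j < dim L \<Longrightarrow> gm M p (X i) (X j) = (if i = j then 1 else 0)"
  by (simp add: is_onb_def)

lemma onb_in: "is_onb M p L X \<Longrightarrow> i < dim L \<Longrightarrow> X i \<in> L"
  unfolding is_onb_def using span_base[of "X i" "X ` {..<dim L}"] by auto

lemma onb_eq_zero:
  assumes X: "is_onb M p L X" and v: "v \<in> L" "\<And>i. i < dim L \<Longrightarrow> gm M p v (X i) = 0"
  shows "v = 0"
proof -
  have "v \<in> span (X ` {..<dim L})" using X v(1) by (simp add: is_onb_def)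
  then have "gm M p v v = 0" using gm_span_zero[of "X ` {..<dim L}" p v v] v(2) by auto
  then show ?thesis by (simp add: gm_eq_zero_iff)
qed

lemma gm_orthonormal_sum:
  assumes "is_onb M p L X" "j < dim L"
  shows "gm M p (\<Sum>i<dim L. a i *\<^sub>R X i) (X j) = a j"
proof -
  have "gm M p (\<Sum>i<dim L. a i *\<^sub>R X i) (X j) = (\<Sum>i<dim L. a i * gm M p (X i) (X j))"
    by (simp add: linear_sum[OF linear_gm(2)] gm_simps)
  also have "\<dots> = (\<Sum>i<dim L. if i = j then a i else 0)"
    by (rule sum.cong) (auto simp: onb_product[OF assms(1) _ assms(2)])
  also have "\<dots> = a j" using assms(2) by (simp add: sum.delta)
  finally show ?thesis .
qed

lemma onb_expansion:
  assumes L: "subspace L" and X: "is_onb M p L X" and v: "v \<in> L"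
  shows "v = (\<Sum>i<dim L. gm M p v (X i) *\<^sub>R X i)"
proof -
  have "v - (\<Sum>i<dim L. gm M p v (X i) *\<^sub>R X i) = 0"
  proof (rule onb_eq_zero[OF X])
    show "v - (\<Sum>i<dim L. gm M p v (X i) *\<^sub>R X i) \<in> L"
      by (intro subspace_diff subspace_sum subspace_scale L v) (simp add: onb_in[OF X])
  qed (simp add: gm_simps gm_orthonormal_sum[OF X])
  then show ?thesis by simp
qed

lemma onb_linear_expansion:
  assumes "subspace L" "is_onb M p L X" "v \<in> L" "linear (f :: 'e \<Rightarrow> real)"
  shows "f v = (\<Sum>i<dim L. gm M p v (X i) * f (X i))"
proof -
  have "f v = f (\<Sum>i<dim L. gm M p v (X i) *\<^sub>R X i)" using onb_expansion[OF assms(1-3)] by simp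
  then show ?thesis by (simp add: linear_sum[OF assms(4)] linear_cmul[OF assms(4)])
qed

lemma parseval:
  assumes "subspace L" "is_onb M p L X" "v \<in> L"
  shows "(\<Sum>i<dim L. (gm M p v (X i))\<^sup>2) = gm M p v v"
  using onb_linear_expansion[OF assms linear_gm(1)[of p v]] by (simp add: power2_eq_square)

lemma bessel:
  assumes X: "is_onb M p L X"
  shows "(\<Sum>i<dim L. (gm M p v (X i))\<^sup>2) \<le> gm M p v v"
proof -
  define w where "w = (\<Sum>i<dim L. gm M p v (X i) *\<^sub>R X i)"
  have vw: "gm M p v w = (\<Sum>i<dim L. (gm M p v (X i))\<^sup>2)"
    unfolding w_def by (simp add: linear_sum[OF linear_gm(1)] gm_simps power2_eq_square)
  have "gm M p w w = (\<Sum>i<dim L. gm M p v (X i) * gm M p w (X i))"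
    by (subst (2) w_def) (simp add: linear_sum[OF linear_gm(1)] gm_simps)
  also have "\<dots> = gm M p v w"
    unfolding vw by (rule sum.cong) (auto simp: w_def gm_orthonormal_sum[OF X] power2_eq_square)
  finally have "gm M p (v - w) (v - w) = gm M p v v - gm M p v w"
    using gm_sym[of p w v] by (simp add: gm_simps)
  then show ?thesis using gm_nonneg[of p "v - w"] vw by simp
qed

text \<open>A linear functional on H is the product with a vector b of H, and b has the squared length
  given by the right hand side; Bessel's inequality for b bounds the left hand side.\<close>

lemma sum_squares_functional_mono:
  assumes H: "subspace H" "is_onb M p H X" and L: "L \<subseteq> H" "is_onb M p L Y"
    and f: "linear (f :: 'e \<Rightarrow> real)"
  shows "(\<Sum>j<dim L. (f (Y j))\<^sup>2) \<le> (\<Sum>i<dim H. (f (X i))\<^sup>2)"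
proof -
  define b where "b = (\<Sum>i<dim H. f (X i) *\<^sub>R X i)"
  have fb: "f v = gm M p b v" if "v \<in> H" for v
    using onb_linear_expansion[OF H that f] gm_sym[of p _ v] unfolding b_def
    by (simp add: linear_sum[OF linear_gm(2)] gm_simps mult.commute)
  have "b \<in> H" unfolding b_def by (intro subspace_sum subspace_scale H(1)) (simp add: onb_in[OF H(2)])
  have "(\<Sum>j<dim L. (f (Y j))\<^sup>2) = (\<Sum>j<dim L. (gm M p b (Y j))\<^sup>2)"
    by (rule sum.cong) (simp_all add: fb subsetD[OF L(1)] onb_in[OF L(2)])
  also have "\<dots> \<le> gm M p b b" by (rule bessel[OF L(2)])
  also have "\<dots> = (\<Sum>i<dim H. (gm M p b (X i))\<^sup>2)" by (rule parseval[OF H \<open>b \<in> H\<close>, symmetric])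
  also have "\<dots> = (\<Sum>i<dim H. (f (X i))\<^sup>2)"
    by (rule sum.cong) (simp_all add: fb onb_in[OF H(2)])
  finally show ?thesis .
qed

lemma sum_squares_bilinear_mono:
  assumes H: "subspace H" "is_onb M p H X" and L: "L \<subseteq> H" "is_onb M p L Y"
    and B1: "\<And>y. linear (\<lambda>x. B x y :: real)" and B2: "\<And>x. linear (B x)"
  shows "(\<Sum>i<dim L. \<Sum>j<dim L. (B (Y i) (Y j))\<^sup>2) \<le> (\<Sum>i<dim H. \<Sum>j<dim H. (B (X i) (X j))\<^sup>2)"
proof -
  have "(\<Sum>i<dim L. \<Sum>j<dim L. (B (Y i) (Y j))\<^sup>2) \<le> (\<Sum>i<dim L. \<Sum>j<dim H. (B (Y i) (X j))\<^sup>2)"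
    by (intro sum_mono sum_squares_functional_mono[OF H L B2])
  also have "\<dots> = (\<Sum>j<dim H. \<Sum>i<dim L. (B (Y i) (X j))\<^sup>2)" by (rule sum.swap)
  also have "\<dots> \<le> (\<Sum>j<dim H. \<Sum>i<dim H. (B (X i) (X j))\<^sup>2)"
    by (intro sum_mono sum_squares_functional_mono[OF H L B1])
  also have "\<dots> = (\<Sum>i<dim H. \<Sum>j<dim H. (B (X i) (X j))\<^sup>2)" by (rule sum.swap)
  finally show ?thesis .
qed

end

context riemannian_submersion_mfd
begin

section \<open>Casorati curvatures and the horizontal scalar curvature\<close>

text \<open>The squared Hilbert--Schmidt norm of the restriction of A to L, that is \<open>dim L\<close> times the
  Casorati curvature of L.\<close>

definition normA where
  "normA p L = (\<Sum>k<dim (V p). \<Sum>i<dim L. \<Sum>j<dim L.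
    (gm M p (oneill M D V p (onb M p L i) (onb M p L j)) (onb M p (V p) k))\<^sup>2)"

lemma casorati_eq: "casorati M D V p L = normA p L / real (dim L)"
  by (simp add: casorati_def normA_def Let_def)

lemma normA_nonneg: "0 \<le> normA p L"
  unfolding normA_def by (intro sum_nonneg) auto

text \<open>Tested against one vector of the vertical basis, A is a bilinear form on horizontal vectors, and
  the sum of its squares over an orthonormal basis grows with the subspace.\<close>

lemma normA_mono:
  assumes L: "subspace L" "L \<subseteq> H p"
  shows "normA p L \<le> normA p (H p)"
  unfolding normA_def
proof (rule sum_mono)
  fix k assume "k \<in> {..<dim (V p)}"
  define u where "u = onb M p (V p) k"
  have u: "u \<in> V p" unfolding u_def
    by (rule onb_in[OF is_onb_onb[OF subspace_V]]) (use \<open>k \<in> _\<close> in simp)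
  define B where "B x y = - gm M p y (adjA p u x)" for x y
  have B: "gm M p (oneill M D V p x y) u = B x y" if "x \<in> H p" "y \<in> H p" for x y
    unfolding B_def by (rule oneill_horizontal(2)[OF that u])
  have B1: "linear (\<lambda>x. B x y)" for y
    unfolding B_def using linear_compose_neg[OF linear_compose[OF linear_adjA[OF u] linear_gm(1)[of p y]]]
    by (simp add: o_def)
  have B2: "linear (B x)" for x
    unfolding B_def[abs_def] using linear_compose_neg[OF linear_gm(2)[of p "adjA p u x"]] .
  have XL: "onb M p L i \<in> H p" if "i < dim L" for i
    using onb_in[OF is_onb_onb[OF L(1)] that] L(2) by auto
  have XH: "onb M p (H p) i \<in> H p" if "i < dim (H p)" for i
    using onb_in[OF is_onb_onb[OF subspace_H] that] .
  have "(\<Sum>i<dim L. \<Sum>j<dim L. (B (onb M p L i) (onb M p L j))\<^sup>2) \<le>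
      (\<Sum>i<dim (H p). \<Sum>j<dim (H p). (B (onb M p (H p) i) (onb M p (H p) j))\<^sup>2)"
    by (rule sum_squares_bilinear_mono[OF subspace_H is_onb_onb[OF subspace_H] L(2)
          is_onb_onb[OF L(1)] B1 B2])
  then show "(\<Sum>i<dim L. \<Sum>j<dim L. (gm M p (oneill M D V p (onb M p L i) (onb M p L j)) u)\<^sup>2) \<le>
      (\<Sum>i<dim (H p). \<Sum>j<dim (H p).
        (gm M p (oneill M D V p (onb M p (H p) i) (onb M p (H p) j)) u)\<^sup>2)"
    by (simp add: B XL XH)
qed

lemma normA_eq_sum:
  "normA p (H p) = (\<Sum>i<dim (H p). \<Sum>j<dim (H p).
    gm M p (oneill M D V p (onb M p (H p) i) (onb M p (H p) j))
      (oneill M D V p (onb M p (H p) i) (onb M p (H p) j)))"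
proof -
  have XH: "onb M p (H p) i \<in> H p" if "i < dim (H p)" for i
    using onb_in[OF is_onb_onb[OF subspace_H] that] .
  have "normA p (H p) = (\<Sum>i<dim (H p). \<Sum>j<dim (H p). \<Sum>k<dim (V p).
    (gm M p (oneill M D V p (onb M p (H p) i) (onb M p (H p) j)) (onb M p (V p) k))\<^sup>2)"
    unfolding normA_def by (rule trans[OF sum.swap], rule sum.cong[OF refl], rule sum.swap)
  then show ?thesis
    by (simp add: parseval[OF subspace_V is_onb_onb[OF subspace_V]] oneill_horizontal(1) XH)
qed

lemma normA_eq_zero:
  assumes "normA p (H p) = 0" and x: "x \<in> H p" and y: "y \<in> H p"
  shows "oneill M D V p x y = 0"
proof -
  define X where "X = onb M p (H p)"
  have X: "is_onb M p (H p) X" unfolding X_def by (rule is_onb_onb[OF subspace_H])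
  have XH: "X i \<in> H p" if "i < dim (H p)" for i by (rule onb_in[OF X that])
  have "\<forall>i\<in>{..<dim (H p)}. (\<Sum>j<dim (H p). gm M p (oneill M D V p (X i) (X j)) (oneill M D V p (X i) (X j))) = 0"
    using assms(1) unfolding normA_eq_sum X_def
    by (subst (asm) sum_nonneg_eq_0_iff) (auto intro!: sum_nonneg gm_nonneg)
  then have zero: "oneill M D V p (X i) (X j) = 0" if "i < dim (H p)" "j < dim (H p)" for i j
    using that by (simp add: sum_nonneg_eq_0_iff gm_nonneg gm_eq_zero_iff)
  show ?thesis
  proof (rule V_eqI[OF oneill_horizontal(1)[OF x y] subspace_0[OF subspace_V]])
    fix u assume u: "u \<in> V p"
    have ij: "gm M p (X j) (adjA p u (X i)) = 0" if "i < dim (H p)" "j < dim (H p)" for i j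
      using oneill_horizontal(2)[OF XH[OF that(1)] XH[OF that(2)] u] zero[OF that]
      by (simp add: gm_simps)
    have yi: "gm M p y (adjA p u (X i)) = 0" if "i < dim (H p)" for i
      using onb_linear_expansion[OF subspace_H X y linear_gm(2)[of p "adjA p u (X i)"]] ij[OF that]
      by simp
    have "linear (\<lambda>x. gm M p y (adjA p u x))"
      using linear_compose[OF linear_adjA[OF u] linear_gm(1)[of p y]] by (simp add: o_def)
    from onb_linear_expansion[OF subspace_H X x this]
    have "gm M p y (adjA p u x) = 0" using yi by simp
    then show "gm M p (oneill M D V p x y) u = gm M p 0 u"
      using oneill_horizontal(2)[OF x y u] by (simp add: gm_simps)
  qed
qed

lemma oneill_vanishes_iff_normA: "oneill_vanishes M D V \<longleftrightarrow> (\<forall>p. normA p (H p) = 0)"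
proof
  assume "oneill_vanishes M D V"
  then have "oneill M D V p (onb M p (H p) i) (onb M p (H p) j) = 0"
    if "i < dim (H p)" "j < dim (H p)" for p i j
    using that onb_in[OF is_onb_onb[OF subspace_H]] by (simp add: oneill_vanishes_iff)
  then show "\<forall>p. normA p (H p) = 0" by (simp add: normA_eq_sum gm_simps)
next
  assume "\<forall>p. normA p (H p) = 0"
  then show "oneill_vanishes M D V" using normA_eq_zero by (simp add: oneill_vanishes_iff)
qed

lemma hyperplanes_nonempty: "hyperplanes (H p) \<noteq> {}"
proof -
  obtain T where "subspace T" "T \<subseteq> span (H p)" "dim T = dim (H p) - 1"
    using choose_subspace_of_subspace[of "dim (H p) - 1" "H p"] by auto
  then show ?thesis using span_eq_iff[THEN iffD2, OF subspace_H] by (auto simp: hyperplanes_def)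
qed

lemma casorati_hyperplane:
  assumes "L \<in> hyperplanes (H p)" "2 \<le> dim (H p)"
  shows "0 \<le> casorati M D V p L" "casorati M D V p L \<le> normA p (H p) / (real (dim (H p)) - 1)"
  using assms normA_nonneg[of p L] normA_mono[of L p]
  by (auto simp: casorati_eq hyperplanes_def of_nat_diff intro!: divide_right_mono)

lemma delta_C_ge:
  assumes s: "2 \<le> dim (H p)"
  shows "normA p (H p) / (2 * real (dim (H p))) \<le> delta_C M D V p"
proof -
  have "0 \<le> (INF L\<in>hyperplanes (H p). casorati M D V p L)"
    by (rule cINF_greatest[OF hyperplanes_nonempty]) (rule casorati_hyperplane(1)[OF _ s])
  then show ?thesis by (simp add: delta_C_def Let_def casorati_eq)
qed

text \<open>For a hyperplane L one has \<open>C(L) \<le> normA p (H p) / (s - 1)\<close>, while the Casorati curvature of the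
  whole horizontal space is \<open>normA p (H p) / s\<close>. The factor on the left hand side is
  \<open>2 / s - (2 s - 1) / (2 s (s - 1))\<close>.\<close>

lemma delta_C_hat_ge:
  assumes s: "2 \<le> dim (H p)"
  shows "(2 * real (dim (H p)) - 3) / (2 * real (dim (H p)) * (real (dim (H p)) - 1)) * normA p (H p)
    \<le> delta_C_hat M D V p"
proof -
  define t where "t = real (dim (H p))"
  have t: "2 \<le> t" using s by (simp add: t_def)
  have "(SUP L\<in>hyperplanes (H p). casorati M D V p L) \<le> normA p (H p) / (t - 1)"
    unfolding t_def by (rule cSUP_least[OF hyperplanes_nonempty]) (rule casorati_hyperplane(2)[OF _ s])
  then have "(2 * t - 1) / (2 * t) * (SUP L\<in>hyperplanes (H p). casorati M D V p L) \<le>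
      (2 * t - 1) / (2 * t) * (normA p (H p) / (t - 1))"
    using t by (intro mult_left_mono) auto
  moreover have "2 * (normA p (H p) / t) - (2 * t - 1) / (2 * t) * (normA p (H p) / (t - 1)) =
      (2 * t - 3) / (2 * t * (t - 1)) * normA p (H p)"
    using t by (simp add: field_simps)
  ultimately show ?thesis
    by (simp add: delta_C_hat_def Let_def casorati_eq flip: t_def)
qed

lemma delta_eq_zero:
  assumes s: "2 \<le> dim (H p)" and zero: "normA p (H p) = 0"
  shows "delta_C M D V p = 0" "delta_C_hat M D V p = 0"
proof -
  have cas: "casorati M D V p L = 0" if "L \<in> hyperplanes (H p)" for L
    using casorati_hyperplane[OF that s] zero by simp
  have "(INF L\<in>hyperplanes (H p). casorati M D V p L) = (INF L\<in>hyperplanes (H p). 0)"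
    "(SUP L\<in>hyperplanes (H p). casorati M D V p L) = (SUP L\<in>hyperplanes (H p). 0)"
    using cas by (simp_all cong: INF_cong SUP_cong)
  then show "delta_C M D V p = 0" "delta_C_hat M D V p = 0"
    using hyperplanes_nonempty[of p] zero
    by (simp_all add: delta_C_def delta_C_hat_def Let_def casorati_eq)
qed

text \<open>O'Neill's formula \<open>hcurv x y y x = g(R(x, y) y, x) - 3 |A x y|\<^sup>2\<close>, summed over an orthonormal basis.\<close>

lemma hscal_eq:
  "hscal M D V p = ((\<Sum>i<dim (H p). \<Sum>j<dim (H p).
      gm M p (curv M D p (onb M p (H p) i) (onb M p (H p) j) (onb M p (H p) j)) (onb M p (H p) i))
    - 3 * normA p (H p)) / (real (dim (H p)) * (real (dim (H p)) - 1))"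
proof -
  define X where "X = onb M p (H p)"
  have XH: "X i \<in> H p" if "i < dim (H p)" for i
    unfolding X_def by (rule onb_in[OF is_onb_onb[OF subspace_H] that])
  have "hcurv M D V p (X i) (X j) (X j) (X i) = gm M p (curv M D p (X i) (X j) (X j)) (X i)
      - 3 * gm M p (oneill M D V p (X i) (X j)) (oneill M D V p (X i) (X j))"
    if "i < dim (H p)" "j < dim (H p)" for i j
    using oneill_alternating(1)[OF XH[OF that(1)] XH[OF that(1)]]
      oneill_alternating(2)[OF XH[OF that(1)] XH[OF that(2)]]
    by (simp add: hcurv_def gm_simps)
  then show ?thesis
    unfolding hscal_def normA_eq_sum X_def[symmetric] Let_def
    by (simp add: sum_subtractf sum_distrib_left)
qed

text \<open>Let B be the contribution of the curvature of the total space to the horizontal scalar curvature.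
  What is left is a negative multiple of the squared norm of A, whereas both Casorati invariants are
  at least a positive multiple of it and vanish with it. So the difference of the two sides of the
  inequality has the sign and the zeros of the squared norm of A.\<close>

lemma casorati_bound:
  assumes s: "\<And>p. dim (H p) = s" "3 \<le> s"
    and B: "\<And>p. hscal M D V p = B p - 3 * normA p (H p) / (real s * (real s - 1))"
    and \<delta>: "\<delta> \<in> {delta_C M D V, delta_C_hat M D V}"
  shows "(\<forall>p. hscal M D V p \<le> \<delta> p + B p) \<and>
    ((\<forall>p. hscal M D V p = \<delta> p + B p) \<longleftrightarrow> oneill_vanishes M D V)"
proof -
  have s2: "2 \<le> dim (H p)" for p using s by simp
  have pos: "0 < real s * (real s - 1)" using s(2) by simp
  obtain k :: real where k: "0 < k" "\<And>p. k * normA p (H p) \<le> \<delta> p"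
  proof (cases "\<delta> = delta_C M D V")
    case True
    show thesis
      by (rule that[of "1 / (2 * real s)"]) (use delta_C_ge[OF s2] s True in auto)
  next
    case False
    then have "\<delta> = delta_C_hat M D V" using \<delta> by simp
    then show thesis
      by (intro that[of "(2 * real s - 3) / (2 * real s * (real s - 1))"])
        (use delta_C_hat_ge[OF s2] s in \<open>auto intro!: divide_pos_pos mult_pos_pos\<close>)
  qed
  have \<delta>0: "\<delta> p = 0" if "normA p (H p) = 0" for p
    using delta_eq_zero[OF s2 that] \<delta> by auto
  have le: "0 \<le> 3 * normA p (H p) / (real s * (real s - 1))" "0 \<le> \<delta> p" for p
    using normA_nonneg[of p "H p"] pos
      order_trans[OF mult_nonneg_nonneg[OF less_imp_le[OF k(1)] normA_nonneg] k(2)]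
    by (simp_all add: divide_nonneg_pos)
  have eq: "hscal M D V p = \<delta> p + B p \<longleftrightarrow> normA p (H p) = 0" for p
  proof
    assume "hscal M D V p = \<delta> p + B p"
    then have "\<delta> p = 0" using B[of p] le[of p] by simp
    then have "k * normA p (H p) \<le> 0" using k(2)[of p] by simp
    then show "normA p (H p) = 0" using k(1) normA_nonneg[of p "H p"] by (simp add: mult_le_0_iff)
  qed (simp add: B \<delta>0)
  have "hscal M D V p \<le> \<delta> p + B p" for p using B[of p] le[of p] by simp
  then show ?thesis by (simp add: eq oneill_vanishes_iff_normA)
qed

end

section \<open>The curvature of a slant submersion on horizontal planes\<close>

locale contact_submersion_mfd = riemannian_submersion_mfd M D N F
  for M :: "('a::{t2_space, second_countable_topology}, 'e::euclidean_space) riem_mfd"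
    and D :: "('a, 'e) covd"
    and N :: "('b::{t2_space, second_countable_topology}, 'f::euclidean_space) riem_mfd"
    and F :: "'a \<Rightarrow> 'b" +
  fixes \<phi> :: "'a \<Rightarrow> 'e \<Rightarrow> 'e" and \<xi> :: "'a \<Rightarrow> 'e" and \<eta> :: "'a \<Rightarrow> 'e \<Rightarrow> real"
  assumes contact: "almost_contact_metric M \<phi> \<xi> \<eta>"
begin

lemma linear_phi: "linear (\<phi> p)"
  and linear_eta: "linear (\<eta> p)"
  and phi_phi: "\<phi> p (\<phi> p v) = - v + \<eta> p v *\<^sub>R \<xi> p"
  and eta_xi: "\<eta> p (\<xi> p) = 1"
  and phi_xi: "\<phi> p (\<xi> p) = 0"
  and gm_phi_phi: "gm M p (\<phi> p v) (\<phi> p w) = gm M p v w - \<eta> p v * \<eta> p w"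
  using contact by (simp_all add: almost_contact_metric_def)

lemma gm_xi: "gm M p v (\<xi> p) = \<eta> p v"
  using gm_phi_phi[of p v "\<xi> p"] by (simp add: phi_xi eta_xi gm_simps)

text \<open>Evaluate \<open>\<phi>\<^sup>3\<close> in two ways.\<close>

lemma eta_phi: "\<eta> p (\<phi> p v) = 0"
proof -
  have "\<phi> p (\<phi> p (\<phi> p v)) = \<phi> p (- v + \<eta> p v *\<^sub>R \<xi> p)" by (simp only: phi_phi[of p v])
  also have "\<dots> = - \<phi> p v"
    by (simp add: linear_add[OF linear_phi] linear_diff[OF linear_phi] linear_neg[OF linear_phi]
        linear_cmul[OF linear_phi] phi_xi)
  finally have "\<eta> p (\<phi> p v) *\<^sub>R \<xi> p = 0" using phi_phi[of p "\<phi> p v"] by simp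
  moreover have "\<xi> p \<noteq> 0" using eta_xi[of p] linear_0[OF linear_eta] by fastforce
  ultimately show ?thesis by simp
qed

lemma phi_skew: "gm M p (\<phi> p v) w = - gm M p v (\<phi> p w)"
  using gm_phi_phi[of p v "\<phi> p w"]
  by (simp add: phi_phi[of p w] eta_phi gm_simps gm_xi)

lemma phi_skew_self: "gm M p v (\<phi> p v) = 0"
  using phi_skew[of p v v] gm_sym[of p "\<phi> p v" v] by simp

abbreviation PH where "PH p x \<equiv> oproj M H p (\<phi> p x)"

text \<open>By Parseval's identity the left hand side is the squared length of \<open>PH p x\<close>, and \<open>PH p\<close> is
  skew-symmetric on horizontal vectors.\<close>

lemma sum_squares_phi:
  assumes X: "is_onb M p (H p) X" and x: "x \<in> H p"
  shows "(\<Sum>i<dim (H p). (gm M p (X i) (\<phi> p x))\<^sup>2) = - gm M p x (PH p (PH p x))"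
proof -
  have "gm M p (X i) (\<phi> p x) = gm M p (PH p x) (X i)" if "i < dim (H p)" for i
    using gm_hproj[OF onb_in[OF X that], of "\<phi> p x"] gm_sym[of p "X i" "\<phi> p x"] by simp
  then have "(\<Sum>i<dim (H p). (gm M p (X i) (\<phi> p x))\<^sup>2) = (\<Sum>i<dim (H p). (gm M p (PH p x) (X i))\<^sup>2)"
    by simp
  also have "\<dots> = gm M p (PH p x) (PH p x)" by (rule parseval[OF subspace_H X hproj_in_H])
  also have "\<dots> = gm M p (\<phi> p x) (PH p x)" by (rule gm_hproj[OF hproj_in_H])
  also have "\<dots> = - gm M p x (\<phi> p (PH p x))" by (rule phi_skew)
  also have "gm M p x (\<phi> p (PH p x)) = gm M p x (PH p (PH p x))"
    using gm_hproj[OF x, of "\<phi> p (PH p x)"] gm_sym[of p "\<phi> p (PH p x)" x]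
      gm_sym[of p "PH p (PH p x)" x] by simp
  finally show ?thesis .
qed

text \<open>The slant condition speaks about vectors orthogonal to the Reeb field. It is applied to the
  component y of x orthogonal to \<open>\<xi> p\<close>, which is horizontal in both positions of the Reeb field and has
  the same image under \<open>\<phi>\<close> as x.\<close>

lemma horizontal_slant_square:
  assumes slant: "horizontal_slant M V \<phi> \<eta> \<theta>" and x: "x \<in> H p"
    and xi: "\<xi> p \<in> H p \<or> \<xi> p \<in> V p"
  shows "gm M p x (PH p (PH p x)) = - (cos (\<theta> p))\<^sup>2 * (gm M p x x - (\<eta> p x)\<^sup>2)"
proof -
  define y where "y = x - \<eta> p x *\<^sub>R \<xi> p"
  have y: "y \<in> H p"
  proof (cases "\<xi> p \<in> H p")
    case True
    then show ?thesis unfolding y_def by (intro subspace_diff subspace_scale subspace_H x)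
  next
    case False
    then have "\<eta> p x = 0" using xi V_H_orthogonal(2)[of "\<xi> p" p x] x by (simp add: gm_xi)
    then show ?thesis using x by (simp add: y_def)
  qed
  have "\<eta> p y = 0"
    by (simp add: y_def linear_diff[OF linear_eta] linear_cmul[OF linear_eta] eta_xi)
  then have "PH p (PH p y) = - ((cos (\<theta> p))\<^sup>2 *\<^sub>R y)"
    using slant y by (simp add: horizontal_slant_def)
  moreover have "\<phi> p y = \<phi> p x"
    by (simp add: y_def linear_diff[OF linear_phi] linear_cmul[OF linear_phi] phi_xi)
  ultimately have square: "PH p (PH p x) = - ((cos (\<theta> p))\<^sup>2 *\<^sub>R y)" by simp
  show ?thesis
    unfolding square by (simp add: y_def gm_simps gm_xi power2_eq_square algebra_simps)
qed

text \<open>In the equation of the space form, the three terms with \<open>c2\<close> add up to \<open>3 g(X\<^sub>i, \<phi> X\<^sub>j)\<^sup>2\<close> because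
  \<open>\<phi>\<close> is skew-symmetric. The number E is 1 or 0 according to the position of the Reeb field.\<close>

lemma sum_horizontal_curvature:
  assumes sf: "gen_sasakian_space_form M D \<phi> \<xi> \<eta> c1 c2 c3"
    and slant: "horizontal_slant M V \<phi> \<eta> \<theta>"
    and xi: "\<xi> p \<in> H p \<or> \<xi> p \<in> V p"
    and X: "is_onb M p (H p) X"
    and s: "s = dim (H p)" and E: "E = (\<Sum>i<s. (\<eta> p (X i))\<^sup>2)"
  shows "(\<Sum>i<s. \<Sum>j<s. gm M p (curv M D p (X i) (X j) (X j)) (X i)) =
    real s * (real s - 1) * c1 p + 3 * (real s - E) * (cos (\<theta> p))\<^sup>2 * c2 p
      - 2 * (real s - 1) * E * c3 p"
proof -
  have XH: "X i \<in> H p" if "i < s" for i using onb_in[OF X] that s by simp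
  have K: "gm M p (curv M D p (X i) (X j) (X j)) (X i) =
      c1 p * (1 - (if i = j then 1 else 0)) + 3 * c2 p * (gm M p (X i) (\<phi> p (X j)))\<^sup>2 +
      c3 p * ((if i = j then 2 * (\<eta> p (X i))\<^sup>2 else 0) - (\<eta> p (X j))\<^sup>2 - (\<eta> p (X i))\<^sup>2)"
    if ij: "i < s" "j < s" for i j
  proof -
    have R: "curv M D p (X i) (X j) (X j) =
        c1 p *\<^sub>R (gm M p (X j) (X j) *\<^sub>R X i - gm M p (X i) (X j) *\<^sub>R X j) +
        c2 p *\<^sub>R (gm M p (X i) (\<phi> p (X j)) *\<^sub>R \<phi> p (X j) - gm M p (X j) (\<phi> p (X j)) *\<^sub>R \<phi> p (X i)
                + (2 * gm M p (X i) (\<phi> p (X j))) *\<^sub>R \<phi> p (X j)) +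
        c3 p *\<^sub>R ((\<eta> p (X i) * \<eta> p (X j)) *\<^sub>R X j - (\<eta> p (X j) * \<eta> p (X j)) *\<^sub>R X i
                + (gm M p (X i) (X j) * \<eta> p (X j)) *\<^sub>R \<xi> p - (gm M p (X j) (X j) * \<eta> p (X i)) *\<^sub>R \<xi> p)"
      using sf unfolding gen_sasakian_space_form_def by blast
    have g: "gm M p (X a) (X b) = (if a = b then 1 else 0)" if "a < s" "b < s" for a b
      using onb_product[OF X] that s by simp
    show ?thesis
      unfolding R
      using g[OF ij] g[OF ij(2,2)] g[OF ij(1,1)] g[OF ij(2,1)]
        gm_sym[of p "\<phi> p (X j)" "X i"] gm_sym[of p "\<xi> p" "X i"]
      by (simp add: gm_simps phi_skew_self gm_xi power2_eq_square algebra_simps)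
  qed
  have sq: "(\<Sum>i<s. (gm M p (X i) (\<phi> p (X j)))\<^sup>2) = (cos (\<theta> p))\<^sup>2 * (1 - (\<eta> p (X j))\<^sup>2)" if "j < s" for j
    using sum_squares_phi[OF X XH[OF that]] horizontal_slant_square[OF slant XH[OF that] xi]
      onb_product[OF X, of j j] that s by simp
  have d: "(\<Sum>i<s. \<Sum>j<s. 1 - (if i = j then 1 else 0)) = real s * (real s - 1)"
    by (simp add: sum_subtractf sum.delta algebra_simps)
  have P: "(\<Sum>i<s. \<Sum>j<s. (gm M p (X i) (\<phi> p (X j)))\<^sup>2) = (cos (\<theta> p))\<^sup>2 * (real s - E)"
    by (subst sum.swap) (simp add: sq E sum_subtractf flip: sum_distrib_left)
  have e: "(\<Sum>i<s. \<Sum>j<s. (if i = j then 2 * (\<eta> p (X i))\<^sup>2 else 0) - (\<eta> p (X j))\<^sup>2 - (\<eta> p (X i))\<^sup>2) =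
      - 2 * (real s - 1) * E"
    by (simp add: sum_subtractf sum.distrib sum.delta E algebra_simps flip: sum_distrib_left)
  have "(\<Sum>i<s. \<Sum>j<s. gm M p (curv M D p (X i) (X j) (X j)) (X i)) =
      c1 p * (\<Sum>i<s. \<Sum>j<s. 1 - (if i = j then 1 else 0)) +
      3 * c2 p * (\<Sum>i<s. \<Sum>j<s. (gm M p (X i) (\<phi> p (X j)))\<^sup>2) +
      c3 p * (\<Sum>i<s. \<Sum>j<s. (if i = j then 2 * (\<eta> p (X i))\<^sup>2 else 0) - (\<eta> p (X j))\<^sup>2 - (\<eta> p (X i))\<^sup>2)"
    by (simp only: sum_distrib_left flip: sum.distrib) (intro sum.cong refl, simp only: K lessThan_iff)
  then show ?thesis unfolding d P e by (simp add: algebra_simps)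
qed

lemma sum_eta_squares:
  assumes X: "is_onb M p (H p) X"
  shows "\<xi> p \<in> H p \<Longrightarrow> (\<Sum>i<dim (H p). (\<eta> p (X i))\<^sup>2) = 1"
    and "\<xi> p \<in> V p \<Longrightarrow> (\<Sum>i<dim (H p). (\<eta> p (X i))\<^sup>2) = 0"
proof -
  have eta: "\<eta> p (X i) = gm M p (\<xi> p) (X i)" for i by (simp add: gm_sym[of p "\<xi> p"] gm_xi)
  show "(\<Sum>i<dim (H p). (\<eta> p (X i))\<^sup>2) = 1" if "\<xi> p \<in> H p"
    unfolding eta using parseval[OF subspace_H X that] by (simp add: gm_xi eta_xi)
  show "(\<Sum>i<dim (H p). (\<eta> p (X i))\<^sup>2) = 0" if "\<xi> p \<in> V p"
    unfolding eta using V_H_orthogonal(1)[OF that] onb_in[OF X] by simp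
qed

text \<open>The four kinds of space forms all have constant coefficients with \<open>c2 = c3\<close>. The two alternatives
  for B are the bounds for a horizontal and for a vertical Reeb field.\<close>

lemma horizontal_bound:
  assumes sf: "gen_sasakian_space_form M D \<phi> \<xi> \<eta> (\<lambda>_. k1) (\<lambda>_. k2) (\<lambda>_. k2)"
    and slant: "horizontal_slant M V \<phi> \<eta> \<theta>"
    and s: "\<forall>p. dim (H p) = s" "3 \<le> s"
    and B: "(\<forall>p. \<xi> p \<in> H p) \<and> (\<forall>p. B p = k1 + 3 * k2 / real s * (cos (\<theta> p))\<^sup>2 - 2 * k2 / real s) \<or>
      (\<forall>p. \<xi> p \<in> V p) \<and> (\<forall>p. B p = k1 + 3 * k2 / (real s - 1) * (cos (\<theta> p))\<^sup>2)"
    and \<delta>: "\<delta> \<in> {delta_C M D V, delta_C_hat M D V}"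
  shows "(\<forall>p. hscal M D V p \<le> \<delta> p + B p) \<and>
    ((\<forall>p. hscal M D V p = \<delta> p + B p) \<longleftrightarrow> oneill_vanishes M D V)"
proof (rule casorati_bound[OF _ s(2) _ \<delta>])
  show "dim (H p) = s" for p using s(1) by simp
  fix p
  define X where "X = onb M p (H p)"
  define E where "E = (\<Sum>i<s. (\<eta> p (X i))\<^sup>2)"
  have X: "is_onb M p (H p) X" unfolding X_def by (rule is_onb_onb[OF subspace_H])
  have xi: "\<xi> p \<in> H p \<or> \<xi> p \<in> V p" using B by blast
  have sum: "(\<Sum>i<s. \<Sum>j<s. gm M p (curv M D p (X i) (X j) (X j)) (X i)) =
      real s * (real s - 1) * k1 + 3 * (real s - E) * (cos (\<theta> p))\<^sup>2 * k2 - 2 * (real s - 1) * E * k2"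
    using sum_horizontal_curvature[OF sf slant xi X s(1)[rule_format, symmetric] E_def] .
  have nz: "real s \<noteq> 0" "real s - 1 \<noteq> 0" using s(2) by auto
  have "real s * (real s - 1) * k1 + 3 * (real s - E) * (cos (\<theta> p))\<^sup>2 * k2 - 2 * (real s - 1) * E * k2 =
      real s * (real s - 1) * B p"
    using B
  proof (elim disjE conjE)
    assume h: "\<forall>p. \<xi> p \<in> H p" "\<forall>p. B p = k1 + 3 * k2 / real s * (cos (\<theta> p))\<^sup>2 - 2 * k2 / real s"
    have "E = 1" using sum_eta_squares(1)[OF X] h(1) s(1) by (simp add: E_def)
    then show ?thesis using nz by (simp add: h(2) field_simps)
  next
    assume h: "\<forall>p. \<xi> p \<in> V p" "\<forall>p. B p = k1 + 3 * k2 / (real s - 1) * (cos (\<theta> p))\<^sup>2"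
    have "E = 0" using sum_eta_squares(2)[OF X] h(1) s(1) by (simp add: E_def)
    then show ?thesis using nz by (simp add: h(2) field_simps)
  qed
  then show "hscal M D V p = B p - 3 * normA p (H p) / (real s * (real s - 1))"
    using nz sum hscal_eq[of p] s(1) by (simp add: diff_divide_distrib flip: X_def)
qed

end

theorem corollary5p2:
  fixes M1 :: "('a::{t2_space, second_countable_topology}, 'e::euclidean_space) riem_mfd"
    and M2 :: "('b::{t2_space, second_countable_topology}, 'f::euclidean_space) riem_mfd"
    and F :: "'a \<Rightarrow> 'b"
    and D :: "('a, 'e) covd"
    and \<phi> :: "'a \<Rightarrow> 'e \<Rightarrow> 'e" and \<xi> :: "'a \<Rightarrow> 'e" and \<eta> :: "'a \<Rightarrow> 'e \<Rightarrow> real"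
    and \<theta> :: "'a \<Rightarrow> real" and s :: nat and c \<alpha> :: real
  assumes "riemannian_manifold M1" and "riemannian_manifold M2"
    and "almost_contact_metric M1 \<phi> \<xi> \<eta>"
    and "levi_civita M1 D"
    and "riemannian_submersion M1 M2 F"
    and "pointwise_slant M1 (vertical M1 M2 F) \<phi> \<xi> \<theta>"
    and "horizontal_slant M1 (vertical M1 M2 F) \<phi> \<eta> \<theta>"
    and "\<forall>p. dim (orth_compl M1 (vertical M1 M2 F) p) = s" and "3 \<le> s"
  shows
    "let V = vertical M1 M2 F;
         H = orth_compl M1 V;
         xi_hor = (\<forall>p. \<xi> p \<in> H p);
         xi_ver = (\<forall>p. \<xi> p \<in> V p);
         bounded_by = (\<lambda>B. \<forall>\<delta>\<in>{delta_C M1 D V, delta_C_hat M1 D V}.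
           (\<forall>p. hscal M1 D V p \<le> \<delta> p + B p) \<and>
           ((\<forall>p. hscal M1 D V p = \<delta> p + B p) \<longleftrightarrow> oneill_vanishes M1 D V))
     in
       (sasakian_space_form M1 D \<phi> \<xi> \<eta> c \<longrightarrow>
         (xi_hor \<longrightarrow> bounded_by (\<lambda>p. (c + 3) / 4 + 3 * (c - 1) / (4 * real s) * (cos (\<theta> p))\<^sup>2 - (c - 1) / (2 * real s))) \<and>
         (xi_ver \<longrightarrow> bounded_by (\<lambda>p. (c + 3) / 4 + 3 * (c - 1) / (4 * (real s - 1)) * (cos (\<theta> p))\<^sup>2))) \<and>
       (kenmotsu_space_form M1 D \<phi> \<xi> \<eta> c \<longrightarrow>
         (xi_hor \<longrightarrow> bounded_by (\<lambda>p. (c - 3) / 4 + 3 * (c + 1) / (4 * real s) * (cos (\<theta> p))\<^sup>2 - (c + 1) / (2 * real s))) \<and>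
         (xi_ver \<longrightarrow> bounded_by (\<lambda>p. (c - 3) / 4 + 3 * (c + 1) / (4 * (real s - 1)) * (cos (\<theta> p))\<^sup>2))) \<and>
       (cosymplectic_space_form M1 D \<phi> \<xi> \<eta> c \<longrightarrow>
         (xi_hor \<longrightarrow> bounded_by (\<lambda>p. c / 4 + 3 * c / (4 * real s) * (cos (\<theta> p))\<^sup>2 - c / (2 * real s))) \<and>
         (xi_ver \<longrightarrow> bounded_by (\<lambda>p. c / 4 + 3 * c / (4 * (real s - 1)) * (cos (\<theta> p))\<^sup>2))) \<and>
       (almost_C_space_form \<alpha> M1 D \<phi> \<xi> \<eta> c \<longrightarrow>
         (xi_hor \<longrightarrow> bounded_by (\<lambda>p. (c + 3 * \<alpha>\<^sup>2) / 4 + 3 * (c - \<alpha>\<^sup>2) / (4 * real s) * (cos (\<theta> p))\<^sup>2 - (c - \<alpha>\<^sup>2) / (2 * real s))) \<and>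
         (xi_ver \<longrightarrow> bounded_by (\<lambda>p. (c + 3 * \<alpha>\<^sup>2) / 4 + 3 * (c - \<alpha>\<^sup>2) / (4 * (real s - 1)) * (cos (\<theta> p))\<^sup>2))) \<and>
       (oneill_vanishes M1 D V \<longleftrightarrow> completely_integrable M1 H)"
proof -
  interpret contact_submersion_mfd M1 D M2 F \<phi> \<xi> \<eta>
    using assms(1-5) by unfold_locales
  have hor: "\<forall>\<delta>\<in>{delta_C M1 D V, delta_C_hat M1 D V}. (\<forall>p. hscal M1 D V p \<le> \<delta> p + B p) \<and>
      ((\<forall>p. hscal M1 D V p = \<delta> p + B p) \<longleftrightarrow> oneill_vanishes M1 D V)"
    if "gen_sasakian_space_form M1 D \<phi> \<xi> \<eta> (\<lambda>_. k1) (\<lambda>_. k2) (\<lambda>_. k2)" "\<forall>p. \<xi> p \<in> H p"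
      "\<And>p. B p = k1 + 3 * k2 / real s * (cos (\<theta> p))\<^sup>2 - 2 * k2 / real s" for k1 k2 B
    using horizontal_bound[OF that(1) assms(7-9)] that(2,3) by blast
  have ver: "\<forall>\<delta>\<in>{delta_C M1 D V, delta_C_hat M1 D V}. (\<forall>p. hscal M1 D V p \<le> \<delta> p + B p) \<and>
      ((\<forall>p. hscal M1 D V p = \<delta> p + B p) \<longleftrightarrow> oneill_vanishes M1 D V)"
    if "gen_sasakian_space_form M1 D \<phi> \<xi> \<eta> (\<lambda>_. k1) (\<lambda>_. k2) (\<lambda>_. k2)" "\<forall>p. \<xi> p \<in> V p"
      "\<And>p. B p = k1 + 3 * k2 / (real s - 1) * (cos (\<theta> p))\<^sup>2" for k1 k2 B
    using horizontal_bound[OF that(1) assms(7-9)] that(2,3) by blast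
  have s: "real s \<noteq> 0" "real s - 1 \<noteq> 0" using assms(9) by auto
  show ?thesis
    unfolding Let_def sasakian_space_form_def kenmotsu_space_form_def cosymplectic_space_form_def
      almost_C_space_form_def
    by (intro conjI impI oneill_vanishes_iff_integrable;
        (erule (1) hor | erule (1) ver); use s in \<open>simp add: field_simps\<close>)
qed

end
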